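(* Let $\frac12 \le \theta < 1$, $\frac12 < \sigma_0 < 1$, and let $A(\sigma)$, $0 \le \sigma \le 1$, be a non-negative function such that 1. $A(\sigma_0) = \dfrac{1}{2(1-\sigma_0)}$; 2. $A(\sigma)$ is monotonically non-increasing for $\sigma \ge \sigma_0$. Assume that there exists a constant $B$ such that $$N(\sigma, T) \ll T^{A(\sigma)(1-\sigma)} \log^{B} T$$ uniformly for $\frac12 \le \sigma \le 1$. Put $T = x^{1-\theta}$, $M = x^{u}$, $N = x^{v}$, where $u, v$ satisfy $$\frac{2\sigma_0 - 2\theta}{2\sigma_0 - 1} \le u + v \le 1,$$ $$u(2 - 2\sigma_0) + v(1 - 2\sigma_0) \le \theta + 1 - 2\sigma_0,$$ $$v(2 - 2\sigma_0) + u(1 - 2\sigma_0) \le \theta + 1 - 2\sigma_0,$$ and suppose that $$\theta \le \frac{3 - 2\sigma_0}{7 - 6\sigma_0}.$$ Let $\{a_m\}_{m\in\mathbb{N}}$, $\{b_n\}_{n \in \mathbb{N}}$ be real sequences with $0 \le a_m \le 1$, $0 \le b_n \le 1$, and let $$M(s) = \sum_{m \sim M} a_m m^{-s}, \qquad N(s) = \sum_{n \sim N} b_n n^{-s}.$$ Then there is a constant $c$ depending on $B$ such that $$\sum_{\substack{\rho \\ \beta \ge \sigma,\ |\gamma| \le T}} \left| M(\rho) N(\rho) \right| \ll x^{1-\sigma} (\log x)^{c}$$ uniformly for $0 \le \sigma \le 1$, where the sum is over all non-trivial zeroes $\rho = \beta + i\gamma$ of $\zeta$ with $\beta \ge \sigma$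 and $|\gamma| \le T$.
   Context: $\zeta$ is the Riemann zeta function. $N(\sigma, T)$ (two arguments) denotes the number of zeroes $\rho = \beta + i\gamma$ of $\zeta$ (counted with multiplicity) with $\sigma \le \beta \le 1$, $0 < \gamma \le T$; it is unrelated to the number $N = x^v$ and to the Dirichlet polynomial $N(s)$. The notation $m \sim M$ means $M \le m < 2M$, with $m$ an integer. The zero-density hypothesis is understood as $T \to \infty$ with $T$ a free variable, and the conclusion is for large $x$. Sums over zeroes count multiplicity. *)

theory Defs
  imports "HOL-Complex_Analysis.Complex_Analysis"
begin

(* The analytic continuation is unique on the connected set UNIV - {1}; the value at the pole s = 1
   is a dummy value, so s = 1 has to be excluded whenever zeros are considered. *)
definition zeta :: "complex \<Rightarrow> complex" where
  "zeta = (THE f. f holomorphic_on (UNIV - {1}) \<and>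
     (\<forall>s. Re s > 1 \<longrightarrow> (\<lambda>n. of_nat (Suc n) powr (-s)) sums f s) \<and> f 1 = 0)"

definition zero_mult :: "complex \<Rightarrow> nat" where
  "zero_mult \<rho> = nat (zorder zeta \<rho>)"

definition nontrivial_zeros :: "complex set" where
  "nontrivial_zeros = {\<rho>. \<rho> \<noteq> 1 \<and> zeta \<rho> = 0 \<and> 0 \<le> Re \<rho> \<and> Re \<rho> \<le> 1}"

definition zero_count :: "real \<Rightarrow> real \<Rightarrow> nat" where
  "zero_count \<sigma> T =
     (\<Sum>\<rho> | zeta \<rho> = 0 \<and> \<sigma> \<le> Re \<rho> \<and> Re \<rho> \<le> 1 \<and> 0 < Im \<rho> \<and> Im \<rho> \<le> T. zero_mult \<rho>)"

(* Used only for X > 0, so the index m = 0 never occurs. *)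
definition dirichlet_poly :: "(nat \<Rightarrow> real) \<Rightarrow> real \<Rightarrow> complex \<Rightarrow> complex" where
  "dirichlet_poly a X s =
     (\<Sum>m | X \<le> real m \<and> real m < 2 * X. complex_of_real (a m) * of_nat m powr (-s))"

(* The implied constant and the threshold for T do not depend on \<sigma>. *)
definition zero_density :: "(real \<Rightarrow> real) \<Rightarrow> real \<Rightarrow> bool" where
  "zero_density A B \<longleftrightarrow> (\<exists>C T0. \<forall>T\<ge>T0. \<forall>\<sigma>\<in>{1/2..1}.
     real (zero_count \<sigma> T) \<le> C * T powr (A \<sigma> * (1 - \<sigma>)) * ln T powr B)"

end

theory Submission
  imports Defs
begin

text \<open>Put \<open>T = x\<^sup>1\<^sup>-\<^sup>\<theta>\<close> and let \<open>D\<close> bound \<open>\<Sum>\<^sub>\<rho>\<^sub>' 1 / (1 + \<bar>\<gamma> - \<gamma>'\<bar>)\<close> for every zero \<open>\<rho>\<close>; the local density of the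
  zeros gives \<open>D \<lless> log\<^sup>2 T\<close>. By duality \<open>\<Sum>\<^sub>\<rho> \<bar>M(\<rho>)\<bar>\<^sup>2\<close> is controlled by quadratic forms in the zeros, which
  are estimated in two ways. Comparing the sum over \<open>m\<close> with the integral over \<open>log m\<close> (Gallagher) gives the
  mean value bound \<open>D M\<^sup>1\<^sup>-\<^sup>2\<^sup>\<sigma> (M + T)\<close>; bounding \<open>\<Sum> m\<^sup>-\<^sup>i\<^sup>t \<lless> M / \<bar>t\<bar> + \<bar>t\<bar>\<^sup>1\<^sup>/\<^sup>2\<close> by van der Corput's method gives
  the Halasz-Montgomery bound \<open>M\<^sup>1\<^sup>-\<^sup>2\<^sup>\<sigma> (D M + R T\<^sup>1\<^sup>/\<^sup>2)\<close>, where \<open>R\<close> is the number of zeros.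
  After Cauchy-Schwarz the first suffices for \<open>\<sigma> \<le> \<sigma>\<^sub>0\<close>. For \<open>\<sigma> \<ge> \<sigma>\<^sub>0\<close> the zero density hypothesis gives
  \<open>R \<lless> T\<^sup>\<kappa> log\<^sup>B T\<close> with \<open>\<kappa> = (1 - \<sigma>) / (2 (1 - \<sigma>\<^sub>0))\<close>; the second bound then has the same strength at \<open>\<sigma>\<^sub>0\<close>, and
  all exponents are affine in \<open>\<sigma>\<close>, so that only the endpoint \<open>\<sigma> = 1\<close> remains to be checked.\<close>

section \<open>Discrete mean values\<close>

text \<open>Zeros may cluster and have multiplicities, so no well-spaced subset is extracted:
  multiplicities act as weights \<open>w\<close>, and clustering enters only through row sums of the
  kernel 1 / (1 + |\<gamma> - \<gamma>'|), to which both quadratic forms are reduced. Duality is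
  needed because the coefficients of the polynomials are arbitrary: in the dual form the sum over m
  has coefficients 1, so it can be compared with an integral or estimated as a zeta sum. Since
  \<open>zeta\<close> is a definite description, its continuation has to be constructed before
  anything can be said about zeros. The construction also has to deliver polynomial growth in half
  planes, which Jensen's inequality turns into O(log t) zeros near height t, the local density
  behind D. It is carried out for the entire function (s - 1) zeta(s), so that discs containing s =
  1 need no separate treatment.\<close>

lemma weighted_row_sum_bound:
  fixes w :: "'a \<Rightarrow> real" and c :: "'a \<Rightarrow> 'b :: real_normed_vector"
  assumes w: "\<And>r. r \<in> S \<Longrightarrow> w r \<ge> 0" and K: "\<And>r s. K r s \<ge> 0" "\<And>r s. K r s = K s r"
    and D: "\<And>r. r \<in> S \<Longrightarrow> (\<Sum>s\<in>S. w s * K r s) \<le> D"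
  shows "(\<Sum>r\<in>S. \<Sum>s\<in>S. w r * w s * norm (c r) * norm (c s) * K r s) \<le> D * (\<Sum>r\<in>S. w r * (norm (c r))\<^sup>2)"
proof -
  have 1: "(\<Sum>r\<in>S. \<Sum>s\<in>S. w r * w s * (norm (c r))\<^sup>2 * K r s) \<le> D * (\<Sum>r\<in>S. w r * (norm (c r))\<^sup>2)"
  proof -
    have "(\<Sum>r\<in>S. \<Sum>s\<in>S. w r * w s * (norm (c r))\<^sup>2 * K r s) = (\<Sum>r\<in>S. w r * (norm (c r))\<^sup>2 * (\<Sum>s\<in>S. w s * K r s))"
      by (simp add: sum_distrib_left algebra_simps)
    also have "\<dots> \<le> (\<Sum>r\<in>S. w r * (norm (c r))\<^sup>2 * D)"
      using w D by (intro sum_mono mult_left_mono) auto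
    finally show ?thesis by (simp add: sum_distrib_left algebra_simps)
  qed
  have 2: "(\<Sum>r\<in>S. \<Sum>s\<in>S. w r * w s * (norm (c s))\<^sup>2 * K r s) = (\<Sum>r\<in>S. \<Sum>s\<in>S. w r * w s * (norm (c r))\<^sup>2 * K r s)"
    by (subst sum.swap) (simp add: K(2) mult.commute mult.left_commute)
  \<comment> \<open>Schur's test: a product of two norms is at most half the sum of their squares,
    and by symmetry of \<open>K\<close> both halves give the same double sum, whose rows are bounded
    by \<open>D\<close>.\<close>
  have "(\<Sum>r\<in>S. \<Sum>s\<in>S. w r * w s * norm (c r) * norm (c s) * K r s)
     \<le> (\<Sum>r\<in>S. \<Sum>s\<in>S. (w r * w s * (norm (c r))\<^sup>2 * K r s + w r * w s * (norm (c s))\<^sup>2 * K r s) / 2)"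
  proof (intro sum_mono)
    fix r s assume "r \<in> S" "s \<in> S"
    have "norm (c r) * norm (c s) \<le> ((norm (c r))\<^sup>2 + (norm (c s))\<^sup>2) / 2"
      using sum_squares_bound[of "norm (c r)" "norm (c s)"] by simp
    then have "(w r * w s * K r s) * (norm (c r) * norm (c s)) \<le> (w r * w s * K r s) * (((norm (c r))\<^sup>2 + (norm (c s))\<^sup>2) / 2)"
      using w \<open>r \<in> S\<close> \<open>s \<in> S\<close> K by (intro mult_left_mono) auto
    then show "w r * w s * norm (c r) * norm (c s) * K r s
       \<le> (w r * w s * (norm (c r))\<^sup>2 * K r s + w r * w s * (norm (c s))\<^sup>2 * K r s) / 2"
      by (simp add: algebra_simps add_divide_distrib)
  qed
  also have "\<dots> = (\<Sum>r\<in>S. \<Sum>s\<in>S. w r * w s * (norm (c r))\<^sup>2 * K r s)"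
    using 2 by (simp add: sum_divide_distrib[symmetric] sum.distrib)
  also note 1
  finally show ?thesis .
qed

text \<open>An operator and its adjoint have the same norm. With the test vector
  \<open>c r = cnj (f r)\<close> the left side \<open>Q\<close> becomes the sum of
  \<open>a m * G m\<close>; Cauchy-Schwarz and \<open>gram\<close> give
  \<open>Q\<^sup>2 \<le> \<Delta> * card M * Q\<close>, and one factor \<open>Q\<close>
  cancels.\<close>

lemma duality:
  fixes w :: "'a \<Rightarrow> real" and e :: "nat \<Rightarrow> 'a \<Rightarrow> complex"
  assumes w: "\<And>r. r \<in> S \<Longrightarrow> w r \<ge> 0" and a: "\<And>m. \<bar>a m\<bar> \<le> 1" and "\<Delta> \<ge> 0"
    and gram: "\<And>c :: 'a \<Rightarrow> complex. (\<Sum>m\<in>M. (norm (\<Sum>r\<in>S. of_real (w r) * c r * e m r))\<^sup>2) \<le> \<Delta> * (\<Sum>r\<in>S. w r * (norm (c r))\<^sup>2)"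
  shows "(\<Sum>r\<in>S. w r * (norm (\<Sum>m\<in>M. of_real (a m) * e m r))\<^sup>2) \<le> \<Delta> * real (card M)"
proof -
  define f where "f = (\<lambda>r. \<Sum>m\<in>M. of_real (a m) * e m r)"
  define G where "G = (\<lambda>m. \<Sum>r\<in>S. of_real (w r) * cnj (f r) * e m r)"
  define Q where "Q = (\<Sum>r\<in>S. w r * (norm (f r))\<^sup>2)"
  have Q0: "Q \<ge> 0" unfolding Q_def using w by (intro sum_nonneg) auto
  have "of_real Q = (\<Sum>r\<in>S. of_real (w r) * cnj (f r) * f r)"
    unfolding Q_def of_real_sum of_real_mult
    by (intro sum.cong refl) (simp add: complex_norm_square mult.assoc mult.commute del: of_real_power)
  also have "\<dots> = (\<Sum>r\<in>S. \<Sum>m\<in>M. of_real (a m) * (of_real (w r) * cnj (f r) * e m r))"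
    by (intro sum.cong refl) (subst (2) f_def, simp add: sum_distrib_left algebra_simps)
  also have "\<dots> = (\<Sum>m\<in>M. of_real (a m) * G m)"
    by (subst sum.swap) (simp add: G_def sum_distrib_left)
  finally have "Q = norm (\<Sum>m\<in>M. of_real (a m) * G m)" using Q0 by (metis abs_of_nonneg norm_of_real)
  also have "\<dots> \<le> (\<Sum>m\<in>M. norm (G m))"
  proof (intro sum_norm_le)
    fix m show "norm (of_real (a m) * G m) \<le> norm (G m)"
      using mult_right_mono[OF a[of m] norm_ge_zero[of "G m"]] by (simp add: norm_mult)
  qed
  finally have "Q\<^sup>2 \<le> (\<Sum>m\<in>M. norm (G m))\<^sup>2" using Q0 by (intro power_mono) auto
  also have "\<dots> \<le> real (card M) * (\<Sum>m\<in>M. (norm (G m))\<^sup>2)"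
    using Cauchy_Schwarz_ineq_sum[of "\<lambda>_. 1" "\<lambda>m. norm (G m)" M] by simp
  also have "\<dots> \<le> real (card M) * (\<Delta> * Q)"
    using gram[of "\<lambda>r. cnj (f r)"] by (intro mult_left_mono) (auto simp: G_def Q_def)
  finally have "Q * Q \<le> (\<Delta> * real (card M)) * Q" by (simp add: power2_eq_square algebra_simps)
  then have "Q \<le> \<Delta> * real (card M)"
    using Q0 \<open>\<Delta> \<ge> 0\<close> by (cases "Q = 0") auto
  then show ?thesis by (simp add: Q_def f_def)
qed

text \<open>For |Im z| <= 1 the length of the interval, at most 2, suffices; otherwise the primitive
  gives a factor 2 / |z|, and |z| is at least (1 + |Im z|) / 2. The resulting denominator is the one
  in the row sums \<open>D\<close>.\<close>

lemma norm_integral_exp_le: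
  fixes z :: complex
  assumes "0 \<le> \<alpha>" "\<alpha> \<le> \<beta>" "\<beta> \<le> \<alpha> + 2" and re: "Re z \<ge> s" "s \<ge> 0"
  shows "(\<lambda>y. exp (- z * of_real y)) integrable_on {\<alpha>..\<beta>}"
    and "norm (integral {\<alpha>..\<beta>} (\<lambda>y. exp (- z * of_real y))) \<le> 4 * exp (- s * \<alpha>) / (1 + \<bar>Im z\<bar>)"
proof -
  show int: "(\<lambda>y. exp (- z * of_real y)) integrable_on {\<alpha>..\<beta>}"
    by (intro integrable_continuous_real continuous_intros)
  have le: "norm (exp (- z * of_real y)) \<le> exp (- s * \<alpha>)" if "\<alpha> \<le> y" for y
    using that assms by (auto intro!: mult_mono)
  have triv: "norm (integral {\<alpha>..\<beta>} (\<lambda>y. exp (- z * of_real y))) \<le> exp (- s * \<alpha>) * (\<beta> - \<alpha>)"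
    using assms le by (intro integral_bound continuous_intros) auto
  show "norm (integral {\<alpha>..\<beta>} (\<lambda>y. exp (- z * of_real y))) \<le> 4 * exp (- s * \<alpha>) / (1 + \<bar>Im z\<bar>)"
  proof (cases "\<bar>Im z\<bar> \<le> 1")
    case True
    have "exp (- s * \<alpha>) * (\<beta> - \<alpha>) \<le> exp (- s * \<alpha>) * (4 / (1 + \<bar>Im z\<bar>))"
    proof (rule mult_left_mono)
      have "2 \<le> 4 / (1 + \<bar>Im z\<bar>)" using True by (simp add: field_simps)
      then show "\<beta> - \<alpha> \<le> 4 / (1 + \<bar>Im z\<bar>)" using assms by linarith
    qed auto
    then show ?thesis using triv by (simp add: mult.commute)
  next
    case False
    then have z: "z \<noteq> 0" by auto
    have "((\<lambda>y. exp (- z * of_real y)) has_integral (exp (- z * of_real \<beta>) / (- z) - exp (- z * of_real \<alpha>) / (- z))) {\<alpha>..\<beta>}"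
    proof (rule fundamental_theorem_of_calculus[OF assms(2)])
      fix x
      have "((\<lambda>y. exp (- z * y) / (- z)) has_field_derivative exp (- z * of_real x)) (at (of_real x))"
        using z by (auto intro!: derivative_eq_intros)
      then show "((\<lambda>y. exp (- z * of_real y) / (- z)) has_vector_derivative exp (- z * of_real x)) (at x within {\<alpha>..\<beta>})"
        by (rule has_vector_derivative_real_field)
    qed
    then have "norm (integral {\<alpha>..\<beta>} (\<lambda>y. exp (- z * of_real y))) = norm (exp (- z * of_real \<beta>) / (- z) - exp (- z * of_real \<alpha>) / (- z))"
      by (simp add: integral_unique)
    also have "\<dots> \<le> norm (exp (- z * of_real \<beta>) / (- z)) + norm (exp (- z * of_real \<alpha>) / (- z))"
      by (rule norm_triangle_ineq4)
    also have "\<dots> \<le> exp (- s * \<alpha>) / norm z + exp (- s * \<alpha>) / norm z"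
      unfolding norm_divide norm_minus_cancel
      using le assms by (intro add_mono divide_right_mono) auto
    also have "\<dots> = 2 * exp (- s * \<alpha>) / norm z" by simp
    also have "\<dots> \<le> 2 * exp (- s * \<alpha>) / ((1 + \<bar>Im z\<bar>) / 2)"
      using False abs_Im_le_cmod[of z] by (intro divide_left_mono) (auto intro!: mult_pos_pos simp: z)
    finally show ?thesis by simp
  qed
qed

text \<open>Expanding the square produces the exponents \<open>\<rho> + cnj \<rho>'\<close>, with
  real part at least \<open>2 * \<sigma>\<close> and imaginary part
  \<open>Im \<rho> - Im \<rho>'\<close>. Their integrals decay away from the diagonal, so Schur's
  test applies with a multiple of \<open>D\<close>.\<close>

lemma integral_norm_exp_sum_le:
  fixes S :: "complex set" and w :: "complex \<Rightarrow> real"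
  assumes S: "finite S" "\<And>\<rho>. \<rho> \<in> S \<Longrightarrow> w \<rho> \<ge> 0" "\<And>\<rho>. \<rho> \<in> S \<Longrightarrow> \<sigma> \<le> Re \<rho>" "\<sigma> \<ge> 0"
    and D: "\<And>\<rho>. \<rho> \<in> S \<Longrightarrow> (\<Sum>\<rho>'\<in>S. w \<rho>' / (1 + \<bar>Im \<rho> - Im \<rho>'\<bar>)) \<le> D"
    and ab: "0 \<le> \<alpha>" "\<alpha> \<le> \<beta>" "\<beta> \<le> \<alpha> + 2"
  shows "integral {\<alpha>..\<beta>} (\<lambda>y. (norm (\<Sum>\<rho>\<in>S. of_real (w \<rho>) * c \<rho> * exp (- \<rho> * of_real y)))\<^sup>2)
     \<le> 4 * exp (- 2 * \<sigma> * \<alpha>) * D * (\<Sum>\<rho>\<in>S. w \<rho> * (norm (c \<rho>))\<^sup>2)"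
proof -
  define g where "g = (\<lambda>y::real. \<Sum>\<rho>\<in>S. of_real (w \<rho>) * c \<rho> * exp (- \<rho> * of_real y))"
  define I :: "complex \<Rightarrow> complex" where "I = (\<lambda>z. integral {\<alpha>..\<beta>} (\<lambda>y. exp (- z * of_real y)))"
  define E where "E = exp (- (2 * \<sigma>) * \<alpha>)"
  have gg: "complex_of_real ((norm (g y))\<^sup>2)
     = (\<Sum>\<rho>\<in>S. \<Sum>\<rho>'\<in>S. (of_real (w \<rho>) * c \<rho> * of_real (w \<rho>') * cnj (c \<rho>')) * exp (- (\<rho> + cnj \<rho>') * of_real y))" for y
  proof -
    have "complex_of_real ((norm (g y))\<^sup>2) = g y * cnj (g y)" by (rule complex_norm_square)
    also have "\<dots> = (\<Sum>\<rho>\<in>S. \<Sum>\<rho>'\<in>S. (of_real (w \<rho>) * c \<rho> * exp (- \<rho> * of_real y)) *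
         (of_real (w \<rho>') * cnj (c \<rho>') * exp (- cnj \<rho>' * of_real y)))"
      by (simp add: g_def sum_product exp_cnj)
    also have "\<dots> = (\<Sum>\<rho>\<in>S. \<Sum>\<rho>'\<in>S. (of_real (w \<rho>) * c \<rho> * of_real (w \<rho>') * cnj (c \<rho>')) * exp (- (\<rho> + cnj \<rho>') * of_real y))"
      by (intro sum.cong refl) (simp add: exp_add[symmetric] algebra_simps exp_diff exp_minus divide_inverse)
    finally show ?thesis .
  qed
  have int: "((\<lambda>y. exp (- (\<rho> + cnj \<rho>') * of_real y)) has_integral I (\<rho> + cnj \<rho>')) {\<alpha>..\<beta>}"
    if "\<rho> \<in> S" "\<rho>' \<in> S" for \<rho> \<rho>'
    unfolding I_def
    by (intro integrable_integral integrable_continuous_real continuous_intros)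
  have "((\<lambda>y. complex_of_real ((norm (g y))\<^sup>2)) has_integral
     (\<Sum>\<rho>\<in>S. \<Sum>\<rho>'\<in>S. (of_real (w \<rho>) * c \<rho> * of_real (w \<rho>') * cnj (c \<rho>')) * I (\<rho> + cnj \<rho>'))) {\<alpha>..\<beta>}"
    unfolding gg by (intro has_integral_sum S(1) has_integral_mult_right int)
  then have eq: "integral {\<alpha>..\<beta>} (\<lambda>y. complex_of_real ((norm (g y))\<^sup>2)) =
     (\<Sum>\<rho>\<in>S. \<Sum>\<rho>'\<in>S. (of_real (w \<rho>) * c \<rho> * of_real (w \<rho>') * cnj (c \<rho>')) * I (\<rho> + cnj \<rho>'))"
    by (rule integral_unique)
  have cont: "continuous_on {\<alpha>..\<beta>} (\<lambda>y. (norm (g y))\<^sup>2)"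
    unfolding g_def by (intro continuous_intros)
  have "integral {\<alpha>..\<beta>} (\<lambda>y. complex_of_real ((norm (g y))\<^sup>2)) = complex_of_real (integral {\<alpha>..\<beta>} (\<lambda>y. (norm (g y))\<^sup>2))"
    using integral_linear[OF integrable_continuous_real[OF cont] bounded_linear_of_real [where 'a = complex]]
    by (simp add: o_def)
  then have "integral {\<alpha>..\<beta>} (\<lambda>y. (norm (g y))\<^sup>2) = Re (integral {\<alpha>..\<beta>} (\<lambda>y. complex_of_real ((norm (g y))\<^sup>2)))"
    by simp
  also have "\<dots> \<le> norm (integral {\<alpha>..\<beta>} (\<lambda>y. complex_of_real ((norm (g y))\<^sup>2)))" by (rule complex_Re_le_cmod)
  also have "\<dots> \<le> (\<Sum>\<rho>\<in>S. \<Sum>\<rho>'\<in>S. w \<rho> * w \<rho>' * norm (c \<rho>) * norm (c \<rho>') * (4 * E / (1 + \<bar>Im \<rho> - Im \<rho>'\<bar>)))"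
    unfolding eq
  proof (intro sum_norm_le)
    fix \<rho> \<rho>' assume r: "\<rho> \<in> S" "\<rho>' \<in> S"
    have "norm (I (\<rho> + cnj \<rho>')) \<le> 4 * E / (1 + \<bar>Im \<rho> - Im \<rho>'\<bar>)"
      using norm_integral_exp_le(2)[OF ab, of "2 * \<sigma>" "\<rho> + cnj \<rho>'"] S(3)[OF r(1)] S(3)[OF r(2)] S(4)
      by (simp add: I_def E_def del: minus_add_distrib)
    then have "(w \<rho> * w \<rho>' * norm (c \<rho>) * norm (c \<rho>')) * norm (I (\<rho> + cnj \<rho>')) \<le>
       (w \<rho> * w \<rho>' * norm (c \<rho>) * norm (c \<rho>')) * (4 * E / (1 + \<bar>Im \<rho> - Im \<rho>'\<bar>))"
      using S(2) r by (intro mult_left_mono) auto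
    then show "norm (of_real (w \<rho>) * c \<rho> * of_real (w \<rho>') * cnj (c \<rho>') * I (\<rho> + cnj \<rho>'))
       \<le> w \<rho> * w \<rho>' * norm (c \<rho>) * norm (c \<rho>') * (4 * E / (1 + \<bar>Im \<rho> - Im \<rho>'\<bar>))"
      using S(2) r by (simp add: norm_mult algebra_simps)
  qed
  also have "\<dots> \<le> (4 * E * D) * (\<Sum>\<rho>\<in>S. w \<rho> * (norm (c \<rho>))\<^sup>2)"
  proof (rule weighted_row_sum_bound)
    fix \<rho> assume r: "\<rho> \<in> S"
    have "(\<Sum>\<rho>'\<in>S. w \<rho>' * (4 * E / (1 + \<bar>Im \<rho> - Im \<rho>'\<bar>))) = 4 * E * (\<Sum>\<rho>'\<in>S. w \<rho>' / (1 + \<bar>Im \<rho> - Im \<rho>'\<bar>))"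
      by (simp add: sum_distrib_left algebra_simps)
    also have "\<dots> \<le> 4 * E * D" using D[OF r] by (intro mult_left_mono) (auto simp: E_def)
    finally show "(\<Sum>\<rho>'\<in>S. w \<rho>' * (4 * E / (1 + \<bar>Im \<rho> - Im \<rho>'\<bar>))) \<le> 4 * E * D" .
  qed (use S in \<open>auto simp: E_def abs_minus_commute\<close>)
  finally show ?thesis by (simp add: g_def E_def)
qed

text \<open>Gallagher's lemma: integrating the derivative of \<open>(b - y) * h y\<close> recovers
  \<open>(b - a) * h a\<close> from \<open>h\<close> and \<open>h'\<close>. The parameter
  \<open>\<tau>\<close> weights the arithmetic-geometric mean inequality; it is later a bound for
  the |\<rho>|, which makes the two terms comparable.\<close>

lemma gallagher_pointwise:
  fixes g g' :: "real \<Rightarrow> complex"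
  assumes "a < b" "\<tau> > 0"
    and g: "\<And>x. x \<in> {a..b} \<Longrightarrow> (g has_vector_derivative g' x) (at x within {a..b})"
    and g': "continuous_on {a..b} g'"
  shows "(norm (g a))\<^sup>2 \<le> (1 / (b - a) + \<tau>) * integral {a..b} (\<lambda>y. (norm (g y))\<^sup>2)
            + 1 / \<tau> * integral {a..b} (\<lambda>y. (norm (g' y))\<^sup>2)"
proof -
  define h where "h y = (norm (g y))\<^sup>2" for y
  define h' where "h' y = 2 * (g y \<bullet> g' y)" for y
  define k where "k y = (norm (g' y))\<^sup>2" for y
  have contg: "continuous_on {a..b} g"
    using g by (meson continuous_on_vector_derivative)
  have h: "(h has_real_derivative h' x) (at x within {a..b})" if "x \<in> {a..b}" for x
  proof -
    have "((\<lambda>y. g y \<bullet> g y) has_vector_derivative (g x \<bullet> g' x + g' x \<bullet> g x)) (at x within {a..b})"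
      by (rule bounded_bilinear.has_vector_derivative[OF bounded_bilinear_inner g[OF that] g[OF that]])
    then show ?thesis
      by (simp add: has_real_derivative_iff_has_vector_derivative h_def [abs_def] h'_def power2_norm_eq_inner inner_commute)
  qed
  have "((\<lambda>y. - h y + (b - y) * h' y) has_integral ((b - b) * h b - (b - a) * h a)) {a..b}"
  proof (rule fundamental_theorem_of_calculus)
    show "((\<lambda>y. (b - y) * h y) has_vector_derivative - h x + (b - x) * h' x) (at x within {a..b})"
      if "x \<in> {a..b}" for x
      unfolding has_real_derivative_iff_has_vector_derivative[symmetric]
      using h[OF that] by (auto intro!: derivative_eq_intros)
  qed (use assms in auto)
  then have 1: "((\<lambda>y. h y - (b - y) * h' y) has_integral ((b - a) * h a)) {a..b}"
    by (drule_tac has_integral_neg) (simp add: algebra_simps)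
  have ih: "(h has_integral integral {a..b} h) {a..b}" "(k has_integral integral {a..b} k) {a..b}"
    unfolding h_def k_def
    by (intro integrable_integral integrable_continuous_real continuous_intros contg g')+
  have 2: "((\<lambda>y. h y + (b - a) * (\<tau> * h y + 1 / \<tau> * k y)) has_integral
      (integral {a..b} h + (b - a) * (\<tau> * integral {a..b} h + 1 / \<tau> * integral {a..b} k))) {a..b}"
    by (intro has_integral_add has_integral_mult_right ih)
  have "(b - a) * h a \<le> integral {a..b} h + (b - a) * (\<tau> * integral {a..b} h + 1 / \<tau> * integral {a..b} k)"
  proof (rule has_integral_le[OF 1 2])
    fix y assume y: "y \<in> {a..b}"
    have "- h' y \<le> 2 * (norm (g y) * norm (g' y))"
      using norm_cauchy_schwarz[of "- g y" "g' y"] by (simp add: h'_def)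
    also have "\<dots> = 2 * (sqrt \<tau> * norm (g y)) * (norm (g' y) / sqrt \<tau>)" using assms by simp
    also have "\<dots> \<le> (sqrt \<tau> * norm (g y))\<^sup>2 + (norm (g' y) / sqrt \<tau>)\<^sup>2" by (rule sum_squares_bound)
    also have "\<dots> = \<tau> * h y + 1 / \<tau> * k y"
      using assms by (simp add: h_def k_def power_mult_distrib power_divide)
    finally have 3: "- h' y \<le> \<tau> * h y + 1 / \<tau> * k y" .
    have "(b - y) * (- h' y) \<le> (b - y) * (\<tau> * h y + 1 / \<tau> * k y)"
      using 3 y by (intro mult_left_mono) auto
    also have "\<dots> \<le> (b - a) * (\<tau> * h y + 1 / \<tau> * k y)"
      using y assms by (intro mult_right_mono) (auto simp: h_def k_def)
    finally show "h y - (b - y) * h' y \<le> h y + (b - a) * (\<tau> * h y + 1 / \<tau> * k y)" by simp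
  qed
  then have "h a \<le> (integral {a..b} h + (b - a) * (\<tau> * integral {a..b} h + 1 / \<tau> * integral {a..b} k)) / (b - a)"
    using assms by (simp add: field_simps)
  also have "\<dots> = (1 / (b - a) + \<tau>) * integral {a..b} h + 1 / \<tau> * integral {a..b} k"
    using assms by (simp add: field_simps)
  finally show ?thesis by (simp add: h_def [abs_def] k_def [abs_def])
qed

lemma sum_integral_log_intervals:
  fixes h :: "real \<Rightarrow> real"
  assumes "1 \<le> p" "p \<le> q" and h: "continuous_on UNIV h"
  shows "(\<Sum>m\<in>{p..<q}. integral {ln (real m)..ln (real (Suc m))} h) = integral {ln (real p)..ln (real q)} h"
  using assms(2)
proof (induction q rule: dec_induct)
  case (step n)
  have "integral {ln (real p)..ln (real n)} h + integral {ln (real n)..ln (real (Suc n))} h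
     = integral {ln (real p)..ln (real (Suc n))} h"
    using step assms
    by (intro Henstock_Kurzweil_Integration.integral_combine integrable_continuous_real continuous_on_subset[OF h]) (auto intro!: ln_mono)
  then show ?case using step by simp
qed auto

lemma of_nat_powr_eq_exp: "m \<ge> 1 \<Longrightarrow> of_nat m powr (- z) = exp (- z * complex_of_real (ln (real m)))"
  by (simp add: powr_def Ln_of_nat)

lemma ln_Suc_minus_ln_ge:
  assumes "m \<ge> 1"
  shows "ln (real (Suc m)) - ln (real m) \<ge> 1 / real (Suc m)"
proof -
  have "ln (real m / real (Suc m)) \<le> real m / real (Suc m) - 1"
    using assms by (intro ln_le_minus_one) auto
  also have "\<dots> = - 1 / real (Suc m)" by (simp add: field_simps)
  finally show ?thesis using assms by (simp add: ln_div del: of_nat_Suc)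
qed

text \<open>The inner sums are values at \<open>ln m\<close> of one exponential sum
  \<open>g\<close>. The intervals between consecutive logarithms tile [ln p, ln q] and have length
  at least 1 / q, whence \<open>real q\<close>. The derivative \<open>g'\<close> is a sum of the
  same kind with coefficients multiplied by \<open>- \<rho>\<close>; this costs
  \<open>\<tau>\<^sup>2\<close> in mean square, which the \<open>1 / \<tau>\<close> of Gallagher's
  lemma reduces to \<open>\<tau>\<close>.\<close>

lemma large_sieve_gram:
  fixes S :: "complex set" and w :: "complex \<Rightarrow> real"
  assumes S: "finite S" "\<And>\<rho>. \<rho> \<in> S \<Longrightarrow> w \<rho> \<ge> 0" "\<And>\<rho>. \<rho> \<in> S \<Longrightarrow> \<sigma> \<le> Re \<rho>" "\<sigma> \<ge> 0"
    and \<tau>: "\<And>\<rho>. \<rho> \<in> S \<Longrightarrow> norm \<rho> \<le> \<tau>" "\<tau> > 0"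
    and D: "\<And>\<rho>. \<rho> \<in> S \<Longrightarrow> (\<Sum>\<rho>'\<in>S. w \<rho>' / (1 + \<bar>Im \<rho> - Im \<rho>'\<bar>)) \<le> D" "D \<ge> 0"
    and pq: "1 \<le> p" "p \<le> q" "q \<le> 3 * p"
  shows "(\<Sum>m\<in>{p..<q}. (norm (\<Sum>\<rho>\<in>S. of_real (w \<rho>) * c \<rho> * of_nat m powr (- \<rho>)))\<^sup>2)
     \<le> 4 * real p powr (- 2 * \<sigma>) * D * (real q + 2 * \<tau>) * (\<Sum>\<rho>\<in>S. w \<rho> * (norm (c \<rho>))\<^sup>2)"
proof -
  define g where "g = (\<lambda>y::real. \<Sum>\<rho>\<in>S. of_real (w \<rho>) * c \<rho> * exp (- \<rho> * of_real y))"
  define g' where "g' = (\<lambda>y::real. \<Sum>\<rho>\<in>S. of_real (w \<rho>) * (- \<rho> * c \<rho>) * exp (- \<rho> * of_real y))"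
  define \<alpha> where "\<alpha> = ln (real p)"
  define \<beta> where "\<beta> = ln (real q)"
  define N where "N = (\<Sum>\<rho>\<in>S. w \<rho> * (norm (c \<rho>))\<^sup>2)"
  have ab: "0 \<le> \<alpha>" "\<alpha> \<le> \<beta>" "\<beta> \<le> \<alpha> + 2"
  proof -
    \<comment> \<open>\<open>q \<le> 3 * p\<close> and ln 3 <= 2 keep the interval within the length
      2 allowed in the integral estimate.\<close>
    have "\<beta> \<le> ln (3 * real p)" unfolding \<beta>_def using pq by (subst ln_le_cancel_iff) auto
    also have "\<dots> = ln 3 + \<alpha>" using pq by (simp add: \<alpha>_def ln_mult)
    also have "ln 3 \<le> (2::real)" using ln_le_minus_one[of "3::real"] by simp
    finally show "\<beta> \<le> \<alpha> + 2" by simp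
  qed (use pq in \<open>auto simp: \<alpha>_def \<beta>_def\<close>)
  have E: "exp (- 2 * \<sigma> * \<alpha>) = real p powr (- 2 * \<sigma>)" using pq by (simp add: powr_def \<alpha>_def)
  have 1: "integral {\<alpha>..\<beta>} (\<lambda>y. (norm (g y))\<^sup>2) \<le> 4 * real p powr (- 2 * \<sigma>) * D * N"
    using integral_norm_exp_sum_le[OF S D(1) ab, of c] unfolding E g_def N_def by simp
  have "integral {\<alpha>..\<beta>} (\<lambda>y. (norm (g' y))\<^sup>2) \<le> 4 * real p powr (- 2 * \<sigma>) * D * (\<Sum>\<rho>\<in>S. w \<rho> * (norm (- \<rho> * c \<rho>))\<^sup>2)"
    using integral_norm_exp_sum_le[OF S D(1) ab, of "\<lambda>\<rho>. - \<rho> * c \<rho>"] unfolding E g'_def by simp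
  also have "\<dots> \<le> 4 * real p powr (- 2 * \<sigma>) * D * (\<tau>\<^sup>2 * N)"
    unfolding N_def sum_distrib_left[of "\<tau>\<^sup>2"]
  proof (intro mult_left_mono sum_mono)
    fix \<rho> assume r: "\<rho> \<in> S"
    have "(norm (- \<rho> * c \<rho>))\<^sup>2 \<le> \<tau>\<^sup>2 * (norm (c \<rho>))\<^sup>2"
      using \<tau>(1)[OF r] by (simp add: norm_mult power_mult_distrib mult_right_mono power_mono)
    then show "w \<rho> * (norm (- \<rho> * c \<rho>))\<^sup>2 \<le> \<tau>\<^sup>2 * (w \<rho> * (norm (c \<rho>))\<^sup>2)"
      using mult_left_mono[OF _ S(2)[OF r]] by (simp only: mult.left_commute)
  qed (use D(2) in auto)
  finally have 2: "integral {\<alpha>..\<beta>} (\<lambda>y. (norm (g' y))\<^sup>2) \<le> 4 * real p powr (- 2 * \<sigma>) * D * (\<tau>\<^sup>2 * N)" .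
  have deriv: "(g has_vector_derivative g' x) (at x within A)" for x A
    unfolding g_def g'_def
  proof (intro has_vector_derivative_sum)
    fix \<rho>
    have "((\<lambda>y. of_real (w \<rho>) * c \<rho> * exp (- \<rho> * y)) has_field_derivative
        of_real (w \<rho>) * (- \<rho> * c \<rho>) * exp (- \<rho> * of_real x)) (at (of_real x))"
      by (auto intro!: derivative_eq_intros)
    then show "((\<lambda>y. of_real (w \<rho>) * c \<rho> * exp (- \<rho> * of_real y)) has_vector_derivative
        of_real (w \<rho>) * (- \<rho> * c \<rho>) * exp (- \<rho> * of_real x)) (at x within A)"
      by (rule has_vector_derivative_real_field)
  qed
  have cont: "continuous_on A g" "continuous_on A g'" for A
    unfolding g_def g'_def by (intro continuous_intros)+
  have "(\<Sum>m\<in>{p..<q}. (norm (\<Sum>\<rho>\<in>S. of_real (w \<rho>) * c \<rho> * of_nat m powr (- \<rho>)))\<^sup>2)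
    = (\<Sum>m\<in>{p..<q}. (norm (g (ln (real m))))\<^sup>2)"
    using pq by (intro sum.cong refl) (simp add: g_def of_nat_powr_eq_exp)
  also have "\<dots> \<le> (\<Sum>m\<in>{p..<q}. (real q + \<tau>) * integral {ln (real m)..ln (real (Suc m))} (\<lambda>y. (norm (g y))\<^sup>2)
       + 1 / \<tau> * integral {ln (real m)..ln (real (Suc m))} (\<lambda>y. (norm (g' y))\<^sup>2))"
  proof (intro sum_mono)
    fix m assume m: "m \<in> {p..<q}"
    have gap: "ln (real (Suc m)) - ln (real m) \<ge> 1 / real (Suc m)"
      using m pq by (intro ln_Suc_minus_ln_ge) auto
    have gap0: "ln (real (Suc m)) - ln (real m) > 0" using m pq by auto
    have "1 / (ln (real (Suc m)) - ln (real m)) \<le> 1 / (1 / real (Suc m))"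
      using gap gap0 by (intro divide_left_mono) auto
    also have "\<dots> \<le> real q" using m by auto
    finally have gap: "1 / (ln (real (Suc m)) - ln (real m)) \<le> real q" .
    have "(norm (g (ln (real m))))\<^sup>2 \<le> (1 / (ln (real (Suc m)) - ln (real m)) + \<tau>) * integral {ln (real m)..ln (real (Suc m))} (\<lambda>y. (norm (g y))\<^sup>2)
       + 1 / \<tau> * integral {ln (real m)..ln (real (Suc m))} (\<lambda>y. (norm (g' y))\<^sup>2)"
      using gap0 \<tau>(2) by (intro gallagher_pointwise deriv cont) auto
    also have "\<dots> \<le> (real q + \<tau>) * integral {ln (real m)..ln (real (Suc m))} (\<lambda>y. (norm (g y))\<^sup>2)
       + 1 / \<tau> * integral {ln (real m)..ln (real (Suc m))} (\<lambda>y. (norm (g' y))\<^sup>2)"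
      using gap by (intro add_right_mono mult_right_mono integral_nonneg integrable_continuous_real continuous_intros cont) auto
    finally show "(norm (g (ln (real m))))\<^sup>2 \<le> (real q + \<tau>) * integral {ln (real m)..ln (real (Suc m))} (\<lambda>y. (norm (g y))\<^sup>2)
       + 1 / \<tau> * integral {ln (real m)..ln (real (Suc m))} (\<lambda>y. (norm (g' y))\<^sup>2)" .
  qed
  also have "\<dots> = (real q + \<tau>) * integral {\<alpha>..\<beta>} (\<lambda>y. (norm (g y))\<^sup>2) + 1 / \<tau> * integral {\<alpha>..\<beta>} (\<lambda>y. (norm (g' y))\<^sup>2)"
    unfolding sum.distrib sum_distrib_left[symmetric] \<alpha>_def \<beta>_def
    by (subst (1 2) sum_integral_log_intervals) (use pq in \<open>auto intro!: continuous_intros cont\<close>)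
  also have "\<dots> \<le> (real q + \<tau>) * (4 * real p powr (- 2 * \<sigma>) * D * N) + 1 / \<tau> * (4 * real p powr (- 2 * \<sigma>) * D * (\<tau>\<^sup>2 * N))"
    using 1 2 \<tau>(2) by (intro add_mono mult_left_mono) auto
  also have "\<dots> = 4 * real p powr (- 2 * \<sigma>) * D * (real q + 2 * \<tau>) * N"
    using \<tau>(2) by (simp add: field_simps power2_eq_square)
  finally show ?thesis by (simp add: N_def)
qed

text \<open>From X = 1/2 on, the rounding error 1 is at most 2 X, which gives the constants 3 and 4.
  Below this threshold the range is empty (\<open>dirichlet_poly_eq_0\<close>).\<close>

lemma dirichlet_poly_range:
  assumes "X \<ge> 1 / 2"
  obtains p q where "{m. X \<le> real m \<and> real m < 2 * X} = {p..<q}" "1 \<le> p" "p \<le> q" "q \<le> 3 * p"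
    "X \<le> real p" "real p \<le> 3 * X" "real q \<le> 4 * X" "real (card {p..<q}) \<le> 3 * X"
proof -
  define p where "p = nat \<lceil>X\<rceil>"
  define q where "q = nat \<lceil>2 * X\<rceil>"
  have p: "X \<le> real p" "real p < X + 1" using assms by (auto simp: p_def) linarith+
  have q: "2 * X \<le> real q" "real q < 2 * X + 1" using assms by (auto simp: q_def) linarith+
  have "{m. X \<le> real m \<and> real m < 2 * X} = {p..<q}"
    using assms by (auto simp: p_def q_def nat_ceiling_le_eq less_ceiling_iff zless_nat_eq_int_zless)
  moreover have "1 \<le> p" using p assms by linarith
  moreover have "p \<le> q" using assms unfolding p_def q_def by (intro nat_mono ceiling_mono) auto
  moreover have "real q < real (3 * p)  + 1" using q p \<open>1 \<le> p\<close> by linarith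
  then have "q \<le> 3 * p" by linarith
  moreover have "real (card {p..<q}) \<le> 3 * X"
    using \<open>p \<le> q\<close> p q assms by (simp add: of_nat_diff)
  ultimately show ?thesis using that[of p q] p q assms by auto
qed

lemma dirichlet_poly_eq_0:
  assumes "0 < X" "X < 1 / 2"
  shows "dirichlet_poly a X s = 0"
proof -
  have "\<not> (X \<le> real m \<and> real m < 2 * X)" for m using assms by (cases m) auto
  then have "{m. X \<le> real m \<and> real m < 2 * X} = {}" by auto
  then show ?thesis unfolding dirichlet_poly_def by (simp only: sum.empty)
qed

lemma discrete_mean_value:
  fixes S :: "complex set" and w :: "complex \<Rightarrow> real"
  assumes S: "finite S" "\<And>\<rho>. \<rho> \<in> S \<Longrightarrow> w \<rho> \<ge> 0" "\<And>\<rho>. \<rho> \<in> S \<Longrightarrow> \<sigma> \<le> Re \<rho>" "\<sigma> \<ge> 0"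
    and T: "\<And>\<rho>. \<rho> \<in> S \<Longrightarrow> Re \<rho> \<le> 1" "\<And>\<rho>. \<rho> \<in> S \<Longrightarrow> \<bar>Im \<rho>\<bar> \<le> T" "T \<ge> 1"
    and D: "\<And>\<rho>. \<rho> \<in> S \<Longrightarrow> (\<Sum>\<rho>'\<in>S. w \<rho>' / (1 + \<bar>Im \<rho> - Im \<rho>'\<bar>)) \<le> D" "D \<ge> 0"
    and X: "X > 0" and a: "\<And>m. \<bar>a m\<bar> \<le> 1"
  shows "(\<Sum>\<rho>\<in>S. w \<rho> * (norm (dirichlet_poly a X \<rho>))\<^sup>2) \<le> 48 * D * X powr (1 - 2 * \<sigma>) * (X + T)"
proof (cases "X < 1 / 2")
  case True
  then show ?thesis using X T D by (simp add: dirichlet_poly_eq_0)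
next
  case False
  then have "X \<ge> 1 / 2" by simp
  then obtain p q where pq: "{m. X \<le> real m \<and> real m < 2 * X} = {p..<q}" "1 \<le> p" "p \<le> q" "q \<le> 3 * p"
    "X \<le> real p" "real p \<le> 3 * X" "real q \<le> 4 * X" "real (card {p..<q}) \<le> 3 * X"
    by (rule dirichlet_poly_range)
  have norm: "norm \<rho> \<le> 1 + T" if "\<rho> \<in> S" for \<rho>
    using cmod_le[of \<rho>] T(1,2)[OF that] S(3)[OF that] S(4) by linarith
  have "(\<Sum>\<rho>\<in>S. w \<rho> * (norm (\<Sum>m\<in>{p..<q}. of_real (a m) * of_nat m powr (- \<rho>)))\<^sup>2)
     \<le> 4 * real p powr (- 2 * \<sigma>) * D * (real q + 2 * (1 + T)) * real (card {p..<q})"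
  proof (rule duality)
    show "(\<Sum>m\<in>{p..<q}. (norm (\<Sum>\<rho>\<in>S. of_real (w \<rho>) * c \<rho> * of_nat m powr (- \<rho>)))\<^sup>2)
       \<le> 4 * real p powr (- 2 * \<sigma>) * D * (real q + 2 * (1 + T)) * (\<Sum>\<rho>\<in>S. w \<rho> * (norm (c \<rho>))\<^sup>2)" for c
      by (rule large_sieve_gram[OF S norm _ D pq(2-4)]) (use T(3) in auto)
    show "0 \<le> 4 * real p powr (- 2 * \<sigma>) * D * (real q + 2 * (1 + T))"
      using T(3) D(2) by simp
  qed (use S a in auto)
  \<comment> \<open>The final 48 is 4 times 4 times 3. Since \<sigma> >= 0, the power with exponent
    - 2 \<sigma> is non-increasing and \<open>p\<close> may be replaced by the smaller
    \<open>X\<close>; T >= 1 absorbs the constant in 2 (1 + T).\<close>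
  also have "\<dots> \<le> 4 * X powr (- 2 * \<sigma>) * D * (4 * X + 4 * T) * (3 * X)"
  proof (intro mult_mono)
    show "real p powr (- 2 * \<sigma>) \<le> X powr (- 2 * \<sigma>)"
      using pq(5) X S(4) by (intro powr_mono2') auto
    show "real q + 2 * (1 + T) \<le> 4 * X + 4 * T" using pq(7) T(3) by simp
  qed (use pq(8) T(3) D(2) X in auto)
  also have "\<dots> = 48 * D * (X powr (- 2 * \<sigma>) * X powr 1) * (X + T)"
    using X by (simp add: algebra_simps)
  also have "X powr (- 2 * \<sigma>) * X powr 1 = X powr (1 - 2 * \<sigma>)"
    by (simp only: powr_add[symmetric]) simp
  finally show ?thesis by (simp add: dirichlet_poly_def pq(1))
qed

section \<open>Exponential sums and the Halasz-Montgomery inequality\<close>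

text \<open>On [0, 1] the derivative of sin is at least 1/2, because cos x = 1 - 2 sin(x/2)^2 and
  |sin(x/2)| <= 1/2.\<close>

lemma sin_ge_half: 
  assumes "0 \<le> y" "y \<le> (1::real)"
  shows "y / 2 \<le> sin y"
proof -
  have "(\<lambda>y. sin y - y / 2) 0 \<le> (\<lambda>y. sin y - y / 2) y"
  proof (rule DERIV_nonneg_imp_nondecreasing[OF assms(1)])
    fix x assume x: "0 \<le> x" "x \<le> y"
    have "\<bar>sin (x / 2)\<bar> \<le> \<bar>x / 2\<bar>" by (rule abs_sin_x_le_abs_x)
    then have "\<bar>sin (x / 2)\<bar> \<le> 1 / 2" using x assms by simp
    then have "\<bar>sin (x / 2)\<bar> ^ 2 \<le> (1 / 2) ^ 2" by (rule power_mono) simp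
    then have "cos x \<ge> 1 / 2" using cos_double_sin[of "x / 2"] by (simp add: power2_eq_square)
    moreover have "((\<lambda>y. sin y - y / 2) has_real_derivative (cos x - 1 / 2)) (at x)"
      by (auto intro!: derivative_eq_intros)
    ultimately show "\<exists>d. ((\<lambda>y. sin y - y / 2) has_real_derivative d) (at x) \<and> d \<ge> 0" by force
  qed
  then show ?thesis by simp
qed

lemma sin_ge_quarter:
  assumes "0 < \<delta>" "\<delta> \<le> 2" "\<delta> / 2 \<le> h" "h \<le> pi - \<delta> / 2"
  shows "\<delta> / 4 \<le> sin h"
proof -
  have 1: "\<delta> / 4 \<le> sin (\<delta> / 2)" using sin_ge_half[of "\<delta> / 2"] assms by simp
  have *: "sin (\<delta> / 2) \<le> sin y" if "\<delta> / 2 \<le> y" "y \<le> pi / 2" for y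
    using assms that by (subst sin_mono_le_eq) auto
  show ?thesis
  proof (cases "h \<le> pi / 2")
    case True
    then show ?thesis using * assms 1 by fastforce
  next
    case False
    then have "sin (\<delta> / 2) \<le> sin (pi - h)" using assms by (intro *) auto
    then show ?thesis using 1 by simp
  qed
qed

text \<open>With \<open>\<theta>\<^sub>n = \<phi>(n+1) - \<phi>(n)\<close> one has \<open>cis \<phi>(n) = (cis \<phi>(n) - cis \<phi>(n+1)) C\<^sub>n\<close> for
  \<open>C\<^sub>n = 1/2 + i/2 cot (\<theta>\<^sub>n/2)\<close>; partial summation applies since the imaginary parts of \<open>C\<^sub>n\<close> are monotone.\<close>
lemma kusmin_landau:
  fixes \<phi> :: "nat \<Rightarrow> real"
  assumes ab: "a < b" and \<delta>: "0 < \<delta>" "\<delta> \<le> 2"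
    and \<theta>: "\<And>n. a \<le> n \<Longrightarrow> n < b \<Longrightarrow> \<delta> \<le> \<phi> (Suc n) - \<phi> n \<and> \<phi> (Suc n) - \<phi> n \<le> 2 * pi - \<delta>"
    and anti: "\<And>n. a \<le> n \<Longrightarrow> Suc n < b \<Longrightarrow> \<phi> (Suc (Suc n)) - \<phi> (Suc n) \<le> \<phi> (Suc n) - \<phi> n"
  shows "norm (\<Sum>n\<in>{a..<b}. cis (\<phi> n)) \<le> 10 / \<delta>"
proof -
  define h where "h n = (\<phi> (Suc n) - \<phi> n) / 2" for n
  define c where "c n = cos (h n) / (2 * sin (h n))" for n
  define C where "C n = Complex (1 / 2) (c n)" for n
  have sin: "sin (h n) \<ge> \<delta> / 4" if "a \<le> n" "n < b" for n
    using \<theta>[OF that] \<delta> by (intro sin_ge_quarter) (auto simp: h_def)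
  have sin_pos: "sin (h n) > 0" if "a \<le> n" "n < b" for n
    using sin[OF that] \<delta> by linarith
  have c: "\<bar>c n\<bar> \<le> 2 / \<delta>" if "a \<le> n" "n < b" for n
  proof -
    have "\<bar>c n\<bar> \<le> 1 / (2 * sin (h n))"
      using sin_pos[OF that] by (simp add: c_def divide_right_mono)
    also have "\<dots> \<le> 1 / (2 * (\<delta> / 4))"
      using sin[OF that] sin_pos[OF that] \<delta> by (intro divide_left_mono) auto
    finally show ?thesis by simp
  qed
  have C: "norm (C n) \<le> 3 / \<delta>" if "a \<le> n" "n < b" for n
  proof -
    have "norm (C n) \<le> 1 / 2 + \<bar>c n\<bar>" using cmod_le[of "C n"] by (simp add: C_def)
    also have "\<dots> \<le> 1 / \<delta> + 2 / \<delta>" using c[OF that] \<delta> by (intro add_mono) (auto simp: field_simps)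
    finally show ?thesis by simp
  qed
  have cis: "cis (\<phi> n) = (cis (\<phi> n) - cis (\<phi> (Suc n))) * C n" if "a \<le> n" "n < b" for n
  proof -
    have s: "sin (h n) \<noteq> 0" using sin_pos[OF that] by simp
    have "(1 - cis (2 * h n)) * C n = 1"
    proof (rule complex_eqI)
      have "Re ((1 - cis (2 * h n)) * C n) = (1 - cos (2 * h n)) / 2 + sin (2 * h n) * cos (h n) / (2 * sin (h n))"
        by (simp add: C_def c_def)
      also have "\<dots> = (sin (h n))\<^sup>2 + (cos (h n))\<^sup>2"
        using s unfolding cos_double_sin sin_double by (simp add: power2_eq_square)
      finally show "Re ((1 - cis (2 * h n)) * C n) = Re 1" by simp
      have "Im ((1 - cis (2 * h n)) * C n) = (1 - cos (2 * h n)) * cos (h n) / (2 * sin (h n)) - sin (2 * h n) / 2"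
        by (simp add: C_def c_def)
      also have "\<dots> = 0"
        using s unfolding cos_double_sin sin_double by (simp add: power2_eq_square)
      finally show "Im ((1 - cis (2 * h n)) * C n) = Im 1" by simp
    qed
    moreover have "\<phi> (Suc n) = \<phi> n + 2 * h n" by (simp add: h_def field_simps)
    then have "cis (\<phi> (Suc n)) = cis (\<phi> n) * cis (2 * h n)" by (simp only: cis_mult)
    ultimately show ?thesis
      by (metis (no_types, lifting) mult.assoc mult.right_neutral right_diff_distrib)
  qed
  \<comment> \<open>\<open>c n\<close> is half the cotangent of \<open>h n\<close>; the cotangent
    decreases on (0, pi) and \<open>h\<close> is non-increasing. After cross-multiplication this is
    \<open>sin (h n - h (Suc n)) \<ge> 0\<close>.\<close>
  have mono: "c n \<le> c (Suc n)" if "a \<le> n" "Suc n < b" for n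
  proof -
    have s: "sin (h n) > 0" "sin (h (Suc n)) > 0" using sin_pos that by auto
    have "h n \<le> pi - \<delta> / 2" "h (Suc n) \<ge> \<delta> / 2" "h (Suc n) \<le> h n"
      unfolding h_def using anti[OF that] \<theta>[of n] \<theta>[of "Suc n"] that by auto
    then have "0 \<le> sin (h n - h (Suc n))"
      using \<delta>(1) by (intro sin_ge_zero) linarith+
    then have "cos (h n) * sin (h (Suc n)) \<le> cos (h (Suc n)) * sin (h n)" by (simp add: sin_diff mult.commute)
    then show ?thesis using s by (simp add: c_def field_simps)
  qed
  \<comment> \<open>Keeping the boundary term \<open>cis (\<phi> k) * C (k - 1)\<close> on the left,
    each step adds only the norm of \<open>C k - C (k - 1)\<close>; by \<open>mono\<close> these
    increments telescope to \<open>c (k - 1) - c a\<close>.\<close>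
  have ind: "norm ((\<Sum>n\<in>{a..<k}. cis (\<phi> n)) + cis (\<phi> k) * C (k - 1)) \<le> norm (C a) + c (k - 1) - c a"
    if "Suc a \<le> k" "k \<le> b" for k
    using that
  proof (induction k rule: dec_induct)
    case base
    have "cis (\<phi> a) + cis (\<phi> (Suc a)) * C a = cis (\<phi> a) * C a"
      using cis[of a] base by (simp add: algebra_simps)
    then show ?case by (simp add: norm_mult)
  next
    case (step k)
    have "cis (\<phi> k) + cis (\<phi> (Suc k)) * C k = cis (\<phi> k) * C k"
      using cis[of k] step by (simp add: algebra_simps)
    then have "(\<Sum>n\<in>{a..<Suc k}. cis (\<phi> n)) + cis (\<phi> (Suc k)) * C (Suc k - 1)
       = ((\<Sum>n\<in>{a..<k}. cis (\<phi> n)) + cis (\<phi> k) * C (k - 1)) + cis (\<phi> k) * (C k - C (k - 1))"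
      using step by (simp add: algebra_simps)
    also have "norm \<dots> \<le> (norm (C a) + c (k - 1) - c a) + norm (cis (\<phi> k) * (C k - C (k - 1)))"
      using step by (intro norm_triangle_mono) auto
    also have "C k - C (k - 1) = \<i> * of_real (c k - c (k - 1))"
      by (simp add: C_def complex_eq_iff)
    also have "norm (cis (\<phi> k) * \<dots>) = \<bar>c k - c (k - 1)\<bar>"
      by (simp add: norm_mult del: of_real_diff)
    also have "\<dots> = c k - c (k - 1)" using mono[of "k - 1"] step by auto
    finally show ?case by simp
  qed
  have "norm (\<Sum>n\<in>{a..<b}. cis (\<phi> n)) \<le> norm ((\<Sum>n\<in>{a..<b}. cis (\<phi> n)) + cis (\<phi> b) * C (b - 1)) + norm (cis (\<phi> b) * C (b - 1))"
    using norm_triangle_ineq4[of "(\<Sum>n\<in>{a..<b}. cis (\<phi> n)) + cis (\<phi> b) * C (b - 1)" "cis (\<phi> b) * C (b - 1)"] by simp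
  also have "\<dots> \<le> (3 / \<delta> + 2 / \<delta> + 2 / \<delta>) + 3 / \<delta>"
  proof (rule add_mono)
    have "\<bar>c a\<bar> \<le> 2 / \<delta>" "\<bar>c (b - 1)\<bar> \<le> 2 / \<delta>" "norm (C a) \<le> 3 / \<delta>" using ab by (auto intro!: c C)
    then show "norm ((\<Sum>n\<in>{a..<b}. cis (\<phi> n)) + cis (\<phi> b) * C (b - 1)) \<le> 3 / \<delta> + 2 / \<delta> + 2 / \<delta>"
      using ind[of b] ab by linarith
    show "norm (cis (\<phi> b) * C (b - 1)) \<le> 3 / \<delta>" using C[of "b - 1"] ab by (simp add: norm_mult)
  qed
  finally show ?thesis by simp
qed

lemma convex_nat_set_eq_interval:
  fixes F :: "nat set"
  assumes "finite F" and conv: "\<forall>x\<in>F. \<forall>y\<in>F. {x..y} \<subseteq> F"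
  shows "\<exists>a b. F = {a..<b}"
proof (cases "F = {}")
  case True
  then show ?thesis by (intro exI[of _ 0]) auto
next
  case False
  have "F = {Min F..<Suc (Max F)}"
  proof
    show "F \<subseteq> {Min F..<Suc (Max F)}" using assms(1) by (auto simp: less_Suc_eq_le)
    have "{Min F..Max F} \<subseteq> F" using assms False by auto
    then show "{Min F..<Suc (Max F)} \<subseteq> F" by (simp add: atLeastLessThanSuc_atLeastAtMost)
  qed
  then show ?thesis by blast
qed

text \<open>The differences \<open>\<theta>\<close> are monotone, so the indices with
  \<open>\<theta> n\<close> in the window form an interval. Subtracting 2 pi k n from the phase
  leaves every \<open>cis\<close> unchanged and moves the window to
  [\<delta>, 2 pi - \<delta>].\<close>

lemma kusmin_landau_window:
  fixes \<phi> :: "nat \<Rightarrow> real" and k :: int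
  defines "\<theta> \<equiv> \<lambda>n. \<phi> (Suc n) - \<phi> n"
  assumes \<delta>: "0 < \<delta>" "\<delta> \<le> 2"
    and anti: "\<And>m n. m \<in> {p..<q} \<Longrightarrow> n \<in> {p..<q} \<Longrightarrow> m \<le> n \<Longrightarrow> \<theta> n \<le> \<theta> m"
  shows "norm (\<Sum>n | n \<in> {p..<q} \<and> 2 * pi * of_int k + \<delta> \<le> \<theta> n \<and> \<theta> n \<le> 2 * pi * of_int k + 2 * pi - \<delta>. cis (\<phi> n)) \<le> 10 / \<delta>"
proof -
  define F where "F = {n. n \<in> {p..<q} \<and> 2 * pi * of_int k + \<delta> \<le> \<theta> n \<and> \<theta> n \<le> 2 * pi * of_int k + 2 * pi - \<delta>}"
  have fin: "finite F" by (simp add: F_def)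
  have "n \<in> F" if "x \<in> F" "y \<in> F" "x \<le> n" "n \<le> y" for x y n
    using that anti[of x n] anti[of n y] by (auto simp: F_def)
  then have conv: "\<forall>x\<in>F. \<forall>y\<in>F. {x..y} \<subseteq> F" by (meson atLeastAtMost_iff subsetI)
  obtain a b where F: "F = {a..<b}"
    using convex_nat_set_eq_interval[OF fin conv] by blast
  show ?thesis
  proof (cases "F = {}")
    case True
    then show ?thesis using \<delta> unfolding F_def[symmetric] by simp
  next
    case False
    define \<psi> where "\<psi> n = \<phi> n + of_int (- (k * int n)) * (2 * pi)" for n
    have \<psi>: "\<psi> (Suc n) - \<psi> n = \<theta> n - 2 * pi * of_int k" for n
      by (simp add: \<psi>_def \<theta>_def algebra_simps)
    have "cis (\<psi> n) = cis (\<phi> n)" for n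
      unfolding \<psi>_def cis_mult[symmetric]
      using cis_multiple_2pi[of "of_int (- (k * int n))"] by (simp add: mult_ac)
    then have "(\<Sum>n\<in>F. cis (\<phi> n)) = (\<Sum>n\<in>{a..<b}. cis (\<psi> n))" using F by simp
    also have "norm \<dots> \<le> 10 / \<delta>"
    proof (rule kusmin_landau)
      show "a < b" using F False by simp
      show "\<delta> \<le> \<psi> (Suc n) - \<psi> n \<and> \<psi> (Suc n) - \<psi> n \<le> 2 * pi - \<delta>" if "a \<le> n" "n < b" for n
      proof -
        have "n \<in> F" using that F by auto
        then show ?thesis unfolding \<psi> by (auto simp: F_def)
      qed
      show "\<psi> (Suc (Suc n)) - \<psi> (Suc n) \<le> \<psi> (Suc n) - \<psi> n" if "a \<le> n" "Suc n < b" for n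
      proof -
        have "n \<in> F" "Suc n \<in> F" using that F by auto
        then show ?thesis unfolding \<psi> using anti[of n "Suc n"] by (auto simp: F_def)
      qed
    qed (use \<delta> in auto)
    finally show ?thesis by (simp add: F_def)
  qed
qed

text \<open>\<open>\<theta>\<close> falls by at least \<open>\<mu>\<close> per step, so the smallest
  and largest index in a window of length \<open>\<delta>\<close> differ by at most
  \<open>\<delta> / \<mu>\<close>.\<close>

lemma card_window_le:
  fixes \<theta> :: "nat \<Rightarrow> real"
  assumes "\<mu> > 0" "\<delta> \<ge> 0"
    and gap: "\<And>m n. m \<in> {p..<q} \<Longrightarrow> n \<in> {p..<q} \<Longrightarrow> m \<le> n \<Longrightarrow> real (n - m) * \<mu> \<le> \<theta> m - \<theta> n"
  shows "real (card {n. n \<in> {p..<q} \<and> l \<le> \<theta> n \<and> \<theta> n \<le> l + \<delta>}) \<le> \<delta> / \<mu> + 1"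
proof -
  define F where "F = {n. n \<in> {p..<q} \<and> l \<le> \<theta> n \<and> \<theta> n \<le> l + \<delta>}"
  have fin: "finite F" by (simp add: F_def)
  show ?thesis
  proof (cases "F = {}")
    case True
    then show ?thesis using assms unfolding F_def[symmetric] by simp
  next
    case False
    have M: "Min F \<in> F" "Max F \<in> F" using fin False by auto
    have "F \<subseteq> {Min F..Max F}" using fin by auto
    then have "card F \<le> Suc (Max F) - Min F" using card_mono[of "{Min F..Max F}" F] by simp
    moreover have "Min F \<le> Max F" using fin False by simp
    ultimately have 1: "real (card F) \<le> real (Max F - Min F) + 1" by linarith
    have "real (Max F - Min F) * \<mu> \<le> \<delta>"
      using gap[of "Min F" "Max F"] M \<open>Min F \<le> Max F\<close> by (auto simp: F_def)
    then have "real (Max F - Min F) \<le> \<delta> / \<mu>" using assms by (simp add: field_simps)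
    then show ?thesis using 1 by (simp add: F_def)
  qed
qed

text \<open>Split according to the integer part of \<open>\<theta>\<^sub>n / 2 \<pi>\<close>; in each block the Kusmin-Landau
  inequality treats the \<open>n\<close> with \<open>\<theta>\<^sub>n\<close> at distance at least \<open>\<delta> = \<surd>\<mu>\<close> from \<open>2 \<pi> \<int>\<close>.\<close>
lemma van_der_corput:
  fixes \<phi> :: "nat \<Rightarrow> real"
  defines "\<theta> \<equiv> \<lambda>n. \<phi> (Suc n) - \<phi> n"
  assumes \<mu>: "0 < \<mu>" "\<mu> \<le> 1"
    and gap: "\<And>m n. m \<in> {p..<q} \<Longrightarrow> n \<in> {p..<q} \<Longrightarrow> m \<le> n \<Longrightarrow> real (n - m) * \<mu> \<le> \<theta> m - \<theta> n"
    and \<Theta>: "\<And>n. n \<in> {p..<q} \<Longrightarrow> 0 \<le> \<theta> n \<and> \<theta> n \<le> \<Theta>" "0 \<le> \<Theta>"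
  shows "norm (\<Sum>n\<in>{p..<q}. cis (\<phi> n)) \<le> (\<Theta> + 1) * (14 / sqrt \<mu>)"
proof -
  \<comment> \<open>This choice balances the number of indices near 2 pi Z, about
    \<open>\<delta> / \<mu>\<close>, against the Kusmin-Landau bound of order
    \<open>1 / \<delta>\<close>.\<close>
  define \<delta> where "\<delta> = sqrt \<mu>"
  have \<delta>: "0 < \<delta>" "\<delta> \<le> 1" "\<delta> / \<mu> = 1 / \<delta>" using \<mu> by (auto simp: \<delta>_def real_div_sqrt field_simps)
  define k where "k n = \<lfloor>\<theta> n / (2 * pi)\<rfloor>" for n
  have anti: "\<theta> n \<le> \<theta> m" if "m \<in> {p..<q}" "n \<in> {p..<q}" "m \<le> n" for m n
    using gap[OF that] \<mu> by (smt (verit) mult_nonneg_nonneg of_nat_0_le_iff)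
  have kn: "2 * pi * of_int (k n) \<le> \<theta> n" "\<theta> n \<le> 2 * pi * of_int (k n) + 2 * pi" for n
  proof -
    have "2 * pi * of_int (k n) \<le> 2 * pi * (\<theta> n / (2 * pi))"
      "2 * pi * (\<theta> n / (2 * pi)) \<le> 2 * pi * (of_int (k n) + 1)"
      unfolding k_def by (intro mult_left_mono; simp; linarith?)+
    then show "2 * pi * of_int (k n) \<le> \<theta> n" "\<theta> n \<le> 2 * pi * of_int (k n) + 2 * pi"
      by (auto simp: algebra_simps)
  qed
  have block: "norm (\<Sum>n | n \<in> {p..<q} \<and> k n = j. cis (\<phi> n)) \<le> 14 / \<delta>" for j
  proof -
    define l where "l = 2 * pi * of_int j"
    define F where "F = {n. n \<in> {p..<q} \<and> k n = j}"
    define J where "J = {n. n \<in> {p..<q} \<and> l + \<delta> \<le> \<theta> n \<and> \<theta> n \<le> l + 2 * pi - \<delta>}"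
    define E1 where "E1 = {n. n \<in> {p..<q} \<and> l \<le> \<theta> n \<and> \<theta> n \<le> l + \<delta>}"
    define E2 where "E2 = {n. n \<in> {p..<q} \<and> l + 2 * pi - \<delta> \<le> \<theta> n \<and> \<theta> n \<le> (l + 2 * pi - \<delta>) + \<delta>}"
    have fin: "finite F" "finite J" "finite E1" "finite E2" by (auto simp: F_def J_def E1_def E2_def)
    have JF: "J \<subseteq> F"
    proof
      fix n assume n: "n \<in> J"
      then have "of_int j \<le> \<theta> n / (2 * pi)" "\<theta> n / (2 * pi) < of_int j + 1"
        using \<delta> pi_gt_zero by (auto simp: J_def l_def field_simps)
      then have "k n = j" unfolding k_def by (intro floor_unique)
      then show "n \<in> F" using n by (auto simp: J_def F_def)
    qed
    have sub: "F - J \<subseteq> E1 \<union> E2"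
    proof
      fix n assume n: "n \<in> F - J"
      have "l \<le> \<theta> n" "\<theta> n \<le> l + 2 * pi" using kn[of n] n by (auto simp: F_def l_def)
      then show "n \<in> E1 \<union> E2" using n by (auto simp: F_def J_def E1_def E2_def)
    qed
    have "real (card E1) \<le> \<delta> / \<mu> + 1" "real (card E2) \<le> \<delta> / \<mu> + 1"
      unfolding E1_def E2_def using \<mu> \<delta> gap by (intro card_window_le; auto)+
    moreover have "card (F - J) \<le> card E1 + card E2"
      using card_mono[OF _ sub] card_Un_le[of E1 E2] fin by simp
    ultimately have c: "real (card (F - J)) \<le> 2 * (1 / \<delta>) + 2" using \<delta> by simp
    have "norm (\<Sum>n\<in>F. cis (\<phi> n)) = norm ((\<Sum>n\<in>F - J. cis (\<phi> n)) + (\<Sum>n\<in>J. cis (\<phi> n)))"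
      using sum.subset_diff[OF JF fin(1), of "\<lambda>n. cis (\<phi> n)"] by simp
    also have "\<dots> \<le> real (card (F - J)) + 10 / \<delta>"
    proof (intro norm_triangle_mono)
      show "norm (\<Sum>n\<in>F - J. cis (\<phi> n)) \<le> real (card (F - J))"
        using sum_norm_le[of "F - J" "\<lambda>n. cis (\<phi> n)" "\<lambda>_. 1"] by simp
      show "norm (\<Sum>n\<in>J. cis (\<phi> n)) \<le> 10 / \<delta>"
        unfolding J_def l_def \<theta>_def using \<delta> anti by (intro kusmin_landau_window) (auto simp: \<theta>_def)
    qed
    \<comment> \<open>14 = 10 + 2 + 2: the Kusmin-Landau part, the two counts
      \<open>\<delta> / \<mu> = 1 / \<delta>\<close>, and their two summands 1, absorbed because
      \<delta> <= 1.\<close>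
    also have "\<dots> \<le> 14 / \<delta>"
    proof -
      have "2 \<le> 2 * (1 / \<delta>)" using \<delta>(1,2) by (simp add: field_simps)
      then show ?thesis using c by simp
    qed
    finally show ?thesis by (simp add: F_def)
  qed
  define Js where "Js = {0..\<lfloor>\<Theta>\<rfloor>}"
  have "k n \<in> Js" if "n \<in> {p..<q}" for n
  proof -
    have "\<theta> n / (2 * pi) \<le> \<theta> n"
      using \<Theta>(1)[OF that] pi_ge_two mult_left_mono[of 1 "2 * pi" "\<theta> n"] by (simp add: divide_le_eq)
    then have "\<lfloor>\<theta> n / (2 * pi)\<rfloor> \<le> \<lfloor>\<Theta>\<rfloor>" using \<Theta>(1)[OF that] by (intro floor_mono) auto
    moreover have "0 \<le> \<lfloor>\<theta> n / (2 * pi)\<rfloor>" using \<Theta>(1)[OF that] by simp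
    ultimately show ?thesis by (simp add: Js_def k_def)
  qed
  then have "(\<Sum>n\<in>{p..<q}. cis (\<phi> n)) = (\<Sum>j\<in>Js. \<Sum>n | n \<in> {p..<q} \<and> k n = j. cis (\<phi> n))"
    by (subst sum.group) (auto simp: Js_def)
  also have "norm \<dots> \<le> (\<Sum>j\<in>Js. 14 / \<delta>)" using block by (intro sum_norm_le)
  also have "\<dots> = real (card Js) * (14 / \<delta>)" by simp
  also have "\<dots> \<le> (\<Theta> + 1) * (14 / \<delta>)"
  proof (intro mult_right_mono)
    have "real (card Js) = of_int (\<lfloor>\<Theta>\<rfloor> + 1)" using \<Theta>(2) by (simp add: Js_def)
    then show "real (card Js) \<le> \<Theta> + 1" by simp
  qed (use \<delta> in auto)
  finally show ?thesis by (simp add: \<delta>_def)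
qed

text \<open>The left side is - ln (1 - 1 / (m + 1)^2), since m (m + 2) = (m + 1)^2 - 1. It supplies
  the curvature required by van der Corput's method.\<close>

lemma ln_ratio_gap:
  assumes "m \<ge> 1"
  shows "(ln (real (Suc m)) - ln (real m)) - (ln (real (Suc (Suc m))) - ln (real (Suc m))) \<ge> 1 / (real (Suc m))\<^sup>2"
proof -
  define x where "x = real m"
  have x: "x \<ge> 1" using assms by (simp add: x_def)
  have "ln (x * (x + 2) / (x + 1)\<^sup>2) \<le> x * (x + 2) / (x + 1)\<^sup>2 - 1"
    using x by (intro ln_le_minus_one) auto
  also have "x * (x + 2) = (x + 1)\<^sup>2 - 1" by (simp add: power2_eq_square algebra_simps)
  also have "((x + 1)\<^sup>2 - 1) / (x + 1)\<^sup>2 - 1 = - 1 / (x + 1)\<^sup>2" using x by (simp add: diff_divide_distrib)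
  finally have "ln (x * (x + 2) / (x + 1)\<^sup>2) \<le> - 1 / (x + 1)\<^sup>2" by (simp add: power2_eq_square algebra_simps)
  also have "ln (x * (x + 2) / (x + 1)\<^sup>2) = ln x + ln (x + 2) - 2 * ln (x + 1)"
    using x by (simp add: ln_div ln_mult ln_realpow)
  finally show ?thesis by (simp add: x_def add_ac)
qed

text \<open>The phase differences lie between t / (n + 1) and t / n. For t <= p they do not exceed
  1, and Kusmin-Landau gives p / t. For p < t <= 9 p^2 van der Corput's method meets O(t / p) blocks
  of cost O(p / sqrt t) each, together sqrt t. For larger t the number of terms is already below
  sqrt t.\<close>

lemma zeta_sum_bound:
  assumes pq: "1 \<le> p" "p \<le> q" "q \<le> 3 * p" and t: "t \<ge> 1"
  shows "norm (\<Sum>n\<in>{p..<q}. cis (t * ln (real n))) \<le> 84 * (real p / t + sqrt t)"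
proof -
  define \<theta> where "\<theta> n = t * ln (real (Suc n)) - t * ln (real n)" for n
  have \<theta>: "t / real (Suc n) \<le> \<theta> n" "\<theta> n \<le> t / real n" if "n \<ge> 1" for n
  proof -
    have "t * (1 / real (Suc n)) \<le> t * (ln (real (Suc n)) - ln (real n))"
      using ln_Suc_minus_ln_ge[OF that] t by (intro mult_left_mono) auto
    then show "t / real (Suc n) \<le> \<theta> n" by (simp add: \<theta>_def right_diff_distrib)
    have "ln (real (Suc n) / real n) \<le> real (Suc n) / real n - 1" using that by (intro ln_le_minus_one) auto
    also have "\<dots> = 1 / real n" using that by (simp add: field_simps)
    finally have "ln (real (Suc n)) - ln (real n) \<le> 1 / real n" using that by (simp add: ln_div)
    then have "t * (ln (real (Suc n)) - ln (real n)) \<le> t * (1 / real n)" using t by (intro mult_left_mono) auto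
    then show "\<theta> n \<le> t / real n" by (simp add: \<theta>_def right_diff_distrib)
  qed
  \<comment> \<open>The curvature t / (n + 1)^2 is smallest at the right end, where n + 1 <= q <= 3
    p. The requirement \<mu> <= 1 is the upper limit 9 p^2 of the middle range.\<close>
  define \<mu> where "\<mu> = t / (9 * (real p)\<^sup>2)"
  have \<mu>0: "\<mu> > 0" using t pq by (simp add: \<mu>_def)
  have gap1: "\<mu> \<le> \<theta> n - \<theta> (Suc n)" if "n \<in> {p..<q}" for n
  proof -
    have "\<mu> = t * (1 / (3 * real p)\<^sup>2)" by (simp add: \<mu>_def power_mult_distrib)
    also have "\<dots> \<le> t * (1 / (real (Suc n))\<^sup>2)"
      using that pq t by (intro mult_left_mono divide_left_mono power_mono) auto
    also have "\<dots> \<le> t * ((ln (real (Suc n)) - ln (real n)) - (ln (real (Suc (Suc n))) - ln (real (Suc n))))"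
      using that pq t by (intro mult_left_mono ln_ratio_gap) auto
    also have "\<dots> = \<theta> n - \<theta> (Suc n)" by (simp add: \<theta>_def algebra_simps)
    finally show ?thesis .
  qed
  have gap: "real (n - m) * \<mu> \<le> \<theta> m - \<theta> n" if "m \<in> {p..<q}" "n \<in> {p..<q}" "m \<le> n" for m n
    using that(3,1,2)
  proof (induction n rule: dec_induct)
    case (step n)
    have "real (Suc n - m) * \<mu> = real (n - m) * \<mu> + \<mu>" using step by (simp add: Suc_diff_le algebra_simps)
    then show ?case using step gap1[of n] by auto
  qed auto
  have anti: "\<theta> n \<le> \<theta> m" if "m \<in> {p..<q}" "n \<in> {p..<q}" "m \<le> n" for m n
    using gap[OF that] \<mu>0 by (smt (verit) mult_nonneg_nonneg of_nat_0_le_iff)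
  have bound: "0 \<le> \<theta> n \<and> \<theta> n \<le> t / real p" if "n \<in> {p..<q}" for n
  proof -
    have "0 \<le> t / real (Suc n)" using t by simp
    moreover have "t / real n \<le> t / real p" using that pq t by (intro divide_left_mono) auto
    ultimately show ?thesis using \<theta>[of n] that pq by auto
  qed
  consider "q = p" | "t \<le> real p" "p < q" | "real p < t" "t \<le> 9 * (real p)\<^sup>2" | "t > 9 * (real p)\<^sup>2"
    using pq by linarith
  then show ?thesis
  proof cases
    case 1
    then show ?thesis using t by simp
  next
    case 2
    define \<delta> where "\<delta> = t / (3 * real p)"
    have "\<delta> \<le> 1 / 3" using 2 pq by (simp add: \<delta>_def field_simps)
    have "norm (\<Sum>n\<in>{p..<q}. cis (t * ln (real n))) \<le> 10 / \<delta>"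
    proof (rule kusmin_landau)
      fix n assume n: "p \<le> n" "n < q"
      have "\<delta> \<le> t / real (Suc n)" unfolding \<delta>_def using n pq t by (intro divide_left_mono) auto
      moreover have "t / real p \<le> 1" using 2 pq by simp
      moreover have "t / real (Suc n) \<le> \<theta> n" "\<theta> n \<le> t / real p" using \<theta>(1)[of n] bound[of n] n pq by auto
      ultimately have "\<delta> \<le> \<theta> n" "\<theta> n \<le> 1" by linarith+
      then show "\<delta> \<le> t * ln (real (Suc n)) - t * ln (real n) \<and> t * ln (real (Suc n)) - t * ln (real n) \<le> 2 * pi - \<delta>"
        using \<open>\<delta> \<le> 1 / 3\<close> pi_ge_two by (auto simp: \<theta>_def)
    next
      fix n assume n: "p \<le> n" "Suc n < q"
      then show "t * ln (real (Suc (Suc n))) - t * ln (real (Suc n)) \<le> t * ln (real (Suc n)) - t * ln (real n)"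
        using anti[of n "Suc n"] by (auto simp: \<theta>_def)
    next
      show "\<delta> \<le> 2" using \<open>\<delta> \<le> 1 / 3\<close> by simp
    qed (use 2 t in \<open>simp_all add: \<delta>_def\<close>)
    also have "10 / \<delta> = 30 * (real p / t)" by (simp add: \<delta>_def)
    also have "\<dots> \<le> 84 * (real p / t + sqrt t)"
    proof -
      have "0 \<le> real p / t" "0 \<le> sqrt t" using t by auto
      then show ?thesis unfolding distrib_left by linarith
    qed
    finally show ?thesis .
  next
    case 3
    have "norm (\<Sum>n\<in>{p..<q}. cis (t * ln (real n))) \<le> (t / real p + 1) * (14 / sqrt \<mu>)"
    proof (rule van_der_corput[OF \<mu>0])
      show "\<mu> \<le> 1" using 3 pq by (simp add: \<mu>_def)
    qed (use gap bound t in \<open>auto simp: \<theta>_def\<close>)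
    also have "\<dots> \<le> (2 * (t / real p)) * (14 / sqrt \<mu>)"
    proof (intro mult_right_mono)
      have "1 \<le> t / real p" using 3 pq by simp
      then show "t / real p + 1 \<le> 2 * (t / real p)" by linarith
    qed (use \<mu>0 in auto)
    also have "sqrt \<mu> = sqrt t / (3 * real p)" by (simp add: \<mu>_def real_sqrt_divide real_sqrt_mult)
    also have "(2 * (t / real p)) * (14 / (sqrt t / (3 * real p))) = 84 * (t / sqrt t)"
      using pq t by (simp add: field_simps)
    also have "t / sqrt t = sqrt t" using t by (simp add: real_div_sqrt)
    also have "84 * sqrt t \<le> 84 * (real p / t + sqrt t)" using t by simp
    finally show ?thesis .
  next
    case 4
    have "norm (\<Sum>n\<in>{p..<q}. cis (t * ln (real n))) \<le> real (card {p..<q})"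
      using sum_norm_le[of "{p..<q}" "\<lambda>n. cis (t * ln (real n))" "\<lambda>_. 1"] by simp
    also have "\<dots> \<le> 3 * real p" using pq by auto
    also have "\<dots> = sqrt (9 * (real p)\<^sup>2)" by (simp add: real_sqrt_mult)
    also have "\<dots> \<le> sqrt t" using 4 by simp
    also have "\<dots> \<le> 84 * (real p / t + sqrt t)" using t by (simp add: algebra_simps)
    finally show ?thesis .
  qed
qed

text \<open>Negative t are reduced to positive ones by conjugation, and |t| <= 1 is trivial.
  Doubling the constant buys the denominator 1 + |t|, matching the row sums
  \<open>D\<close>.\<close>

lemma zeta_sum_bound':
  assumes pq: "1 \<le> p" "p \<le> q" "q \<le> 3 * p"
  shows "norm (\<Sum>n\<in>{p..<q}. cis (t * ln (real n))) \<le> 168 * (real p / (1 + \<bar>t\<bar>) + sqrt \<bar>t\<bar>)"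
proof (cases "\<bar>t\<bar> \<le> 1")
  case True
  have "norm (\<Sum>n\<in>{p..<q}. cis (t * ln (real n))) \<le> real (card {p..<q})"
    using sum_norm_le[of "{p..<q}" "\<lambda>n. cis (t * ln (real n))" "\<lambda>_. 1"] by simp
  also have "\<dots> \<le> 2 * real p" using pq by auto
  also have "\<dots> \<le> 4 * (real p / (1 + \<bar>t\<bar>))" using True pq by (simp add: field_simps)
  also have "\<dots> \<le> 168 * (real p / (1 + \<bar>t\<bar>) + sqrt \<bar>t\<bar>)"
    unfolding distrib_left by (intro add_increasing2 mult_right_mono) auto
  finally show ?thesis .
next
  case False
  have "norm (\<Sum>n\<in>{p..<q}. cis (t * ln (real n))) = norm (\<Sum>n\<in>{p..<q}. cis (\<bar>t\<bar> * ln (real n)))"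
  proof (cases "t \<ge> 0")
    case False
    have "(\<Sum>n\<in>{p..<q}. cis (\<bar>t\<bar> * ln (real n))) = cnj (\<Sum>n\<in>{p..<q}. cis (t * ln (real n)))"
      using False by (simp add: cis_cnj)
    then show ?thesis by (simp only: complex_mod_cnj)
  qed auto
  also have "\<dots> \<le> 84 * (real p / \<bar>t\<bar> + sqrt \<bar>t\<bar>)" using False pq by (intro zeta_sum_bound) auto
  also have "\<dots> \<le> 84 * (2 * (real p / (1 + \<bar>t\<bar>)) + 2 * sqrt \<bar>t\<bar>)"
  proof (intro mult_left_mono add_mono)
    have "real p / \<bar>t\<bar> \<le> real p / ((1 + \<bar>t\<bar>) / 2)" using False pq by (intro divide_left_mono) auto
    then show "real p / \<bar>t\<bar> \<le> 2 * (real p / (1 + \<bar>t\<bar>))" by (simp add: mult.commute)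
  qed auto
  finally show ?thesis by simp
qed

section \<open>From zeta sums to the Halasz-Montgomery quadratic form\<close>

lemma abel_inequality:
  fixes v :: "nat \<Rightarrow> real" and z :: "nat \<Rightarrow> complex"
  assumes "p \<le> q" and v: "\<And>n. p \<le> n \<Longrightarrow> v (Suc n) \<le> v n" "\<And>n. p \<le> n \<Longrightarrow> v n \<ge> 0"
    and B: "\<And>r. p \<le> r \<Longrightarrow> r \<le> q \<Longrightarrow> norm (\<Sum>n\<in>{p..<r}. z n) \<le> B"
  shows "norm (\<Sum>n\<in>{p..<q}. of_real (v n) * z n) \<le> B * v p"
proof -
  define Z where "Z r = (\<Sum>n\<in>{p..<r}. z n)" for r
  have "(\<Sum>n\<in>{p..<r}. of_real (v n) * z n) = (\<Sum>n\<in>{p..<r}. of_real (v n - v (Suc n)) * Z (Suc n)) + of_real (v r) * Z r"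
    if "p \<le> r" for r
    using that by (induction r rule: dec_induct) (auto simp: Z_def algebra_simps)
  then have "norm (\<Sum>n\<in>{p..<q}. of_real (v n) * z n)
     = norm ((\<Sum>n\<in>{p..<q}. of_real (v n - v (Suc n)) * Z (Suc n)) + of_real (v q) * Z q)" using assms by simp
  also have "\<dots> \<le> (\<Sum>n\<in>{p..<q}. (v n - v (Suc n)) * B) + v q * B"
  proof (intro norm_triangle_mono sum_norm_le)
    fix n assume n: "n \<in> {p..<q}"
    then show "norm (of_real (v n - v (Suc n)) * Z (Suc n)) \<le> (v n - v (Suc n)) * B"
      unfolding norm_mult norm_of_real using v(1)[of n] B[of "Suc n"] by (auto simp: Z_def intro!: mult_left_mono)
  next
    show "norm (of_real (v q) * Z q) \<le> v q * B"
      unfolding norm_mult norm_of_real using v(2)[of q] B[of q] assms(1) by (auto simp: Z_def intro!: mult_left_mono)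
  qed
  also have "(\<Sum>n\<in>{p..<q}. (v n - v (Suc n)) * B) = (v p - v q) * B"
    unfolding sum_distrib_right[symmetric]
    using sum_Suc_diff'[of p q "\<lambda>n. - v n"] assms(1) by simp
  finally show ?thesis by (simp add: algebra_simps)
qed

text \<open>Partial summation strips the decreasing factor \<open>real n powr (- Re z)\<close> and
  leaves the pure oscillation of \<open>zeta_sum_bound'\<close>.\<close>

lemma norm_dirichlet_kernel_le:
  assumes pq: "1 \<le> p" "p \<le> q" "q \<le> 3 * p" and z: "Re z \<ge> s" "s \<ge> 0"
  shows "norm (\<Sum>n\<in>{p..<q}. of_nat n powr (- z)) \<le> 168 * (real p / (1 + \<bar>Im z\<bar>) + sqrt \<bar>Im z\<bar>) * real p powr (- s)"
proof -
  have eq: "of_nat n powr (- z) = of_real (real n powr (- Re z)) * cis ((- Im z) * ln (real n))" if "n \<ge> 1" for n :: nat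
  proof -
    have "of_nat n powr (- z) = exp (of_real (- Re z * ln (real n))) * exp (\<i> * of_real ((- Im z) * ln (real n)))"
      unfolding of_nat_powr_eq_exp[OF that] exp_add[symmetric]
      by (rule arg_cong[where f = exp]) (auto simp: complex_eq_iff)
    then show ?thesis using that by (simp only: cis_conv_exp exp_of_real powr_def) simp
  qed
  have "(\<Sum>n\<in>{p..<q}. of_nat n powr (- z)) = (\<Sum>n\<in>{p..<q}. of_real (real n powr (- Re z)) * cis ((- Im z) * ln (real n)))"
    using pq by (intro sum.cong refl eq) auto
  also have "norm \<dots> \<le> 168 * (real p / (1 + \<bar>- Im z\<bar>) + sqrt \<bar>- Im z\<bar>) * real p powr (- Re z)"
  proof (rule abel_inequality)
    fix r assume "p \<le> r" "r \<le> q"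
    then show "norm (\<Sum>n\<in>{p..<r}. cis ((- Im z) * ln (real n))) \<le> 168 * (real p / (1 + \<bar>- Im z\<bar>) + sqrt \<bar>- Im z\<bar>)"
      using pq by (intro zeta_sum_bound') auto
  qed (use pq z in \<open>auto intro!: powr_mono2'\<close>)
  also have "\<dots> \<le> 168 * (real p / (1 + \<bar>- Im z\<bar>) + sqrt \<bar>- Im z\<bar>) * real p powr (- s)"
    using pq z by (intro mult_left_mono powr_mono) auto
  finally show ?thesis by simp
qed

text \<open>The sum over m is carried out inside the double sum over zeros. The kernel has a part p
  / (1 + |\<gamma> - \<gamma>'|), whose row sums are at most p D, and a part sqrt |\<gamma> -
  \<gamma>'| without decay; the latter is bounded by sqrt (2 T), so Schur's test gives the total
  weight of the zeros.\<close>

lemma halasz_montgomery_gram: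
  fixes S :: "complex set" and w :: "complex \<Rightarrow> real"
  assumes S: "finite S" "\<And>\<rho>. \<rho> \<in> S \<Longrightarrow> w \<rho> \<ge> 0" "\<And>\<rho>. \<rho> \<in> S \<Longrightarrow> \<sigma> \<le> Re \<rho>" "\<sigma> \<ge> 0"
    and T: "\<And>\<rho>. \<rho> \<in> S \<Longrightarrow> \<bar>Im \<rho>\<bar> \<le> T" "T \<ge> 0"
    and D: "\<And>\<rho>. \<rho> \<in> S \<Longrightarrow> (\<Sum>\<rho>'\<in>S. w \<rho>' / (1 + \<bar>Im \<rho> - Im \<rho>'\<bar>)) \<le> D"
    and pq: "1 \<le> p" "p \<le> q" "q \<le> 3 * p"
  shows "(\<Sum>m\<in>{p..<q}. (norm (\<Sum>\<rho>\<in>S. of_real (w \<rho>) * c \<rho> * of_nat m powr (- \<rho>)))\<^sup>2)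
     \<le> 168 * real p powr (- 2 * \<sigma>) * (real p * D + sqrt (2 * T) * (\<Sum>\<rho>\<in>S. w \<rho>)) * (\<Sum>\<rho>\<in>S. w \<rho> * (norm (c \<rho>))\<^sup>2)"
proof -
  define E where "E = 168 * real p powr (- 2 * \<sigma>)"
  define K where "K = (\<lambda>z. \<Sum>n\<in>{p..<q}. of_nat n powr (- z) :: complex)"
  define G where "G m = (\<Sum>\<rho>\<in>S. of_real (w \<rho>) * c \<rho> * of_nat m powr (- \<rho>))" for m :: nat
  have GG: "complex_of_real ((norm (G m))\<^sup>2)
     = (\<Sum>\<rho>\<in>S. \<Sum>\<rho>'\<in>S. (of_real (w \<rho>) * c \<rho> * of_real (w \<rho>') * cnj (c \<rho>')) * of_nat m powr (- (\<rho> + cnj \<rho>')))"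
    if "m \<ge> 1" for m
  proof -
    have cn: "cnj (of_nat m powr (- \<rho>')) = of_nat m powr (- cnj \<rho>')" for \<rho>'
      using that by (subst cnj_powr) auto
    have "complex_of_real ((norm (G m))\<^sup>2) = G m * cnj (G m)" by (rule complex_norm_square)
    also have "\<dots> = (\<Sum>\<rho>\<in>S. \<Sum>\<rho>'\<in>S. (of_real (w \<rho>) * c \<rho> * of_nat m powr (- \<rho>)) *
         (of_real (w \<rho>') * cnj (c \<rho>') * of_nat m powr (- cnj \<rho>')))"
      by (simp add: G_def sum_product cn)
    also have "\<dots> = (\<Sum>\<rho>\<in>S. \<Sum>\<rho>'\<in>S. (of_real (w \<rho>) * c \<rho> * of_real (w \<rho>') * cnj (c \<rho>')) * of_nat m powr (- (\<rho> + cnj \<rho>')))"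
    proof (intro sum.cong refl)
      fix \<rho> \<rho>'
      have "of_nat m powr (- (\<rho> + cnj \<rho>')) = of_nat m powr (- \<rho>) * (of_nat m powr (- cnj \<rho>') :: complex)"
        unfolding minus_add_distrib using that by (subst powr_add) auto
      then show "(of_real (w \<rho>) * c \<rho> * of_nat m powr (- \<rho>)) * (of_real (w \<rho>') * cnj (c \<rho>') * of_nat m powr (- cnj \<rho>'))
         = (of_real (w \<rho>) * c \<rho> * of_real (w \<rho>') * cnj (c \<rho>')) * of_nat m powr (- (\<rho> + cnj \<rho>'))"
        by (simp only: mult_ac)
    qed
    finally show ?thesis .
  qed
  have "complex_of_real (\<Sum>m\<in>{p..<q}. (norm (G m))\<^sup>2)
    = (\<Sum>m\<in>{p..<q}. \<Sum>\<rho>\<in>S. \<Sum>\<rho>'\<in>S. (of_real (w \<rho>) * c \<rho> * of_real (w \<rho>') * cnj (c \<rho>')) * of_nat m powr (- (\<rho> + cnj \<rho>')))"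
    unfolding of_real_sum using pq by (intro sum.cong refl GG) auto
  also have "\<dots> = (\<Sum>\<rho>\<in>S. \<Sum>m\<in>{p..<q}. \<Sum>\<rho>'\<in>S. (of_real (w \<rho>) * c \<rho> * of_real (w \<rho>') * cnj (c \<rho>')) * of_nat m powr (- (\<rho> + cnj \<rho>')))"
    by (rule sum.swap)
  also have "\<dots> = (\<Sum>\<rho>\<in>S. \<Sum>\<rho>'\<in>S. (of_real (w \<rho>) * c \<rho> * of_real (w \<rho>') * cnj (c \<rho>')) * K (\<rho> + cnj \<rho>'))"
    unfolding K_def sum_distrib_left by (intro sum.cong refl sum.swap)
  finally have eq: "complex_of_real (\<Sum>m\<in>{p..<q}. (norm (G m))\<^sup>2)
     = (\<Sum>\<rho>\<in>S. \<Sum>\<rho>'\<in>S. (of_real (w \<rho>) * c \<rho> * of_real (w \<rho>') * cnj (c \<rho>')) * K (\<rho> + cnj \<rho>'))" .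
  have "(\<Sum>m\<in>{p..<q}. (norm (G m))\<^sup>2) = norm (complex_of_real (\<Sum>m\<in>{p..<q}. (norm (G m))\<^sup>2))"
    unfolding norm_of_real by (simp add: sum_nonneg)
  also have "\<dots> \<le> (\<Sum>\<rho>\<in>S. \<Sum>\<rho>'\<in>S. w \<rho> * w \<rho>' * norm (c \<rho>) * norm (c \<rho>') * (E * (real p / (1 + \<bar>Im \<rho> - Im \<rho>'\<bar>) + sqrt (2 * T))))"
    unfolding eq
  proof (intro sum_norm_le)
    fix \<rho> \<rho>' assume r: "\<rho> \<in> S" "\<rho>' \<in> S"
    define z where "z = \<rho> + cnj \<rho>'"
    have "norm (K z) \<le> 168 * (real p / (1 + \<bar>Im z\<bar>) + sqrt \<bar>Im z\<bar>) * real p powr (- (2 * \<sigma>))"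
      unfolding K_def using S(3)[OF r(1)] S(3)[OF r(2)] S(4)
      by (intro norm_dirichlet_kernel_le[OF pq]) (auto simp: z_def)
    also have "\<dots> = E * (real p / (1 + \<bar>Im z\<bar>) + sqrt \<bar>Im z\<bar>)" by (simp add: E_def)
    finally have "norm (K (\<rho> + cnj \<rho>')) \<le> E * (real p / (1 + \<bar>Im \<rho> - Im \<rho>'\<bar>) + sqrt \<bar>Im \<rho> - Im \<rho>'\<bar>)"
      by (simp add: z_def)
    also have "\<dots> \<le> E * (real p / (1 + \<bar>Im \<rho> - Im \<rho>'\<bar>) + sqrt (2 * T))"
      using T(1)[OF r(1)] T(1)[OF r(2)] by (intro mult_left_mono add_left_mono real_sqrt_le_mono) (auto simp: E_def)
    finally have "(w \<rho> * w \<rho>' * norm (c \<rho>) * norm (c \<rho>')) * norm (K (\<rho> + cnj \<rho>')) \<le>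
       (w \<rho> * w \<rho>' * norm (c \<rho>) * norm (c \<rho>')) * (E * (real p / (1 + \<bar>Im \<rho> - Im \<rho>'\<bar>) + sqrt (2 * T)))"
      using S(2) r by (intro mult_left_mono) auto
    moreover have "norm (of_real (w \<rho>) * c \<rho> * of_real (w \<rho>') * cnj (c \<rho>') * K (\<rho> + cnj \<rho>'))
       = (w \<rho> * w \<rho>' * norm (c \<rho>) * norm (c \<rho>')) * norm (K (\<rho> + cnj \<rho>'))"
      using S(2) r by (simp add: norm_mult mult_ac)
    ultimately show "norm (of_real (w \<rho>) * c \<rho> * of_real (w \<rho>') * cnj (c \<rho>') * K (\<rho> + cnj \<rho>'))
       \<le> w \<rho> * w \<rho>' * norm (c \<rho>) * norm (c \<rho>') * (E * (real p / (1 + \<bar>Im \<rho> - Im \<rho>'\<bar>) + sqrt (2 * T)))"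
      by simp
  qed
  also have "\<dots> \<le> (E * (real p * D + sqrt (2 * T) * (\<Sum>\<rho>\<in>S. w \<rho>))) * (\<Sum>\<rho>\<in>S. w \<rho> * (norm (c \<rho>))\<^sup>2)"
  proof (rule weighted_row_sum_bound)
    fix \<rho> assume r: "\<rho> \<in> S"
    have "(\<Sum>\<rho>'\<in>S. w \<rho>' * (E * (real p / (1 + \<bar>Im \<rho> - Im \<rho>'\<bar>) + sqrt (2 * T))))
       = (\<Sum>\<rho>'\<in>S. E * real p * (w \<rho>' / (1 + \<bar>Im \<rho> - Im \<rho>'\<bar>)) + E * sqrt (2 * T) * w \<rho>')"
      by (intro sum.cong refl) (simp add: distrib_left mult_ac)
    also have "\<dots> = E * real p * (\<Sum>\<rho>'\<in>S. w \<rho>' / (1 + \<bar>Im \<rho> - Im \<rho>'\<bar>)) + E * sqrt (2 * T) * (\<Sum>\<rho>\<in>S. w \<rho>)"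
      by (simp only: sum.distrib sum_distrib_left)
    also have "\<dots> \<le> E * real p * D + E * sqrt (2 * T) * (\<Sum>\<rho>\<in>S. w \<rho>)"
      using D[OF r] by (intro add_right_mono mult_left_mono) (auto simp: E_def)
    finally show "(\<Sum>\<rho>'\<in>S. w \<rho>' * (E * (real p / (1 + \<bar>Im \<rho> - Im \<rho>'\<bar>) + sqrt (2 * T))))
       \<le> E * (real p * D + sqrt (2 * T) * (\<Sum>\<rho>\<in>S. w \<rho>))" by (simp only: distrib_left mult.assoc)
  qed (use S T in \<open>auto simp: E_def abs_minus_commute\<close>)
  finally show ?thesis by (simp add: G_def E_def)
qed

lemma halasz_montgomery:
  fixes S :: "complex set" and w :: "complex \<Rightarrow> real"
  assumes S: "finite S" "\<And>\<rho>. \<rho> \<in> S \<Longrightarrow> w \<rho> \<ge> 0" "\<And>\<rho>. \<rho> \<in> S \<Longrightarrow> \<sigma> \<le> Re \<rho>" "\<sigma> \<ge> 0"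
    and T: "\<And>\<rho>. \<rho> \<in> S \<Longrightarrow> \<bar>Im \<rho>\<bar> \<le> T" "T \<ge> 0"
    and D: "\<And>\<rho>. \<rho> \<in> S \<Longrightarrow> (\<Sum>\<rho>'\<in>S. w \<rho>' / (1 + \<bar>Im \<rho> - Im \<rho>'\<bar>)) \<le> D" "D \<ge> 0"
    and X: "X > 0" and a: "\<And>m. \<bar>a m\<bar> \<le> 1"
  shows "(\<Sum>\<rho>\<in>S. w \<rho> * (norm (dirichlet_poly a X \<rho>))\<^sup>2)
     \<le> 1512 * X powr (1 - 2 * \<sigma>) * (X * D + sqrt T * (\<Sum>\<rho>\<in>S. w \<rho>))"
proof -
  have W: "(\<Sum>\<rho>\<in>S. w \<rho>) \<ge> 0" using S(2) by (rule sum_nonneg)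
  show ?thesis
  proof (cases "X < 1 / 2")
    case True
    then show ?thesis using X T D W by (simp add: dirichlet_poly_eq_0)
  next
    case False
    then have "X \<ge> 1 / 2" by simp
    then obtain p q where pq: "{m. X \<le> real m \<and> real m < 2 * X} = {p..<q}" "1 \<le> p" "p \<le> q" "q \<le> 3 * p"
      "X \<le> real p" "real p \<le> 3 * X" "real q \<le> 4 * X" "real (card {p..<q}) \<le> 3 * X"
      by (rule dirichlet_poly_range)
    have "(\<Sum>\<rho>\<in>S. w \<rho> * (norm (\<Sum>m\<in>{p..<q}. of_real (a m) * of_nat m powr (- \<rho>)))\<^sup>2)
       \<le> 168 * real p powr (- 2 * \<sigma>) * (real p * D + sqrt (2 * T) * (\<Sum>\<rho>\<in>S. w \<rho>)) * real (card {p..<q})"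
    proof (rule duality)
      show "(\<Sum>m\<in>{p..<q}. (norm (\<Sum>\<rho>\<in>S. of_real (w \<rho>) * c \<rho> * of_nat m powr (- \<rho>)))\<^sup>2)
         \<le> 168 * real p powr (- 2 * \<sigma>) * (real p * D + sqrt (2 * T) * (\<Sum>\<rho>\<in>S. w \<rho>)) * (\<Sum>\<rho>\<in>S. w \<rho> * (norm (c \<rho>))\<^sup>2)" for c
        by (rule halasz_montgomery_gram[OF S T D(1) pq(2-4)])
      show "0 \<le> 168 * real p powr (- 2 * \<sigma>) * (real p * D + sqrt (2 * T) * (\<Sum>\<rho>\<in>S. w \<rho>))"
        using T(2) D(2) W by simp
    qed (use S a in auto)
    \<comment> \<open>168 times 3 times 3 is 1512: one 3 covers both \<open>p \<le> 3 * X\<close>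
      and sqrt 2, the other the number of terms.\<close>
    also have "\<dots> \<le> 168 * X powr (- 2 * \<sigma>) * (3 * X * D + 3 * sqrt T * (\<Sum>\<rho>\<in>S. w \<rho>)) * (3 * X)"
    proof (intro mult_mono add_mono)
      show "real p powr (- 2 * \<sigma>) \<le> X powr (- 2 * \<sigma>)"
        using pq(5) X S(4) by (intro powr_mono2') auto
      have "sqrt 2 \<le> (3::real)" by (rule real_le_lsqrt) auto
      then show "sqrt (2 * T) \<le> 3 * sqrt T"
        unfolding real_sqrt_mult using T(2) by (intro mult_right_mono) auto
    qed (use pq(6,8) T(2) D(2) X W in auto)
    also have "\<dots> = 1512 * (X powr (- 2 * \<sigma>) * X powr 1) * (X * D + sqrt T * (\<Sum>\<rho>\<in>S. w \<rho>))"
      using X by (simp add: algebra_simps)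
    also have "X powr (- 2 * \<sigma>) * X powr 1 = X powr (1 - 2 * \<sigma>)"
      by (simp only: powr_add[symmetric]) simp
    finally show ?thesis by (simp add: dirichlet_poly_def pq(1))
  qed
qed

section \<open>Analytic continuation of the zeta function\<close>

text \<open>As 1 + |s| is at least 1, different exponents can be merged, and translations cost only
  a constant factor; so the class is closed under the operations of the recurrence below. It is used
  on half planes, because one of them contains the discs of fixed radius about 3 + it for all
  t.\<close>

definition poly_growth_on :: "complex set \<Rightarrow> (complex \<Rightarrow> complex) \<Rightarrow> bool" where
  "poly_growth_on S f \<longleftrightarrow> (\<exists>C m. \<forall>s\<in>S. norm (f s) \<le> C * (1 + norm s) ^ m)"

lemma poly_growth_onI:
  assumes "\<And>s. s \<in> S \<Longrightarrow> norm (f s) \<le> C * (1 + norm s) ^ m"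
  shows "poly_growth_on S f"
  using assms unfolding poly_growth_on_def by blast

lemma poly_growth_onE:
  assumes "poly_growth_on S f"
  obtains C m where "C > 0" "\<And>s. s \<in> S \<Longrightarrow> norm (f s) \<le> C * (1 + norm s) ^ m"
proof -
  obtain C m where *: "\<And>s. s \<in> S \<Longrightarrow> norm (f s) \<le> C * (1 + norm s) ^ m"
    using assms unfolding poly_growth_on_def by blast
  have "norm (f s) \<le> max C 1 * (1 + norm s) ^ m" if "s \<in> S" for s
    using *[OF that] by (rule order_trans) (auto intro!: mult_right_mono)
  with that[of "max C 1" m] show ?thesis by auto
qed

lemma poly_growth_on_const: "poly_growth_on S (\<lambda>s. c)"
  by (rule poly_growth_onI[of _ _ "norm c" 0]) auto

lemma poly_growth_on_linear: "poly_growth_on S (\<lambda>s. c - s)"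
proof (rule poly_growth_onI[of _ _ "norm c + 1" 1])
  fix s
  have "norm (c - s) \<le> norm c + norm s" by (rule norm_triangle_ineq4)
  also have "\<dots> \<le> (norm c + 1) * (1 + norm s) ^ 1" by (simp add: algebra_simps)
  finally show "norm (c - s) \<le> (norm c + 1) * (1 + norm s) ^ 1" .
qed

lemma poly_growth_on_mult:
  assumes "poly_growth_on S f" "poly_growth_on S g"
  shows "poly_growth_on S (\<lambda>s. f s * g s)"
proof -
  obtain C m where 1: "C > 0" "\<And>s. s \<in> S \<Longrightarrow> norm (f s) \<le> C * (1 + norm s) ^ m"
    using poly_growth_onE[OF assms(1)] by blast
  obtain D n where 2: "D > 0" "\<And>s. s \<in> S \<Longrightarrow> norm (g s) \<le> D * (1 + norm s) ^ n"
    using poly_growth_onE[OF assms(2)] by blast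
  have "norm (f s * g s) \<le> (C * D) * (1 + norm s) ^ (m + n)" if "s \<in> S" for s
  proof -
    have "norm (f s * g s) \<le> (C * (1 + norm s) ^ m) * (D * (1 + norm s) ^ n)"
      unfolding norm_mult using 1 2 that by (intro mult_mono) auto
    then show ?thesis by (simp add: power_add algebra_simps)
  qed
  then show ?thesis by (rule poly_growth_onI)
qed

lemma poly_growth_on_add:
  assumes "poly_growth_on S f" "poly_growth_on S g"
  shows "poly_growth_on S (\<lambda>s. f s + g s)"
proof -
  obtain C m where 1: "C > 0" "\<And>s. s \<in> S \<Longrightarrow> norm (f s) \<le> C * (1 + norm s) ^ m"
    using poly_growth_onE[OF assms(1)] by blast
  obtain D n where 2: "D > 0" "\<And>s. s \<in> S \<Longrightarrow> norm (g s) \<le> D * (1 + norm s) ^ n"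
    using poly_growth_onE[OF assms(2)] by blast
  have "norm (f s + g s) \<le> (C + D) * (1 + norm s) ^ (m + n)" if "s \<in> S" for s
  proof -
    have "norm (f s + g s) \<le> C * (1 + norm s) ^ m + D * (1 + norm s) ^ n"
      using 1 2 that by (intro norm_triangle_mono) auto
    also have "\<dots> \<le> C * (1 + norm s) ^ (m + n) + D * (1 + norm s) ^ (m + n)"
      using 1 2 by (intro add_mono mult_left_mono power_increasing) auto
    finally show ?thesis by (simp add: algebra_simps)
  qed
  then show ?thesis by (rule poly_growth_onI)
qed

lemma poly_growth_on_sum:
  assumes "\<And>i. i \<in> I \<Longrightarrow> poly_growth_on S (f i)"
  shows "poly_growth_on S (\<lambda>s. \<Sum>i\<in>I. f i s)"
  using assms
  by (induction I rule: infinite_finite_induct) (auto intro: poly_growth_on_add poly_growth_on_const)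

lemma poly_growth_on_prod:
  assumes "\<And>i. i \<in> I \<Longrightarrow> poly_growth_on S (f i)"
  shows "poly_growth_on S (\<lambda>s. \<Prod>i\<in>I. f i s)"
  using assms
  by (induction I rule: infinite_finite_induct) (auto intro: poly_growth_on_mult poly_growth_on_const)

lemma poly_growth_on_shift:
  assumes "poly_growth_on S f" "\<And>s. s \<in> R \<Longrightarrow> s + c \<in> S"
  shows "poly_growth_on R (\<lambda>s. f (s + c))"
proof -
  obtain C m where 1: "C > 0" "\<And>s. s \<in> S \<Longrightarrow> norm (f s) \<le> C * (1 + norm s) ^ m"
    using poly_growth_onE[OF assms(1)] by blast
  have "norm (f (s + c)) \<le> (C * (1 + norm c) ^ m) * (1 + norm s) ^ m" if "s \<in> R" for s
  proof -
    have "norm (f (s + c)) \<le> C * (1 + norm (s + c)) ^ m"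
      using 1 assms(2)[OF that] by auto
    also have "\<dots> \<le> C * ((1 + norm c) * (1 + norm s)) ^ m"
    proof (intro mult_left_mono power_mono)
      have "norm (s + c) \<le> norm s + norm c" by (rule norm_triangle_ineq)
      also have "\<dots> \<le> norm s + norm c + norm s * norm c" by simp
      finally show "1 + norm (s + c) \<le> (1 + norm c) * (1 + norm s)" by (simp add: algebra_simps)
    qed (use 1 in auto)
    finally show ?thesis by (simp only: power_mult_distrib mult.assoc)
  qed
  then show ?thesis by (rule poly_growth_onI)
qed

lemma poly_growth_on_subset: "poly_growth_on S f \<Longrightarrow> R \<subseteq> S \<Longrightarrow> poly_growth_on R f"
  unfolding poly_growth_on_def by blast

section \<open>The Dirichlet series and its binomial recurrence\<close>

lemma norm_Suc_powr: "norm (of_nat (Suc n) powr s :: complex) = real (Suc n) powr Re s"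
  by (subst norm_powr_real_powr) auto

text \<open>Taylor's formula on the segment from 0 to 1. The hypothesis on \<open>Re w\<close> gives
  the exponent w - (J + 1) in the last derivative a non-positive real part, so that power of 1 + z
  is bounded by 1 and only a polynomial in |w| remains.\<close>

lemma binomial_series_remainder:
  fixes w :: complex and y :: real
  assumes y: "0 \<le> y" "y \<le> 1" and w: "Re w \<le> real J + 1"
  shows "norm ((1 + of_real y) powr w - (\<Sum>j\<le>J. (w gchoose j) * of_real y ^ j))
           \<le> (norm w + real J) ^ (J + 1) * y ^ (J + 1)"
proof -
  define f where "f = (\<lambda>i z. (\<Prod>k<i. (w - of_nat k)) * (1 + z) powr (w - of_nat i))"
  define S :: "complex set" where "S = closed_segment 0 1"
  have S: "\<exists>t. 0 \<le> t \<and> t \<le> 1 \<and> z = of_real t" if "z \<in> S" for z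
    using that by (auto simp: S_def in_segment scaleR_conv_of_real)
  have "norm (f 0 (of_real y) - (\<Sum>i\<le>J. f i 0 * (of_real y - 0) ^ i / fact i))
          \<le> (norm w + real J) ^ (J + 1) * norm (of_real y - 0 :: complex) ^ (Suc J) / fact J"
  proof (rule complex_Taylor[of S])
    fix i z assume z: "z \<in> S" "i \<le> J"
    obtain t where t: "0 \<le> t" "z = of_real t" using S[OF z(1)] by blast
    have "1 + z \<notin> \<real>\<^sub>\<le>\<^sub>0"
      using t by (auto simp: complex_nonpos_Reals_iff)
    then have "((\<lambda>z. (1 + z) powr (w - of_nat i)) has_field_derivative
        (w - of_nat i) * (1 + z) powr (w - of_nat i - 1)) (at z within S)"
      by (auto intro!: derivative_eq_intros)
    from DERIV_cmult[OF this, of "\<Prod>k<i. (w - of_nat k)"]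
    show "(f i has_field_derivative f (Suc i) z) (at z within S)"
      unfolding f_def by (rule DERIV_cong) (simp add: diff_diff_eq add.commute)
  next
    fix z assume z: "z \<in> S"
    obtain t where t: "0 \<le> t" "z = of_real t" using S[OF z] by blast
    have "norm ((1 + z) powr (w - of_nat (Suc J))) = (1 + t) powr (Re w - real (Suc J))"
      using t by (subst norm_powr_real_powr) (auto simp: complex_is_Real_iff)
    also have "\<dots> \<le> (1 + t) powr 0"
      using t w by (intro powr_mono) auto
    also have "\<dots> \<le> 1" by simp
    finally have 1: "norm ((1 + z) powr (w - of_nat (Suc J))) \<le> 1" .
    have "norm (\<Prod>k<Suc J. (w - of_nat k)) \<le> (\<Prod>k<Suc J. norm w + real J)"
      unfolding prod_norm[symmetric]
    proof (intro prod_mono conjI norm_ge_zero)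
      fix k assume "k \<in> {..<Suc J}"
      have "norm (w - of_nat k) \<le> norm w + norm (of_nat k :: complex)" by (rule norm_triangle_ineq4)
      then show "norm (w - of_nat k) \<le> norm w + real J" using \<open>k \<in> _\<close> by auto
    qed
    also have "\<dots> = (norm w + real J) ^ (J + 1)" by simp
    finally have 2: "norm (\<Prod>k<Suc J. (w - of_nat k)) \<le> (norm w + real J) ^ (J + 1)" .
    have "norm (f (Suc J) z) \<le> (norm w + real J) ^ (J + 1) * 1"
      unfolding f_def norm_mult by (intro mult_mono 1 2) auto
    then show "norm (f (Suc J) z) \<le> (norm w + real J) ^ (J + 1)" by simp
  qed (use y in \<open>auto simp: S_def in_segment scaleR_conv_of_real intro!: exI[of _ y]\<close>)
  also have "f 0 (of_real y) = (1 + of_real y) powr w" by (simp add: f_def)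
  also have "(\<Sum>i\<le>J. f i 0 * (of_real y - 0) ^ i / fact i) = (\<Sum>j\<le>J. (w gchoose j) * of_real y ^ j)"
    by (intro sum.cong) (auto simp: f_def gbinomial_prod_rev atLeast0LessThan)
  also have "(norm w + real J) ^ (J + 1) * norm (of_real y - 0 :: complex) ^ (Suc J) / fact J
     \<le> (norm w + real J) ^ (J + 1) * y ^ (J + 1) / 1"
    using y by (intro frac_le mult_mono) (auto simp: fact_ge_1)
  finally show ?thesis by simp
qed

definition zeta_series :: "complex \<Rightarrow> complex" where
  "zeta_series s = (\<Sum>n. of_nat (Suc n) powr (-s))"

lemma summable_Suc_powr: "e > 1 \<Longrightarrow> summable (\<lambda>n. real (Suc n) powr (-e))"
  using summable_real_powr_iff[of "-e"] summable_Suc_iff[of "\<lambda>n. real n powr (-e)"] by auto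

lemma summable_zeta_series:
  assumes "Re s > 1"
  shows "summable (\<lambda>n. of_nat (Suc n) powr (-s) :: complex)"
  by (rule summable_norm_cancel)
     (use summable_Suc_powr[OF assms] in \<open>simp only: norm_Suc_powr uminus_complex.sel\<close>)

lemma norm_zeta_series_le:
  assumes "Re s \<ge> e" "e > 1"
  shows "norm (zeta_series s) \<le> (\<Sum>n. real (Suc n) powr (-e))"
  unfolding zeta_series_def
  by (rule norm_suminf_le)
     (use assms summable_Suc_powr[of e] in \<open>auto simp only: norm_Suc_powr intro!: powr_mono\<close>, auto)

text \<open>With N = n + 1 this is what remains of (N + 1)^(1 - s) = N^(1 - s) (1 + 1/N)^(1 - s)
  after the binomial terms up to order \<open>J\<close>. It is of size N^(- Re s - J), so its series
  converges for Re s > 1 - J: larger \<open>J\<close> reaches further left.\<close>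

definition zeta_remainder :: "nat \<Rightarrow> nat \<Rightarrow> complex \<Rightarrow> complex" where
  "zeta_remainder J n s = of_nat (n + 2) powr (1 - s)
      - (\<Sum>j\<le>J. ((1 - s) gchoose j) * of_nat (Suc n) powr (1 - s - of_nat j))"

lemma norm_zeta_remainder_le:
  assumes "Re s \<ge> - real J"
  shows "norm (zeta_remainder J n s) \<le> (norm (1 - s) + real J) ^ (J + 1) * real (Suc n) powr (- Re s - real J)"
proof -
  define y where "y = 1 / real (Suc n)"
  have y: "0 \<le> y" "y \<le> 1" by (auto simp: y_def)
  have "of_nat (n + 2) powr (1 - s) = (complex_of_real (real (Suc n)) * of_real (1 + y)) powr (1 - s)"
  proof -
    have "real (Suc n) * (1 + y) = real (n + 2)" by (auto simp: y_def field_simps)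
    then show ?thesis by (metis of_real_mult of_real_of_nat_eq)
  qed
  also have "\<dots> = of_nat (Suc n) powr (1 - s) * (1 + of_real y) powr (1 - s)"
    using y by (subst powr_times_real) auto
  finally have 1: "of_nat (n + 2) powr (1 - s) = of_nat (Suc n) powr (1 - s) * (1 + of_real y) powr (1 - s)" .
  have 2: "of_nat (Suc n) powr (1 - s - of_nat j) = of_nat (Suc n) powr (1 - s) * complex_of_real y ^ j" for j
    by (simp add: powr_diff powr_nat' y_def power_one_over divide_inverse power_inverse del: of_nat_Suc)
  have "zeta_remainder J n s = of_nat (Suc n) powr (1 - s) *
      ((1 + of_real y) powr (1 - s) - (\<Sum>j\<le>J. ((1 - s) gchoose j) * of_real y ^ j))"
    unfolding zeta_remainder_def 1 2 by (simp add: algebra_simps sum_distrib_left)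
  also have "norm \<dots> \<le> real (Suc n) powr (1 - Re s) * ((norm (1 - s) + real J) ^ (J + 1) * y ^ (J + 1))"
    unfolding norm_mult norm_Suc_powr
    using binomial_series_remainder[OF y, of "1 - s" J] assms
    by (intro mult_mono) (auto simp: minus_complex.sel)
  also have "y ^ (J + 1) = real (Suc n) powr (- real (J + 1))"
    unfolding powr_minus powr_realpow[OF of_nat_0_less_iff[THEN iffD2, OF zero_less_Suc]]
    by (simp add: y_def power_one_over field_simps)
  also have "real (Suc n) powr (1 - Re s) * ((norm (1 - s) + real J) ^ (J + 1) * real (Suc n) powr (- real (J + 1)))
     = (norm (1 - s) + real J) ^ (J + 1) * real (Suc n) powr (- Re s - real J)"
  proof -
    have *: "real (Suc n) powr (1 - Re s) * real (Suc n) powr (- real (J + 1)) = real (Suc n) powr (- Re s - real J)"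
      unfolding powr_add[symmetric] by (rule arg_cong[where f = "\<lambda>e. real (Suc n) powr e"]) simp
    show ?thesis by (subst mult.left_commute) (simp only: *)
  qed
  finally show ?thesis .
qed

lemma holomorphic_gchoose [holomorphic_intros]:
  "f holomorphic_on S \<Longrightarrow> (\<lambda>s. f s gchoose j :: complex) holomorphic_on S"
  unfolding gbinomial_prod_rev by (intro holomorphic_intros) auto

lemma holomorphic_zeta_remainder: "zeta_remainder J n holomorphic_on S"
  unfolding zeta_remainder_def [abs_def]
  by (intro holomorphic_intros) (auto simp: complex_nonpos_Reals_iff)

lemma norm_suminf_zeta_remainder_le:
  assumes "Re s \<ge> 1 - real J + e" "e > 0"
  shows "norm (\<Sum>n. zeta_remainder J n s)
     \<le> (norm (1 - s) + real J) ^ (J + 1) * (\<Sum>n. real (Suc n) powr (- (1 + e)))"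
    and "summable (\<lambda>n. zeta_remainder J n s)"
proof -
  have sm: "summable (\<lambda>n. (norm (1 - s) + real J) ^ (J + 1) * real (Suc n) powr (- (1 + e)))"
    using assms by (intro summable_mult summable_Suc_powr) auto
  have le: "norm (zeta_remainder J n s) \<le> (norm (1 - s) + real J) ^ (J + 1) * real (Suc n) powr (- (1 + e))" for n
  proof -
    have "real (Suc n) powr (- Re s - real J) \<le> real (Suc n) powr (- (1 + e))"
      using assms by (intro powr_mono) auto
    then show ?thesis
      using norm_zeta_remainder_le[of J s n] assms
      by (smt (verit) mult_left_mono norm_ge_zero of_nat_0_le_iff zero_le_power)
  qed
  show "summable (\<lambda>n. zeta_remainder J n s)"
    by (rule summable_comparison_test'[OF sm, of 0]) (rule le)
  have "norm (\<Sum>n. zeta_remainder J n s) \<le> (\<Sum>n. (norm (1 - s) + real J) ^ (J + 1) * real (Suc n) powr (- (1 + e)))"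
    by (rule norm_suminf_le[OF le sm])
  also have "\<dots> = (norm (1 - s) + real J) ^ (J + 1) * (\<Sum>n. real (Suc n) powr (- (1 + e)))"
    using assms by (intro suminf_mult summable_Suc_powr) auto
  finally show "norm (\<Sum>n. zeta_remainder J n s)
     \<le> (norm (1 - s) + real J) ^ (J + 1) * (\<Sum>n. real (Suc n) powr (- (1 + e)))" .
qed

lemma holomorphic_suminf_zeta_remainder:
  "(\<lambda>s. \<Sum>n. zeta_remainder J n s) holomorphic_on {s. Re s > 1 - real J}"
proof (rule holomorphic_uniform_sequence[where f = "\<lambda>N s. \<Sum>n<N. zeta_remainder J n s"])
  show "open {s. Re s > 1 - real J}" by (rule open_halfspace_Re_gt)
  show "(\<lambda>s. \<Sum>n<N. zeta_remainder J n s) holomorphic_on {s. Re s > 1 - real J}" for N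
    by (intro holomorphic_on_sum holomorphic_zeta_remainder)
  fix x assume x: "x \<in> {s. Re s > 1 - real J}"
  \<comment> \<open>Half the distance to the boundary line, so that the closed disc keeps a margin
    \<open>d\<close> and the majorant has exponent - (1 + d).\<close>
  define d where "d = (Re x - (1 - real J)) / 2"
  have d: "d > 0" using x by (auto simp: d_def)
  have re: "Re s \<ge> 1 - real J + d" if "s \<in> cball x d" for s
    using abs_Re_le_cmod[of "x - s"] that by (simp add: d_def dist_norm field_simps)
  have nm: "norm (1 - s) \<le> 1 + norm x + d" if "s \<in> cball x d" for s
  proof -
    have "norm (1 - s) = norm (1 - x + (x - s))" by simp
    also have "\<dots> \<le> norm (1 - x) + norm (x - s)" by (rule norm_triangle_ineq)
    also have "norm (1 - x) \<le> 1 + norm x" using norm_triangle_ineq4[of 1 x] by simp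
    finally show ?thesis using that by (simp add: dist_norm)
  qed
  have "uniform_limit (cball x d) (\<lambda>N s. \<Sum>n<N. zeta_remainder J n s) (\<lambda>s. \<Sum>n. zeta_remainder J n s) sequentially"
  proof (rule Weierstrass_m_test)
    show "summable (\<lambda>n. (1 + norm x + d + real J) ^ (J + 1) * real (Suc n) powr (- (1 + d)))"
      using d by (intro summable_mult summable_Suc_powr) auto
    fix n s assume s: "s \<in> cball x d"
    have "norm (zeta_remainder J n s) \<le> (norm (1 - s) + real J) ^ (J + 1) * real (Suc n) powr (- Re s - real J)"
      using re[OF s] d by (intro norm_zeta_remainder_le) auto
    also have "\<dots> \<le> (1 + norm x + d + real J) ^ (J + 1) * real (Suc n) powr (- (1 + d))"
      using re[OF s] nm[OF s] d by (intro mult_mono power_mono powr_mono) auto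
    finally show "norm (zeta_remainder J n s) \<le> (1 + norm x + d + real J) ^ (J + 1) * real (Suc n) powr (- (1 + d))" .
  qed
  moreover have "cball x d \<subseteq> {s. Re s > 1 - real J}" using re d by fastforce
  ultimately show "\<exists>d>0. cball x d \<subseteq> {s. 1 - real J < Re s} \<and>
     uniform_limit (cball x d) (\<lambda>N s. \<Sum>n<N. zeta_remainder J n s) (\<lambda>s. \<Sum>n. zeta_remainder J n s) sequentially"
    using d by blast
qed

text \<open>Expanding \<open>(n + 1)\<^sup>1\<^sup>-\<^sup>s - n\<^sup>1\<^sup>-\<^sup>s\<close>, which telescopes to \<open>-1\<close>, in powers of \<open>1/n\<close> expresses
  \<open>(s - 1) \<zeta>(s)\<close> through \<open>\<zeta>(s + 1), \<zeta>(s + 2), \<dots>\<close>.\<close>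
lemma zeta_series_recurrence:
  assumes "Re s > 1" "J \<ge> 1"
  shows "(s - 1) * zeta_series s = 1 + (\<Sum>j=2..J. ((1 - s) gchoose j) * zeta_series (s + of_nat j - 1))
     + (\<Sum>n. zeta_remainder J n s)"
proof -
  have sm: "(\<lambda>n. of_nat (Suc n) powr (1 - s - of_nat j)) sums zeta_series (s + of_nat j - 1)" if "j \<ge> 1" for j
    using summable_zeta_series[of "s + of_nat j - 1"] assms that
    by (auto simp: zeta_series_def summable_sums algebra_simps)
  have lim: "(\<lambda>n. of_nat (Suc n) powr (1 - s)) \<longlonglongrightarrow> (0::complex)"
  proof (rule tendsto_norm_zero_cancel)
    have "(\<lambda>n. real (Suc n) powr (1 - Re s)) \<longlonglongrightarrow> 0"
      using assms filterlim_compose[OF filterlim_real_sequentially filterlim_Suc]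
      by (intro tendsto_neg_powr) auto
    then show "(\<lambda>n. norm (of_nat (Suc n) powr (1 - s) :: complex)) \<longlonglongrightarrow> 0"
      unfolding norm_Suc_powr by simp
  qed
  have tel: "(\<lambda>n. of_nat (n + 2) powr (1 - s) - of_nat (Suc n) powr (1 - s) :: complex) sums (0 - 1)"
    using telescope_sums[OF lim] by simp
  \<comment> \<open>The term j = 0 completes the telescoping difference, whose sum over n is -
    1.\<close>
  have R: "zeta_remainder J n s = (of_nat (n + 2) powr (1 - s) - of_nat (Suc n) powr (1 - s))
     - (\<Sum>j=1..J. ((1 - s) gchoose j) * of_nat (Suc n) powr (1 - s - of_nat j))" for n
  proof -
    have "{..J} = insert 0 {1..J}" using assms by auto
    then show ?thesis by (simp add: zeta_remainder_def del: of_nat_Suc)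
  qed
  have "(\<lambda>n. zeta_remainder J n s) sums ((0 - 1) - (\<Sum>j=1..J. ((1 - s) gchoose j) * zeta_series (s + of_nat j - 1)))"
    unfolding R by (intro sums_diff tel sums_sum sums_mult sm) auto
  then have "(\<Sum>n. zeta_remainder J n s) = -1 - (\<Sum>j=1..J. ((1 - s) gchoose j) * zeta_series (s + of_nat j - 1))"
    by (simp add: sums_iff)
  \<comment> \<open>The term j = 1 is \<open>(1 - s) * zeta_series s\<close>; moved across, it
    becomes the left side of the recurrence.\<close>
  also have "{1..J} = insert 1 {2..J}" using assms by auto
  finally show ?thesis by (simp add: algebra_simps)
qed

text \<open>Each induction step gains a strip of width 1: for Re s > - k the recurrence with J = k +
  1 uses only the arguments s + j - 1 with j >= 2, which lie in the previous half plane. It speaks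
  of zeta rather than of F = (s - 1) zeta, but the last factor of the binomial coefficient is - (s +
  j - 2), exactly what turns zeta(s + j - 1) into - F(s + j - 1), so no pole arises. Growth is
  claimed half a unit inside, where the remainder series is bounded uniformly up to a polynomial
  factor.\<close>

lemma zeta_continuation_halfplane:
  "\<exists>F. F holomorphic_on {s. Re s > 1 - real k} \<and> (\<forall>s. Re s > 1 \<longrightarrow> F s = (s - 1) * zeta_series s)
     \<and> poly_growth_on {s. Re s \<ge> 3/2 - real k} F"
proof (induction k)
  case 0
  have "zeta_series holomorphic_on {s. Re s > 1}"
  proof -
    \<comment> \<open>For \<open>J = 1\<close> the middle sum of the recurrence is empty, so the
      holomorphy of \<open>zeta_series\<close> itself follows from that of the remainder.\<close>
    have "(\<lambda>s. \<Sum>n. zeta_remainder 1 n s) holomorphic_on {s. Re s > 1}"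
      using holomorphic_suminf_zeta_remainder[of 1] by (rule holomorphic_on_subset) auto
    then have "(\<lambda>s. (1 + (\<Sum>n. zeta_remainder 1 n s)) / (s - 1)) holomorphic_on {s. Re s > 1}"
      by (intro holomorphic_intros) auto
    moreover have "(1 + (\<Sum>n. zeta_remainder 1 n s)) / (s - 1) = zeta_series s" if "s \<in> {s. Re s > 1}" for s
    proof -
      have "s \<noteq> 1" using that by auto
      then show ?thesis using zeta_series_recurrence[of s 1] that by (simp add: field_simps)
    qed
    ultimately show ?thesis by (rule holomorphic_transform)
  qed
  moreover have "poly_growth_on {s. Re s \<ge> 3/2} zeta_series"
    by (rule poly_growth_onI[of _ _ "\<Sum>n. real (Suc n) powr (-(3/2))" 0]) (use norm_zeta_series_le[of "3/2"] in auto)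
  then have "poly_growth_on {s. Re s \<ge> 3/2} (\<lambda>s. (- 1) * (1 - s) * zeta_series s)"
    by (intro poly_growth_on_mult poly_growth_on_const poly_growth_on_linear)
  ultimately show ?case
    by (intro exI[of _ "\<lambda>s. (- 1) * (1 - s) * zeta_series s"])
       (auto intro!: holomorphic_intros simp: algebra_simps)
next
  case (Suc k)
  then obtain F where F: "F holomorphic_on {s. Re s > 1 - real k}"
    "\<And>s. Re s > 1 \<Longrightarrow> F s = (s - 1) * zeta_series s" "poly_growth_on {s. Re s \<ge> 3/2 - real k} F" by blast
  define J where "J = Suc k"
  \<comment> \<open>The product stops before the factor absorbed into \<open>F\<close>, whose sign
    is the - 1 in the quotient. Factors are written as a constant minus s to fit
    \<open>poly_growth_on_linear\<close>.\<close>
  define G where "G = (\<lambda>s. 1 + (\<Sum>j=2..J. (\<Prod>i<j-1. (1 - of_nat i) - s) * (- 1 / fact j) * F (s + (of_nat j - 1)))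
     + (\<Sum>n. zeta_remainder J n s))"
  have "G holomorphic_on {s. Re s > 1 - real J}"
    unfolding G_def
  proof (intro holomorphic_intros holomorphic_suminf_zeta_remainder)
    fix j assume "j \<in> {2..J}"
    then have "(\<lambda>s. s + (of_nat j - 1)) ` {s. Re s > 1 - real J} \<subseteq> {s. Re s > 1 - real k}"
      by (auto simp: J_def)
    then have "(F \<circ> (\<lambda>s. s + (of_nat j - 1))) holomorphic_on {s. Re s > 1 - real J}"
      by (intro holomorphic_on_compose_gen[OF _ F(1)] holomorphic_intros)
    then show "(\<lambda>s. F (s + (of_nat j - 1))) holomorphic_on {s. Re s > 1 - real J}" by (simp add: o_def)
  qed
  moreover have "G s = (s - 1) * zeta_series s" if s: "Re s > 1" for s
  proof -
    have "(\<Prod>i<j-1. (1 - of_nat i) - s) * (- 1 / fact j) * F (s + (of_nat j - 1))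
       = ((1 - s) gchoose j) * zeta_series (s + of_nat j - 1)" if "j \<in> {2..J}" for j
    proof -
      have "F (s + (of_nat j - 1)) = (s + of_nat j - 2) * zeta_series (s + of_nat j - 1)"
        using F(2)[of "s + (of_nat j - 1)"] s that by (simp add: algebra_simps)
      moreover have "((1 - s) gchoose j) = (\<Prod>i<j-1. (1 - of_nat i) - s) * (- (s + of_nat j - 2)) / fact j"
      proof -
        obtain q where j: "j = Suc q" using \<open>j \<in> {2..J}\<close> by (cases j) auto
        have prod: "(\<Prod>i<q. 1 - s - of_nat i) = (\<Prod>i<q. (1 - of_nat i) - s)"
          by (intro prod.cong) (auto simp: algebra_simps)
        have "1 - s - of_nat q = 1 - (s + of_nat q)" by simp
        then show ?thesis
          using prod by (simp add: gbinomial_prod_rev atLeast0LessThan j)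
      qed
      moreover have "P * (- 1 / fact j) * (x * z) = P * (- x) / fact j * z" for P x z :: complex by simp
      ultimately show ?thesis by (simp only:)
    qed
    then have "(\<Sum>j=2..J. (\<Prod>i<j-1. (1 - of_nat i) - s) * (- 1 / fact j) * F (s + (of_nat j - 1)))
       = (\<Sum>j=2..J. ((1 - s) gchoose j) * zeta_series (s + of_nat j - 1))"
      by (intro sum.cong refl)
    then show ?thesis
      using zeta_series_recurrence[OF s, of J] by (simp only: G_def J_def)
  qed
  moreover have "poly_growth_on {s. Re s \<ge> 3/2 - real J} G"
    unfolding G_def
  proof (intro poly_growth_on_add poly_growth_on_const poly_growth_on_sum poly_growth_on_mult
      poly_growth_on_prod poly_growth_on_linear)
    fix j assume "j \<in> {2..J}"
    then show "poly_growth_on {s. Re s \<ge> 3/2 - real J} (\<lambda>s. F (s + (of_nat j - 1)))"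
      by (intro poly_growth_on_shift[OF F(3)]) (auto simp: J_def)
  next
    have "norm (\<Sum>n. zeta_remainder J n s) \<le>
      (real J + 1) ^ (J + 1) * (\<Sum>n. real (Suc n) powr (- (1 + 1/2))) * (1 + norm s) ^ (J + 1)"
      if "s \<in> {s. Re s \<ge> 3/2 - real J}" for s
    proof -
      have "norm (\<Sum>n. zeta_remainder J n s) \<le> (norm (1 - s) + real J) ^ (J + 1) * (\<Sum>n. real (Suc n) powr (- (1 + 1/2)))"
        using that by (intro norm_suminf_zeta_remainder_le(1)) auto
      also have "\<dots> \<le> ((real J + 1) * (1 + norm s)) ^ (J + 1) * (\<Sum>n. real (Suc n) powr (- (1 + 1/2)))"
      proof (intro mult_right_mono power_mono)
        have "norm (1 - s) \<le> 1 + norm s" using norm_triangle_ineq4[of 1 s] by simp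
        also have "1 + norm s + real J \<le> (real J + 1) * (1 + norm s)" by (simp add: algebra_simps)
        finally show "norm (1 - s) + real J \<le> (real J + 1) * (1 + norm s)" by simp
      qed (auto intro!: suminf_nonneg summable_Suc_powr[of "1 + 1/2", simplified])
      finally show ?thesis by (simp only: power_mult_distrib mult_ac)
    qed
    then show "poly_growth_on {s. Re s \<ge> 3/2 - real J} (\<lambda>s. \<Sum>n. zeta_remainder J n s)"
      by (rule poly_growth_onI)
  qed
  ultimately show ?case unfolding J_def by blast
qed

section \<open>Zeros of the zeta function\<close>

lemma halfplane_identity:
  assumes "f holomorphic_on {s. Re s > 1 - real k}" "g holomorphic_on {s. Re s > 1 - real k}"
    "\<And>s. Re s > 1 \<Longrightarrow> f s = g s" "Re s > 1 - real k"
  shows "f s = g s"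
proof (rule analytic_continuation_open[of "{s. Re s > 1}" "{s. Re s > 1 - real k}" f g])
  show "{s. 1 < Re s} \<noteq> {}" by (auto intro!: exI[of _ 2])
  show "connected {s. Re s > 1 - real k}"
    by (intro convex_connected convex_halfspace_Re_gt)
qed (use assms in \<open>auto intro: open_halfspace_Re_gt\<close>)

lemma zeta_regularization_exists:
  "\<exists>F. F holomorphic_on UNIV \<and> (\<forall>s. Re s > 1 \<longrightarrow> F s = (s - 1) * zeta_series s)
     \<and> (\<forall>k::nat. poly_growth_on {s. Re s \<ge> - real k} F)"
proof -
  obtain F where F: "\<And>k. F k holomorphic_on {s. Re s > 1 - real k}"
    "\<And>k s. Re s > 1 \<Longrightarrow> F k s = (s - 1) * zeta_series s"
    "\<And>k. poly_growth_on {s. Re s \<ge> 3/2 - real k} (F k)"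
    using zeta_continuation_halfplane by metis
  \<comment> \<open>The index only has to be large enough for s to lie in its half plane; by the
    identity theorem any other admissible index gives the same value.\<close>
  define G where "G s = F (nat \<lceil>1 - Re s\<rceil> + 1) s" for s
  have eq: "F k s = F l s" if "k \<le> l" "Re s > 1 - real k" for k l s
  proof (rule halfplane_identity[of "F k" k "F l"])
    show "F l holomorphic_on {s. Re s > 1 - real k}"
      using that by (intro holomorphic_on_subset[OF F(1)[of l]]) auto
  qed (use F that in auto)
  have G: "G s = F k s" if "Re s > 1 - real k" for k s
  proof -
    have "Re s > 1 - real (nat \<lceil>1 - Re s\<rceil> + 1)" by linarith
    then show ?thesis unfolding G_def
      using eq[of k "nat \<lceil>1 - Re s\<rceil> + 1" s] eq[of "nat \<lceil>1 - Re s\<rceil> + 1" k s] that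
      by (metis nle_le)
  qed
  have "G holomorphic_on {s. Re s > 1 - real k}" for k
    using F(1)[of k] by (rule holomorphic_transform) (simp add: G)
  then have "G holomorphic_on (\<Union>k. {s. Re s > 1 - real k})"
    by (intro holomorphic_on_UN_open) (auto intro: open_halfspace_Re_gt)
  moreover have "(\<Union>k. {s. Re s > 1 - real k}) = UNIV"
  proof safe
    fix s :: complex
    obtain k :: nat where "1 - Re s < real k" using reals_Archimedean2 by blast
    then have "Re s > 1 - real k" by linarith
    then show "s \<in> (\<Union>k. {s. Re s > 1 - real k})" by blast
  qed auto
  moreover have "poly_growth_on {s. Re s \<ge> - real k} G" for k
  proof -
    \<comment> \<open>Index k + 2 puts Re s >= - k inside both the growth region Re s >= - k - 1/2
      and the domain Re s > - k - 1.\<close>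
    have "poly_growth_on {s. Re s \<ge> - real k} (F (k + 2))"
      by (rule poly_growth_on_subset[OF F(3)]) auto
    moreover have "G s = F (k + 2) s" if "s \<in> {s. Re s \<ge> - real k}" for s
      using that by (intro G) auto
    ultimately show ?thesis unfolding poly_growth_on_def by auto
  qed
  moreover have "G s = (s - 1) * zeta_series s" if "Re s > 1" for s
    using G[of 0 s] F(2) that by auto
  ultimately show ?thesis by auto
qed

text \<open>The entire function (s - 1) zeta(s), with the growth bounds included in the description
  so that they can be read off from the choice.\<close>

definition zeta_reg :: "complex \<Rightarrow> complex" where
  "zeta_reg = (SOME F. F holomorphic_on UNIV \<and> (\<forall>s. Re s > 1 \<longrightarrow> F s = (s - 1) * zeta_series s)
     \<and> (\<forall>k::nat. poly_growth_on {s. Re s \<ge> - real k} F))"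

lemma holomorphic_zeta_reg: "zeta_reg holomorphic_on S"
  and zeta_reg_eq: "Re s > 1 \<Longrightarrow> zeta_reg s = (s - 1) * zeta_series s"
  and poly_growth_zeta_reg: "poly_growth_on {s. Re s \<ge> - real k} zeta_reg"
  using someI_ex[OF zeta_regularization_exists, folded zeta_reg_def]
  by (auto intro: holomorphic_on_subset)

text \<open>Evaluates the definite description: the quotient satisfies it, and uniqueness follows
  from the identity theorem on the connected punctured plane together with the prescribed value at
  1.\<close>

lemma zeta_eq:
  assumes "s \<noteq> 1"
  shows "zeta s = zeta_reg s / (s - 1)"
proof -
  define f where "f = (\<lambda>s. if s = 1 then 0 else zeta_reg s / (s - 1))"
  define P where "P = (\<lambda>f. f holomorphic_on (UNIV - {1}) \<and>
     (\<forall>s. Re s > 1 \<longrightarrow> (\<lambda>n. of_nat (Suc n) powr (-s)) sums f s) \<and> f 1 = (0::complex))"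
  have "(\<lambda>s. zeta_reg s / (s - 1)) holomorphic_on (UNIV - {1})"
    by (intro holomorphic_intros holomorphic_zeta_reg) auto
  then have "f holomorphic_on (UNIV - {1})"
    by (rule holomorphic_transform) (auto simp: f_def)
  moreover have "(\<lambda>n. of_nat (Suc n) powr (-s)) sums f s" if "Re s > 1" for s
  proof -
    have "s \<noteq> 1" using that by auto
    then have "f s = zeta_series s" using that by (simp add: f_def zeta_reg_eq)
    then show ?thesis using summable_zeta_series[OF that] by (simp add: zeta_series_def summable_sums)
  qed
  ultimately have Pf: "P f" by (auto simp: P_def f_def)
  have "g = f" if "P g" for g
  proof
    fix s show "g s = f s"
    proof (cases "s = 1")
      case False
      show ?thesis
      proof (rule analytic_continuation_open[of "{s. Re s > 1}" "UNIV - {1}" g f])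
        show "{s. 1 < Re s} \<noteq> {}" by (auto intro!: exI[of _ 2])
        show "connected (UNIV - {1::complex})"
          using connected_punctured_universe[of "1::complex"] by (simp add: Compl_eq_Diff_UNIV)
        show "g z = f z" if "z \<in> {s. 1 < Re s}" for z
          using \<open>P g\<close> Pf that unfolding P_def by (auto intro: sums_unique2)
      qed (use that Pf False in \<open>auto simp: P_def intro: open_halfspace_Re_gt\<close>)
    qed (use that Pf in \<open>auto simp: P_def\<close>)
  qed
  note uniq = this
  have "zeta = (THE f. P f)" by (simp only: zeta_def P_def)
  also have "\<dots> = f" using Pf uniq by (rule the_equality)
  finally have "zeta = f" .
  then have "zeta s = f s" by (rule fun_cong)
  then show ?thesis using assms by (simp add: f_def)
qed

lemma zeta_zero_iff: "s \<noteq> 1 \<Longrightarrow> zeta s = 0 \<longleftrightarrow> zeta_reg s = 0"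
  by (simp add: zeta_eq)

text \<open>On Re s = 3 the terms of the series after the first sum to at most 1/2 by telescoping,
  while |s - 1| is at least 2 and at least |t|. The first bound is the lower bound at the centre for
  Jensen's inequality; the second shows that \<open>zeta_reg\<close> is not constant.\<close>

lemma norm_zeta_reg_ge: "norm (zeta_reg (Complex 3 t)) \<ge> 1" "norm (zeta_reg (Complex 3 t)) \<ge> \<bar>t\<bar> / 2"
proof -
  define s where "s = Complex 3 t"
  have sm: "summable (\<lambda>n. of_nat (Suc n) powr (-s) :: complex)"
    by (rule summable_zeta_series) (simp add: s_def)
  have "(\<lambda>n. inverse (real (Suc n))) \<longlonglongrightarrow> 0" by (rule LIMSEQ_inverse_real_of_nat)
  then have tel: "(\<lambda>n. inverse (real (Suc n)) - inverse (real (Suc (Suc n)))) sums (inverse (real (Suc 0)) - 0)"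
    by (rule telescope_sums')
  then have tel: "(\<lambda>n. (inverse (real (Suc n)) - inverse (real (Suc (Suc n)))) / 2) sums (1 / 2)"
    using sums_divide[OF tel, of 2] by simp
  have le: "norm (of_nat (Suc (Suc n)) powr (-s) :: complex) \<le> (inverse (real (Suc n)) - inverse (real (Suc (Suc n)))) / 2" for n
  proof -
    define x where "x = real n"
    have x: "x \<ge> 0" by (simp add: x_def)
    have "norm (of_nat (Suc (Suc n)) powr (-s) :: complex) = real (Suc (Suc n)) powr (- 3)"
      unfolding norm_Suc_powr by (simp add: s_def)
    also have "\<dots> = 1 / (x + 2) ^ 3"
      by (simp add: powr_minus x_def divide_inverse add_ac)
    also have "\<dots> \<le> 1 / (2 * ((x + 1) * (x + 2)))"
    proof (rule divide_left_mono)
      have "2 * (x + 1) * (x + 2) \<le> (x + 2) ^ 2 * (x + 2)"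
        using x by (intro mult_right_mono) (auto simp: power2_eq_square algebra_simps)
      then show "2 * ((x + 1) * (x + 2)) \<le> (x + 2) ^ 3" by (simp add: power_def algebra_simps numeral_eq_Suc)
    qed (use x in auto)
    also have "\<dots> = (inverse (real (Suc n)) - inverse (real (Suc (Suc n)))) / 2"
      using x by (simp add: x_def field_simps)
    finally show ?thesis .
  qed
  have "norm (\<Sum>n. of_nat (Suc (Suc n)) powr (-s) :: complex) \<le> 1 / 2"
    using norm_suminf_le[of "\<lambda>n. of_nat (Suc (Suc n)) powr (-s) :: complex", OF le] tel
    by (auto simp: sums_iff)
  moreover have "zeta_series s = 1 + (\<Sum>n. of_nat (Suc (Suc n)) powr (-s))"
    using suminf_split_head[OF sm] by (simp add: zeta_series_def)
  ultimately have "norm (zeta_series s) \<ge> 1 / 2"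
    using norm_diff_ineq[of 1 "\<Sum>n. of_nat (Suc (Suc n)) powr (-s) :: complex"] by simp
  moreover have "norm (s - 1) \<ge> 2"
    using abs_Re_le_cmod[of "s - 1"] by (simp add: s_def)
  moreover have "norm (s - 1) \<ge> \<bar>t\<bar>"
    using abs_Im_le_cmod[of "s - 1"] by (simp add: s_def)
  ultimately have "norm (s - 1) * norm (zeta_series s) \<ge> 2 * (1 / 2)"
    "norm (s - 1) * norm (zeta_series s) \<ge> \<bar>t\<bar> * (1 / 2)" by (intro mult_mono; simp)+
  then show "norm (zeta_reg (Complex 3 t)) \<ge> 1" "norm (zeta_reg (Complex 3 t)) \<ge> \<bar>t\<bar> / 2"
    using zeta_reg_eq[of s] by (simp_all add: norm_mult s_def)
qed

section \<open>Conjugation symmetry and orders of zeros\<close>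

lemma cnj_zeta_series:
  assumes "Re s > 1"
  shows "cnj (zeta_series s) = zeta_series (cnj s)"
proof -
  have "cnj (of_nat (Suc n) powr (-s)) = of_nat (Suc n) powr (- cnj s)" for n
    by (subst cnj_powr) auto
  then show ?thesis
    using bounded_linear.suminf[OF bounded_linear_cnj summable_zeta_series[OF assms]]
    by (simp add: zeta_series_def)
qed

lemma zeta_reg_cnj: "zeta_reg (cnj s) = cnj (zeta_reg s)"
proof -
  have hol: "cnj \<circ> zeta_reg \<circ> cnj holomorphic_on UNIV"
    by (intro holomorphic_on_compose_cnj_cnj holomorphic_zeta_reg) auto
  have "zeta_reg (cnj s) = (cnj \<circ> zeta_reg \<circ> cnj) (cnj s)"
  proof (rule analytic_continuation_open[of "{s. Re s > 1}" UNIV _ _ "cnj s"])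
    show "{s. 1 < Re s} \<noteq> {}" by (auto intro!: exI[of _ 2])
    show "zeta_reg z = (cnj \<circ> zeta_reg \<circ> cnj) z" if "z \<in> {s. Re s > 1}" for z
      using that cnj_zeta_series[of "cnj z"] by (simp add: zeta_reg_eq)
  qed (use hol in \<open>auto simp only: intro: open_halfspace_Re_gt holomorphic_zeta_reg\<close>)
  then show ?thesis by simp
qed

lemma zeta_reg_nonzero: "\<exists>w. zeta_reg w \<noteq> 0"
  using norm_zeta_reg_ge(1)[of 0] by (metis norm_zero not_one_le_zero)

lemma zorder_zeta_reg_nonneg: "zorder zeta_reg s \<ge> 0"
  and zeta_reg_local_factorization:
    "\<exists>r>0. zor_poly zeta_reg s holomorphic_on cball s r \<and>
       (\<forall>w\<in>cball s r. zeta_reg w = zor_poly zeta_reg s w * (w - s) ^ nat (zorder zeta_reg s) \<and> zor_poly zeta_reg s w \<noteq> 0)"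
proof -
  have "\<exists>w\<in>UNIV. zeta_reg w \<noteq> 0" using zeta_reg_nonzero by simp
  note * = zorder_exist_zero[OF holomorphic_zeta_reg open_UNIV connected_UNIV UNIV_I this, of s]
  show "zorder zeta_reg s \<ge> 0" using conjunct1[OF *] by (simp split: if_splits)
  show "\<exists>r>0. zor_poly zeta_reg s holomorphic_on cball s r \<and>
       (\<forall>w\<in>cball s r. zeta_reg w = zor_poly zeta_reg s w * (w - s) ^ nat (zorder zeta_reg s) \<and> zor_poly zeta_reg s w \<noteq> 0)"
    using conjunct2[OF *] by blast
qed

lemma zorder_zeta:
  assumes "s \<noteq> 1"
  shows "zorder zeta s = zorder zeta_reg s"
proof -
  obtain r where r: "r > 0" "zor_poly zeta_reg s holomorphic_on cball s r"
    "\<And>w. w \<in> cball s r \<Longrightarrow> zeta_reg w = zor_poly zeta_reg s w * (w - s) ^ nat (zorder zeta_reg s) \<and> zor_poly zeta_reg s w \<noteq> 0"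
    using zeta_reg_local_factorization by blast
  note ge = zorder_zeta_reg_nonneg[of s]
  show ?thesis
  proof (rule zorder_eqI[of "ball s r - {1}" s "\<lambda>w. zor_poly zeta_reg s w / (w - 1)"])
    show "(\<lambda>w. zor_poly zeta_reg s w / (w - 1)) holomorphic_on ball s r - {1}"
      by (intro holomorphic_intros holomorphic_on_subset[OF r(2)]) auto
    show "zor_poly zeta_reg s s / (s - 1) \<noteq> 0" using r(3)[of s] r(1) assms by auto
    fix w assume w: "w \<in> ball s r - {1}" "w \<noteq> s"
    have "zeta_reg w = zor_poly zeta_reg s w * (w - s) ^ nat (zorder zeta_reg s)"
      using r(3)[of w] w by auto
    moreover have "(w - s) powi zorder zeta_reg s = (w - s) ^ nat (zorder zeta_reg s)"
      using ge by (simp add: power_int_def)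
    ultimately show "zeta w = zor_poly zeta_reg s w / (w - 1) * (w - s) powi zorder zeta_reg s"
      using w by (simp add: zeta_eq)
  qed (use r(1) assms in auto)
qed

text \<open>Conjugating the local factorization at s yields one at \<open>cnj s\<close> with the
  same exponent; zeros in the lower half plane are counted through this.\<close>

lemma zorder_zeta_reg_cnj: "zorder zeta_reg (cnj s) = zorder zeta_reg s"
proof -
  obtain r where r: "r > 0" "zor_poly zeta_reg s holomorphic_on cball s r"
    "\<And>w. w \<in> cball s r \<Longrightarrow> zeta_reg w = zor_poly zeta_reg s w * (w - s) ^ nat (zorder zeta_reg s) \<and> zor_poly zeta_reg s w \<noteq> 0"
    using zeta_reg_local_factorization by blast
  note ge = zorder_zeta_reg_nonneg[of s]
  have mem: "cnj w \<in> ball s r" if "w \<in> ball (cnj s) r" for w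
    using that complex_mod_cnj[of "cnj s - w"] by (simp add: dist_norm)
  show ?thesis
  proof (rule zorder_eqI[of "ball (cnj s) r" _ "cnj \<circ> zor_poly zeta_reg s \<circ> cnj"])
    have "cnj ` ball (cnj s) r \<subseteq> cball s r" using mem ball_subset_cball by blast
    then show "cnj \<circ> zor_poly zeta_reg s \<circ> cnj holomorphic_on ball (cnj s) r"
      by (intro holomorphic_on_compose_cnj_cnj holomorphic_on_subset[OF r(2)]) auto
    show "(cnj \<circ> zor_poly zeta_reg s \<circ> cnj) (cnj s) \<noteq> 0" using r(3)[of s] r(1) by auto
    fix w assume w: "w \<in> ball (cnj s) r" "w \<noteq> cnj s"
    have "zeta_reg (cnj w) = zor_poly zeta_reg s (cnj w) * (cnj w - s) ^ nat (zorder zeta_reg s)"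
      using r(3)[of "cnj w"] mem[OF w(1)] by auto
    from this[THEN arg_cong, of cnj]
    have "zeta_reg w = cnj (zor_poly zeta_reg s (cnj w)) * (w - cnj s) ^ nat (zorder zeta_reg s)"
      by (simp add: zeta_reg_cnj)
    moreover have "(w - cnj s) powi zorder zeta_reg s = (w - cnj s) ^ nat (zorder zeta_reg s)"
      using ge by (simp add: power_int_def)
    ultimately show "zeta_reg w = (cnj \<circ> zor_poly zeta_reg s \<circ> cnj) w * (w - cnj s) powi zorder zeta_reg s"
      by simp
  qed (use r(1) in auto)
qed

lemma zero_mult_cnj: "s \<noteq> 1 \<Longrightarrow> zero_mult (cnj s) = zero_mult s"
  using zorder_zeta_reg_cnj[of s] by (simp add: zero_mult_def zorder_zeta complex_cnj_one_iff)

lemma nontrivial_zeros_cnj: "s \<in> nontrivial_zeros \<Longrightarrow> cnj s \<in> nontrivial_zeros"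
  by (auto simp: nontrivial_zeros_def zeta_zero_iff zeta_reg_cnj)

section \<open>Counting zeros in discs\<close>

lemma finite_nontrivial_zeros: "finite {\<rho> \<in> nontrivial_zeros. a \<le> Im \<rho> \<and> Im \<rho> \<le> b}"
proof -
  define K where "K = cbox (Complex 0 a) (Complex 1 b)"
  have "\<not> zeta_reg constant_on UNIV"
  proof
    assume "zeta_reg constant_on UNIV"
    then obtain c where c: "\<And>s. zeta_reg s = c" unfolding constant_on_def by blast
    \<comment> \<open>At this height the lower bound would read |c| >= |c| + 1.\<close>
    then show False using norm_zeta_reg_ge(2)[of "2 * norm c + 2"] by simp
  qed
  then have "finite {z \<in> K. zeta_reg z = 0}"
    by (intro holomorphic_compact_finite_zeros[of _ UNIV] holomorphic_zeta_reg) (auto simp: K_def)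
  then show ?thesis
    by (rule rev_finite_subset)
       (auto simp: nontrivial_zeros_def zeta_zero_iff K_def in_cbox_complex_iff)
qed

text \<open>Points are divided out one at a time. The factors already removed do not vanish at the
  next \<open>z\<close>, so \<open>f\<close> and the remaining quotient \<open>h\<close> have the
  same order there; the new quotient is filled in at \<open>z\<close> by the value of
  \<open>zor_poly\<close>.\<close>

lemma factor_zeros:
  assumes "finite Z" "f holomorphic_on S" "open S" "connected S" "Z \<subseteq> S" "\<exists>w\<in>S. f w \<noteq> 0"
  shows "\<exists>h. h holomorphic_on S \<and> (\<forall>w\<in>S. f w = h w * (\<Prod>z\<in>Z. (w - z) ^ nat (zorder f z)))"
  using assms(1,5)
proof (induction Z rule: finite_induct)
  case empty
  then show ?case using assms by auto
next
  case (insert z Z)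
  then obtain h where h: "h holomorphic_on S"
    "\<And>w. w \<in> S \<Longrightarrow> f w = h w * (\<Prod>y\<in>Z. (w - y) ^ nat (zorder f y))" by auto
  have z: "z \<in> S" using insert by auto
  have nz: "\<exists>w\<in>S. h w \<noteq> 0" using h assms(6) by (metis mult_zero_left)
  define P where "P = (\<lambda>w. \<Prod>y\<in>Z. (w - y) ^ nat (zorder f y))"
  have Pz: "P z \<noteq> 0" using insert by (auto simp: P_def)
  note ord = zorder_exist_zero[OF h(1) assms(3,4) z nz]
  have ge: "zorder h z \<ge> 0" using conjunct1[OF ord] by (simp split: if_splits)
  obtain r where r: "r > 0" "cball z r \<subseteq> S" "zor_poly h z holomorphic_on cball z r"
    "\<And>w. w \<in> cball z r \<Longrightarrow> h w = zor_poly h z w * (w - z) ^ nat (zorder h z) \<and> zor_poly h z w \<noteq> 0"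
    using conjunct2[OF ord] by blast
  have "zorder f z = zorder h z"
  proof (rule zorder_eqI[of "ball z r" z "\<lambda>w. zor_poly h z w * P w"])
    show "(\<lambda>w. zor_poly h z w * P w) holomorphic_on ball z r"
      unfolding P_def by (intro holomorphic_intros holomorphic_on_subset[OF r(3)]) auto
    show "zor_poly h z z * P z \<noteq> 0" using r(1) r(4)[of z] Pz by auto
    fix w assume w: "w \<in> ball z r" "w \<noteq> z"
    have "w \<in> S" using w r(2) by auto
    moreover have "(w - z) powi zorder h z = (w - z) ^ nat (zorder h z)"
      using ge by (simp add: power_int_def)
    ultimately show "f w = zor_poly h z w * P w * (w - z) powi zorder h z"
      using h(2)[of w] r(2) r(4)[of w] w unfolding P_def by (auto simp: mult_ac)
  qed (use r(1) in auto)
  note ord = this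
  define g where "g = (\<lambda>w. if w = z then zor_poly h z z else h w / (w - z) ^ nat (zorder h z))"
  have "g holomorphic_on (ball z r \<union> (S - {z}))"
  proof (rule holomorphic_on_Un)
    have "zor_poly h z holomorphic_on ball z r" by (rule holomorphic_on_subset[OF r(3)]) auto
    then show "g holomorphic_on ball z r"
      by (rule holomorphic_transform) (use r(4) in \<open>auto simp: g_def\<close>)
    have "(\<lambda>w. h w / (w - z) ^ nat (zorder h z)) holomorphic_on S - {z}"
      by (intro holomorphic_intros holomorphic_on_subset[OF h(1)]) auto
    then show "g holomorphic_on S - {z}"
      by (rule holomorphic_transform) (auto simp: g_def)
  qed (use assms in auto)
  moreover have "ball z r \<union> (S - {z}) = S" using r(1,2) by auto
  moreover have "h w = g w * (w - z) ^ nat (zorder h z)" if "w \<in> S" for w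
    using r(4)[of z] r(1) by (auto simp: g_def)
  then have "f w = g w * (\<Prod>y\<in>insert z Z. (w - y) ^ nat (zorder f y))" if "w \<in> S" for w
    using h(2)[OF that] insert that by (simp add: ord)
  ultimately show ?case by auto
qed

text \<open>A crude Jensen inequality: on the circle of radius \<open>4 r\<close> every linear factor is at least
  \<open>3 r\<close>, at the centre it is at most \<open>r\<close>.\<close>
lemma zeros_in_disc_bound:
  assumes f: "f holomorphic_on UNIV" and Z: "finite Z" "Z \<subseteq> cball c r" and r: "r > 0"
    and B: "\<And>z. z \<in> cball c (4 * r) \<Longrightarrow> norm (f z) \<le> B" and c: "norm (f c) \<ge> 1"
  shows "real (\<Sum>z\<in>Z. nat (zorder f z)) \<le> ln B"
proof -
  define n where "n = (\<Sum>z\<in>Z. nat (zorder f z))"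
  obtain h where h: "h holomorphic_on UNIV" "\<And>w. f w = h w * (\<Prod>z\<in>Z. (w - z) ^ nat (zorder f z))"
    using factor_zeros[OF Z(1) f] c by (metis norm_zero not_one_le_zero UNIV_I connected_UNIV open_UNIV subset_UNIV)
  have B1: "B \<ge> 1" using B[of c] c r by auto
  have "norm (h c) \<le> B / (3 * r) ^ n"
  proof (rule maximum_modulus_frontier[of h "cball c (4 * r)"])
    fix w assume w: "w \<in> frontier (cball c (4 * r))"
    then have dw: "dist c w = 4 * r" using r by (simp add: frontier_cball)
    have "(3 * r) ^ n = (\<Prod>z\<in>Z. (3 * r) ^ nat (zorder f z))"
      by (simp add: n_def power_sum)
    also have "\<dots> \<le> (\<Prod>z\<in>Z. norm ((w - z) ^ nat (zorder f z)))"
    proof (intro prod_mono conjI)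
      fix z assume "z \<in> Z"
      then have "dist c z \<le> r" using Z by auto
      then have "norm (w - z) \<ge> 3 * r"
        using dist_triangle[of c w z] dw by (simp add: dist_norm norm_minus_commute)
      then show "(3 * r) ^ nat (zorder f z) \<le> norm ((w - z) ^ nat (zorder f z))"
        unfolding norm_power using r by (intro power_mono) auto
    qed (use r in auto)
    finally have "norm (h w) * (3 * r) ^ n \<le> norm (f w)"
      unfolding h(2)[of w] norm_mult prod_norm[symmetric] by (intro mult_left_mono) auto
    also have "\<dots> \<le> B" using B[of w] dw by auto
    finally show "norm (h w) \<le> B / (3 * r) ^ n" using r by (simp add: field_simps)
  qed (use r h in \<open>auto intro: holomorphic_on_subset holomorphic_on_imp_continuous_on\<close>)
  moreover have "norm (f c) \<le> norm (h c) * r ^ n"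
  proof -
    have "(\<Prod>z\<in>Z. norm ((c - z) ^ nat (zorder f z))) \<le> (\<Prod>z\<in>Z. r ^ nat (zorder f z))"
      using Z unfolding norm_power by (intro prod_mono conjI power_mono) (auto simp: dist_norm)
    also have "\<dots> = r ^ n" by (simp add: n_def power_sum)
    finally show ?thesis unfolding h(2)[of c] norm_mult prod_norm[symmetric] by (intro mult_left_mono) auto
  qed
  ultimately have "1 \<le> B / (3 * r) ^ n * r ^ n"
    using c r by (smt (verit) mult_right_mono zero_le_power)
  then have "3 ^ n \<le> B" using r by (simp add: power_mult_distrib field_simps)
  \<comment> \<open>The ratio of the distances on the circle and at the centre gives 3^n <= B; since
    e <= 3, this becomes n <= ln B.\<close>
  moreover have "exp (real n) \<le> 3 ^ n"
    using exp_le by (subst exp_of_nat_mult[of n 1, simplified]) (auto intro: power_mono)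
  ultimately have "exp (real n) \<le> B" by linarith
  then show ?thesis using B1 ln_ge_iff[of B "real n"] by (simp add: n_def)
qed

text \<open>The disc of radius 4 about 3 + it contains all zeros in question, as 3 + 1 = 4, and its
  centre lies where \<open>zeta_reg\<close> is bounded below. Polynomial growth makes the logarithm
  of the maximum on the larger disc O(ln (|t| + 3)); the summand 3 >= e keeps this logarithm at
  least 1.\<close>

lemma local_zero_count:
  obtains C where "C > 0"
    "\<And>t Z. Z \<subseteq> nontrivial_zeros \<Longrightarrow> (\<And>\<rho>. \<rho> \<in> Z \<Longrightarrow> \<bar>Im \<rho> - t\<bar> \<le> 1) \<Longrightarrow>
        (\<Sum>\<rho>\<in>Z. real (zero_mult \<rho>)) \<le> C * ln (\<bar>t\<bar> + 3)"
proof -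
  \<comment> \<open>The larger disc, of radius 16 about \<open>Complex 3 t\<close>, reaches left to
    Re z = - 13.\<close>
  obtain C m where C: "C > 0" "\<And>s. s \<in> {s. Re s \<ge> - real 13} \<Longrightarrow> norm (zeta_reg s) \<le> C * (1 + norm s) ^ m"
    using poly_growth_onE[OF poly_growth_zeta_reg] by blast
  define K where "K = (\<bar>ln C\<bar> + real m * ln 20) + real m"
  have K: "K \<ge> 0" by (simp add: K_def)
  have "(\<Sum>\<rho>\<in>Z. real (zero_mult \<rho>)) \<le> (K + 1) * ln (\<bar>t\<bar> + 3)"
    if Z: "Z \<subseteq> nontrivial_zeros" "\<And>\<rho>. \<rho> \<in> Z \<Longrightarrow> \<bar>Im \<rho> - t\<bar> \<le> 1" for t Z
  proof -
    define c where "c = Complex 3 t"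
    have "Z \<subseteq> {\<rho> \<in> nontrivial_zeros. t - 1 \<le> Im \<rho> \<and> Im \<rho> \<le> t + 1}"
      using Z by (force simp: abs_le_iff)
    then have fin: "finite Z" using finite_nontrivial_zeros finite_subset by blast
    have "Z \<subseteq> cball c 4"
    proof
      fix \<rho> assume "\<rho> \<in> Z"
      then have "norm (c - \<rho>) \<le> \<bar>Re (c - \<rho>)\<bar> + \<bar>Im (c - \<rho>)\<bar>" "\<bar>Im \<rho> - t\<bar> \<le> 1" "0 \<le> Re \<rho>" "Re \<rho> \<le> 1"
        using cmod_le[of "c - \<rho>"] Z by (auto simp: nontrivial_zeros_def)
      then show "\<rho> \<in> cball c 4" by (simp add: dist_norm c_def abs_minus_commute)
    qed
    moreover have "norm (zeta_reg z) \<le> C * (20 * (\<bar>t\<bar> + 3)) ^ m" if "z \<in> cball c (4 * 4)" for z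
    proof -
      have d: "norm (z - c) \<le> 16" using that by (simp add: dist_norm norm_minus_commute)
      have "Re z \<ge> - real 13" using abs_Re_le_cmod[of "z - c"] d by (simp add: c_def)
      then have "norm (zeta_reg z) \<le> C * (1 + norm z) ^ m" using C by auto
      also have "\<dots> \<le> C * (20 * (\<bar>t\<bar> + 3)) ^ m"
      proof (intro mult_left_mono power_mono)
        have "norm z \<le> norm (z - c) + norm c" using norm_triangle_ineq[of "z - c" c] by simp
        moreover have "norm c \<le> 3 + \<bar>t\<bar>" using cmod_le[of c] by (simp add: c_def)
        ultimately show "1 + norm z \<le> 20 * (\<bar>t\<bar> + 3)" using d by simp
      qed (use C in auto)
      finally show ?thesis .
    qed
    ultimately have "real (\<Sum>z\<in>Z. nat (zorder zeta_reg z)) \<le> ln (C * (20 * (\<bar>t\<bar> + 3)) ^ m)"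
      using zeros_in_disc_bound[OF holomorphic_zeta_reg fin, of c 4] norm_zeta_reg_ge(1)[of t] by (simp add: c_def)
    also have "\<dots> = ln C + real m * (ln 20 + ln (\<bar>t\<bar> + 3))"
    proof -
      have "ln (C * (20 * (\<bar>t\<bar> + 3)) ^ m) = ln C + ln ((20 * (\<bar>t\<bar> + 3)) ^ m)"
        using C(1) by (intro ln_mult_pos) auto
      also have "ln ((20 * (\<bar>t\<bar> + 3)) ^ m) = real m * ln (20 * (\<bar>t\<bar> + 3))" by (rule ln_realpow)
      also have "ln (20 * (\<bar>t\<bar> + 3)) = ln 20 + ln (\<bar>t\<bar> + 3)" by (intro ln_mult_pos) auto
      finally show ?thesis .
    qed
    also have "\<dots> \<le> (\<bar>ln C\<bar> + real m * ln 20) * 1 + real m * ln (\<bar>t\<bar> + 3)"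
      by (simp add: algebra_simps)
    also have "\<dots> \<le> (\<bar>ln C\<bar> + real m * ln 20) * ln (\<bar>t\<bar> + 3) + real m * ln (\<bar>t\<bar> + 3)"
    proof (intro add_mono mult_left_mono)
      have "exp 1 \<le> \<bar>t\<bar> + 3" using exp_le by linarith
      then show "1 \<le> ln (\<bar>t\<bar> + 3)" by (subst ln_ge_iff) auto
    qed auto
    also have "\<dots> = K * ln (\<bar>t\<bar> + 3)" by (simp add: K_def algebra_simps)
    also have "\<dots> \<le> (K + 1) * ln (\<bar>t\<bar> + 3)" by (intro mult_right_mono) auto
    also have "real (\<Sum>z\<in>Z. nat (zorder zeta_reg z)) = (\<Sum>\<rho>\<in>Z. real (zero_mult \<rho>))"
      unfolding of_nat_sum using Z(1)
      by (intro sum.cong) (auto simp: zero_mult_def zorder_zeta nontrivial_zeros_def)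
    finally show ?thesis .
  qed
  then show ?thesis using that[of "K + 1"] K by auto
qed

section \<open>Sums over the zeros\<close>

lemma sum_inverse_Suc_le: "(\<Sum>k<Suc n. 1 / (1 + real k)) \<le> 1 + ln (real (Suc n))"
proof (induction n)
  case (Suc n)
  have "1 / (1 + real (Suc n)) \<le> ln (real (Suc (Suc n))) - ln (real (Suc n))"
    using ln_Suc_minus_ln_ge[of "Suc n"] by simp
  then show ?case using Suc unfolding sum.lessThan_Suc[of _ "Suc n"] by linarith
qed auto

text \<open>Zeros are grouped by the integer part j of their vertical distance to \<rho>. Each group
  lies in two windows of half width 1, of weight O(log T) by local density, and the factors 1 / (1 +
  j) sum to another O(log T).\<close>

lemma zero_row_sum_bound:
  obtains C where "C > 0"
    "\<And>T Z \<rho>. T \<ge> 3 \<Longrightarrow> finite Z \<Longrightarrow> Z \<subseteq> nontrivial_zeros \<Longrightarrow> (\<And>\<rho>. \<rho> \<in> Z \<Longrightarrow> \<bar>Im \<rho>\<bar> \<le> T) \<Longrightarrow> \<rho> \<in> Z \<Longrightarrow>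
        (\<Sum>\<rho>'\<in>Z. real (zero_mult \<rho>') / (1 + \<bar>Im \<rho> - Im \<rho>'\<bar>)) \<le> C * (ln T)\<^sup>2"
proof -
  obtain C where C: "C > 0"
    "\<And>t Z. Z \<subseteq> nontrivial_zeros \<Longrightarrow> (\<And>\<rho>. \<rho> \<in> Z \<Longrightarrow> \<bar>Im \<rho> - t\<bar> \<le> 1) \<Longrightarrow>
        (\<Sum>\<rho>\<in>Z. real (zero_mult \<rho>)) \<le> C * ln (\<bar>t\<bar> + 3)"
    using local_zero_count by blast
  have "(\<Sum>\<rho>'\<in>Z. real (zero_mult \<rho>') / (1 + \<bar>Im \<rho> - Im \<rho>'\<bar>)) \<le> 18 * C * (ln T)\<^sup>2"
    if T: "T \<ge> 3" and Z: "finite Z" "Z \<subseteq> nontrivial_zeros" "\<And>\<rho>. \<rho> \<in> Z \<Longrightarrow> \<bar>Im \<rho>\<bar> \<le> T" "\<rho> \<in> Z" for T Z \<rho>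
  proof -
    define d where "d = (\<lambda>\<rho>'. \<bar>Im \<rho> - Im \<rho>'\<bar>)"
    define k where "k = (\<lambda>\<rho>'. nat \<lfloor>d \<rho>'\<rfloor>)"
    define n where "n = nat \<lfloor>2 * T\<rfloor>"
    have lnT: "ln T \<ge> 1"
      using exp_le T by (subst ln_ge_iff) auto
    have n: "real n \<le> 2 * T" using T by (simp add: n_def)
    have kd: "real (k \<rho>') \<le> d \<rho>'" "d \<rho>' < real (k \<rho>') + 1" for \<rho>'
      by (auto simp: k_def d_def)
    have kn: "k \<rho>' \<in> {..<Suc n}" if "\<rho>' \<in> Z" for \<rho>'
    proof -
      have "d \<rho>' \<le> 2 * T" using Z(3)[OF that] Z(3)[OF Z(4)] unfolding d_def by linarith
      then show ?thesis unfolding k_def n_def by (auto simp: less_Suc_eq_le intro!: nat_mono floor_mono)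
    qed
    have block: "(\<Sum>\<rho>' | \<rho>' \<in> Z \<and> k \<rho>' = j. real (zero_mult \<rho>') / (1 + d \<rho>')) \<le> 6 * C * ln T * (1 / (1 + real j))"
      if j: "j \<in> {..<Suc n}" for j
    proof -
      define A where "A = {\<rho>' \<in> Z. \<bar>Im \<rho>' - (Im \<rho> + real j)\<bar> \<le> 1}"
      define B where "B = {\<rho>' \<in> Z. \<bar>Im \<rho>' - (Im \<rho> - real j)\<bar> \<le> 1}"
      have fin: "finite A" "finite B" using Z(1) by (auto simp: A_def B_def)
      have sub: "{\<rho>'. \<rho>' \<in> Z \<and> k \<rho>' = j} \<subseteq> A \<union> B"
      proof
        fix \<rho>' assume r: "\<rho>' \<in> {\<rho>'. \<rho>' \<in> Z \<and> k \<rho>' = j}"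
        then have "real j \<le> \<bar>Im \<rho> - Im \<rho>'\<bar>" "\<bar>Im \<rho> - Im \<rho>'\<bar> < real j + 1"
          using kd[of \<rho>'] by (auto simp: d_def)
        then have "\<bar>Im \<rho>' - (Im \<rho> + real j)\<bar> \<le> 1 \<or> \<bar>Im \<rho>' - (Im \<rho> - real j)\<bar> \<le> 1" by linarith
        then show "\<rho>' \<in> A \<union> B" using r by (auto simp: A_def B_def)
      qed
      \<comment> \<open>The window centres are at most T + 2 T in modulus, and 3 T + 3 <= 4 T <= T^3
        for T >= 3.\<close>
      have ln: "ln (\<bar>t\<bar> + 3) \<le> 3 * ln T" if "\<bar>t\<bar> \<le> 3 * T" for t
      proof -
        have "\<bar>t\<bar> + 3 \<le> 4 * T" using that T by simp
        also have "\<dots> \<le> (T * T) * T" using T mult_mono[of 3 T 3 T] by (intro mult_right_mono) auto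
        also have "\<dots> = T ^ 3" by (simp add: power3_eq_cube)
        finally have "ln (\<bar>t\<bar> + 3) \<le> ln (T ^ 3)" using T by (subst ln_le_cancel_iff) auto
        then show ?thesis by (simp add: ln_realpow)
      qed
      have j2: "real j \<le> 2 * T" using j n by auto
      have "(\<Sum>\<rho>'\<in>A. real (zero_mult \<rho>')) \<le> C * ln (\<bar>Im \<rho> + real j\<bar> + 3)"
        by (rule C(2)) (use Z(2) in \<open>auto simp: A_def\<close>)
      also have "\<dots> \<le> C * (3 * ln T)"
        using C(1) Z(3)[OF Z(4)] j2 by (intro mult_left_mono ln) linarith+
      finally have A: "(\<Sum>\<rho>'\<in>A. real (zero_mult \<rho>')) \<le> C * (3 * ln T)" .
      have "(\<Sum>\<rho>'\<in>B. real (zero_mult \<rho>')) \<le> C * ln (\<bar>Im \<rho> - real j\<bar> + 3)"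
        by (rule C(2)) (use Z(2) in \<open>auto simp: B_def\<close>)
      also have "\<dots> \<le> C * (3 * ln T)"
        using C(1) Z(3)[OF Z(4)] j2 by (intro mult_left_mono ln) linarith+
      finally have B: "(\<Sum>\<rho>'\<in>B. real (zero_mult \<rho>')) \<le> C * (3 * ln T)" .
      have "(\<Sum>\<rho>' | \<rho>' \<in> Z \<and> k \<rho>' = j. real (zero_mult \<rho>') / (1 + d \<rho>'))
        \<le> (\<Sum>\<rho>' | \<rho>' \<in> Z \<and> k \<rho>' = j. real (zero_mult \<rho>') / (1 + real j))"
        using kd by (intro sum_mono divide_left_mono) (auto simp: d_def intro!: mult_pos_pos add_pos_nonneg)
      also have "\<dots> = (\<Sum>\<rho>' | \<rho>' \<in> Z \<and> k \<rho>' = j. real (zero_mult \<rho>')) / (1 + real j)"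
        by (simp add: sum_divide_distrib)
      also have "\<dots> \<le> (C * (3 * ln T) + C * (3 * ln T)) / (1 + real j)"
      proof (intro divide_right_mono)
        have "(\<Sum>\<rho>' | \<rho>' \<in> Z \<and> k \<rho>' = j. real (zero_mult \<rho>')) \<le> (\<Sum>\<rho>'\<in>A \<union> B. real (zero_mult \<rho>'))"
          using fin sub by (intro sum_mono2) auto
        also have "\<dots> \<le> (\<Sum>\<rho>'\<in>A. real (zero_mult \<rho>')) + (\<Sum>\<rho>'\<in>B. real (zero_mult \<rho>'))"
          using fin by (subst sum_Un) (auto intro!: sum_nonneg)
        finally show "(\<Sum>\<rho>' | \<rho>' \<in> Z \<and> k \<rho>' = j. real (zero_mult \<rho>')) \<le> C * (3 * ln T) + C * (3 * ln T)"
          using A B by linarith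
      qed auto
      finally show ?thesis by simp
    qed
    have "(\<Sum>\<rho>'\<in>Z. real (zero_mult \<rho>') / (1 + d \<rho>'))
        = (\<Sum>j\<in>{..<Suc n}. \<Sum>\<rho>' | \<rho>' \<in> Z \<and> k \<rho>' = j. real (zero_mult \<rho>') / (1 + d \<rho>'))"
      using kn Z(1) by (subst sum.group) auto
    also have "\<dots> \<le> (\<Sum>j\<in>{..<Suc n}. 6 * C * ln T * (1 / (1 + real j)))"
      by (intro sum_mono block)
    also have "\<dots> = 6 * C * ln T * (\<Sum>j<Suc n. 1 / (1 + real j))"
      by (simp only: sum_distrib_left)
    \<comment> \<open>The harmonic sum is at most 1 + ln (2 T + 1) <= 1 + 2 ln T <= 3 ln T, as 2 T +
      1 <= T^2 and ln T >= 1.\<close>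
    also have "\<dots> \<le> 6 * C * ln T * (3 * ln T)"
    proof (intro mult_left_mono)
      have "3 * T \<le> T * T" using T by (intro mult_right_mono) auto
      then have "real (Suc n) \<le> T\<^sup>2" using n T unfolding power2_eq_square of_nat_Suc by linarith
      then have "ln (real (Suc n)) \<le> ln (T\<^sup>2)" using T by (subst ln_le_cancel_iff) auto
      also have "\<dots> = 2 * ln T" using ln_realpow[of T 2] by simp
      finally show "(\<Sum>j<Suc n. 1 / (1 + real j)) \<le> 3 * ln T"
        using sum_inverse_Suc_le[of n] lnT by linarith
    qed (use C lnT in auto)
    finally show ?thesis by (simp add: d_def power2_eq_square)
  qed
  then show ?thesis using that[of "18 * C"] C(1) by auto
qed

text \<open>\<open>zero_count\<close> sees only Im \<rho> > 0. Conjugation supplies the zeros below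
  the axis, and possible real zeros are covered by the local count at t = 0, which costs the
  constant \<open>C * ln 3\<close>.\<close>

lemma sum_zero_mult_le_zero_count:
  assumes C: "\<And>t Z. Z \<subseteq> nontrivial_zeros \<Longrightarrow> (\<And>\<rho>. \<rho> \<in> Z \<Longrightarrow> \<bar>Im \<rho> - t\<bar> \<le> 1) \<Longrightarrow>
        (\<Sum>\<rho>\<in>Z. real (zero_mult \<rho>)) \<le> C * ln (\<bar>t\<bar> + 3)"
    and "\<sigma> \<ge> 0"
  shows "(\<Sum>\<rho> | \<rho> \<in> nontrivial_zeros \<and> \<sigma> \<le> Re \<rho> \<and> \<bar>Im \<rho>\<bar> \<le> T. real (zero_mult \<rho>))
     \<le> 2 * real (zero_count \<sigma> T) + C * ln 3"
proof -
  define Z where "Z = {\<rho>. \<rho> \<in> nontrivial_zeros \<and> \<sigma> \<le> Re \<rho> \<and> \<bar>Im \<rho>\<bar> \<le> T}"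
  define P where "P = {\<rho>. zeta \<rho> = 0 \<and> \<sigma> \<le> Re \<rho> \<and> Re \<rho> \<le> 1 \<and> 0 < Im \<rho> \<and> Im \<rho> \<le> T}"
  define R where "R = {\<rho> \<in> Z. Im \<rho> = 0}"
  have P: "P = {\<rho> \<in> Z. Im \<rho> > 0}"
    using assms(2) by (auto simp: P_def Z_def nontrivial_zeros_def)
  have "Z \<subseteq> {\<rho> \<in> nontrivial_zeros. - T \<le> Im \<rho> \<and> Im \<rho> \<le> T}" by (auto simp: Z_def)
  then have fin: "finite Z" using finite_nontrivial_zeros finite_subset by blast
  then have finP: "finite P" "finite R" unfolding P R_def by auto
  have "Z \<subseteq> P \<union> (cnj ` P) \<union> R"
  proof
    fix \<rho> assume r: "\<rho> \<in> Z"
    have "cnj \<rho> \<in> P" if "Im \<rho> < 0"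
      using r that nontrivial_zeros_cnj[of \<rho>] unfolding P by (auto simp: Z_def)
    then have "\<rho> \<in> cnj ` P" if "Im \<rho> < 0" using that by (metis complex_cnj_cnj image_eqI)
    then show "\<rho> \<in> P \<union> (cnj ` P) \<union> R"
      using r unfolding P R_def by (cases "Im \<rho>" "0 :: real" rule: linorder_cases) auto
  qed
  then have "(\<Sum>\<rho>\<in>Z. real (zero_mult \<rho>)) \<le> (\<Sum>\<rho>\<in>P \<union> (cnj ` P) \<union> R. real (zero_mult \<rho>))"
    using finP by (intro sum_mono2) auto
  also have "\<dots> \<le> (\<Sum>\<rho>\<in>P. real (zero_mult \<rho>)) + (\<Sum>\<rho>\<in>cnj ` P. real (zero_mult \<rho>)) + (\<Sum>\<rho>\<in>R. real (zero_mult \<rho>))"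
  proof -
    have un: "(\<Sum>\<rho>\<in>A \<union> B. real (zero_mult \<rho>)) \<le> (\<Sum>\<rho>\<in>A. real (zero_mult \<rho>)) + (\<Sum>\<rho>\<in>B. real (zero_mult \<rho>))"
      if "finite A" "finite B" for A B
      using that by (subst sum_Un) (auto intro!: sum_nonneg)
    show ?thesis using un[of "P \<union> cnj ` P" R] un[of P "cnj ` P"] finP by auto
  qed
  also have "(\<Sum>\<rho>\<in>cnj ` P. real (zero_mult \<rho>)) = (\<Sum>\<rho>\<in>P. real (zero_mult (cnj \<rho>)))"
    by (subst sum.reindex) (auto simp: inj_on_def o_def)
  also have "\<dots> = (\<Sum>\<rho>\<in>P. real (zero_mult \<rho>))"
    by (intro sum.cong refl arg_cong[where f = real] zero_mult_cnj) (auto simp: P_def)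
  also have "(\<Sum>\<rho>\<in>P. real (zero_mult \<rho>)) = real (zero_count \<sigma> T)"
    by (simp add: zero_count_def P_def)
  also have "(\<Sum>\<rho>\<in>R. real (zero_mult \<rho>)) \<le> C * ln (\<bar>0\<bar> + 3)"
    by (rule C) (auto simp: R_def Z_def)
  finally show ?thesis by (simp add: Z_def)
qed

text \<open>Cauchy-Schwarz with each weight split into two square roots. The product of the bounds
  has four terms, and \<open>h\<close> says that each exponent is at most 2 - 2 \<sigma>; four such
  terms give 2 K after taking the root. The exponent \<open>e\<close> is that of the secondary term:
  1 - \<theta> for the mean value bound, one depending on \<sigma> for Halasz-Montgomery.\<close>

lemma sum_product_bound:
  fixes S :: "complex set" and w :: "complex \<Rightarrow> real" and f g :: "complex \<Rightarrow> complex"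
  assumes w: "\<And>\<rho>. \<rho> \<in> S \<Longrightarrow> w \<rho> \<ge> 0" and x: "x \<ge> 1" and K: "K \<ge> 0"
    and f: "(\<Sum>\<rho>\<in>S. w \<rho> * (norm (f \<rho>))\<^sup>2) \<le> K * x powr (u * (1 - 2 * \<sigma>)) * (x powr u + x powr e)"
    and g: "(\<Sum>\<rho>\<in>S. w \<rho> * (norm (g \<rho>))\<^sup>2) \<le> K * x powr (v * (1 - 2 * \<sigma>)) * (x powr v + x powr e)"
    and h: "(u + v) * (1 - 2 * \<sigma>) + (u + v) \<le> 2 - 2 * \<sigma>" "(u + v) * (1 - 2 * \<sigma>) + (u + e) \<le> 2 - 2 * \<sigma>"
      "(u + v) * (1 - 2 * \<sigma>) + (v + e) \<le> 2 - 2 * \<sigma>" "(u + v) * (1 - 2 * \<sigma>) + 2 * e \<le> 2 - 2 * \<sigma>"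
  shows "(\<Sum>\<rho>\<in>S. w \<rho> * norm (f \<rho> * g \<rho>)) \<le> 2 * K * x powr (1 - \<sigma>)"
proof -
  define F where "F = (\<Sum>\<rho>\<in>S. w \<rho> * (norm (f \<rho>))\<^sup>2)"
  define G where "G = (\<Sum>\<rho>\<in>S. w \<rho> * (norm (g \<rho>))\<^sup>2)"
  have FG: "0 \<le> F" "0 \<le> G" unfolding F_def G_def using w by (auto intro!: sum_nonneg)
  have "(\<Sum>\<rho>\<in>S. w \<rho> * norm (f \<rho> * g \<rho>)) = (\<Sum>\<rho>\<in>S. (sqrt (w \<rho>) * norm (f \<rho>)) * (sqrt (w \<rho>) * norm (g \<rho>)))"
  proof (intro sum.cong refl)
    fix \<rho> assume "\<rho> \<in> S"
    then have "w \<rho> = sqrt (w \<rho>) * sqrt (w \<rho>)" using w by simp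
    then show "w \<rho> * norm (f \<rho> * g \<rho>) = (sqrt (w \<rho>) * norm (f \<rho>)) * (sqrt (w \<rho>) * norm (g \<rho>))"
      by (metis (no_types, opaque_lifting) mult.assoc mult.left_commute norm_mult)
  qed
  then have "(\<Sum>\<rho>\<in>S. w \<rho> * norm (f \<rho> * g \<rho>))\<^sup>2 \<le>
      (\<Sum>\<rho>\<in>S. (sqrt (w \<rho>) * norm (f \<rho>))\<^sup>2) * (\<Sum>\<rho>\<in>S. (sqrt (w \<rho>) * norm (g \<rho>))\<^sup>2)"
    using Cauchy_Schwarz_ineq_sum by metis
  also have "\<dots> = F * G"
    unfolding F_def G_def using w by (simp add: power_mult_distrib)
  also have "\<dots> \<le> (K * x powr (u * (1 - 2 * \<sigma>)) * (x powr u + x powr e)) * (K * x powr (v * (1 - 2 * \<sigma>)) * (x powr v + x powr e))"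
    using f g FG K by (intro mult_mono) (auto simp: F_def G_def)
  also have "\<dots> = K\<^sup>2 * (x powr ((u + v) * (1 - 2 * \<sigma>) + (u + v)) + x powr ((u + v) * (1 - 2 * \<sigma>) + (u + e))
       + x powr ((u + v) * (1 - 2 * \<sigma>) + (v + e)) + x powr ((u + v) * (1 - 2 * \<sigma>) + 2 * e))"
  proof -
    define a b where "a = x powr (u * (1 - 2 * \<sigma>))" and "b = x powr (v * (1 - 2 * \<sigma>))"
    have ab: "x powr ((u + v) * (1 - 2 * \<sigma>) + r) = a * b * x powr r" for r
      by (simp add: a_def b_def powr_add[symmetric] algebra_simps)
    have 2: "x powr (2 * e) = x powr e * x powr e" by (simp add: powr_add[symmetric])
    show ?thesis unfolding ab a_def[symmetric] b_def[symmetric] powr_add[of x u] powr_add[of x v e] 2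
      by (simp add: power2_eq_square algebra_simps)
  qed
  also have "\<dots> \<le> K\<^sup>2 * (x powr (2 - 2 * \<sigma>) + x powr (2 - 2 * \<sigma>) + x powr (2 - 2 * \<sigma>) + x powr (2 - 2 * \<sigma>))"
    using x h by (intro mult_left_mono add_mono powr_mono) auto
  also have "\<dots> = (2 * K * x powr (1 - \<sigma>))\<^sup>2"
    by (simp add: power2_eq_square powr_add[symmetric])
  finally have "(\<Sum>\<rho>\<in>S. w \<rho> * norm (f \<rho> * g \<rho>))\<^sup>2 \<le> (2 * K * x powr (1 - \<sigma>))\<^sup>2" .
  then show ?thesis by (rule power2_le_imp_le) (use K in simp)
qed

text \<open>Left minus right side has slope 2 (1 - (u + v)) >= 0 in \<sigma> in the last three
  claims, so \<sigma> = \<sigma>0 is the worst case; there they are precisely the two mixed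
  conditions on u, v and the lower bound for u + v. The first claim is u + v <= 1 multiplied by 2 -
  2 \<sigma>.\<close>

lemma exponents_below:
  fixes \<theta> \<sigma>0 \<sigma> u v :: real
  assumes "1/2 \<le> \<theta>" "1/2 < \<sigma>0" "\<sigma> \<le> \<sigma>0" "\<sigma> \<le> 1"
    and uv: "(2 * \<sigma>0 - 2 * \<theta>) / (2 * \<sigma>0 - 1) \<le> u + v" "u + v \<le> 1"
      "u * (2 - 2 * \<sigma>0) + v * (1 - 2 * \<sigma>0) \<le> \<theta> + 1 - 2 * \<sigma>0"
      "v * (2 - 2 * \<sigma>0) + u * (1 - 2 * \<sigma>0) \<le> \<theta> + 1 - 2 * \<sigma>0"
  shows "(u + v) * (1 - 2 * \<sigma>) + (u + v) \<le> 2 - 2 * \<sigma>" "(u + v) * (1 - 2 * \<sigma>) + (u + (1 - \<theta>)) \<le> 2 - 2 * \<sigma>"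
    "(u + v) * (1 - 2 * \<sigma>) + (v + (1 - \<theta>)) \<le> 2 - 2 * \<sigma>" "(u + v) * (1 - 2 * \<sigma>) + 2 * (1 - \<theta>) \<le> 2 - 2 * \<sigma>"
proof -
  have 0: "2 * \<sigma>0 - 2 * \<theta> \<le> (u + v) * (2 * \<sigma>0 - 1)" using uv(1) assms by (simp add: field_simps)
  have 1: "0 \<le> (1 - (u + v)) * (1 - \<sigma>)" using uv assms by (intro mult_nonneg_nonneg) auto
  have 2: "0 \<le> (1 - (u + v)) * (\<sigma>0 - \<sigma>)" using uv assms by (intro mult_nonneg_nonneg) auto
  show "(u + v) * (1 - 2 * \<sigma>) + (u + v) \<le> 2 - 2 * \<sigma>" using 1 by (simp add: algebra_simps)
  show "(u + v) * (1 - 2 * \<sigma>) + (u + (1 - \<theta>)) \<le> 2 - 2 * \<sigma>"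
    "(u + v) * (1 - 2 * \<sigma>) + (v + (1 - \<theta>)) \<le> 2 - 2 * \<sigma>" using 2 uv by (simp_all add: algebra_simps)
  show "(u + v) * (1 - 2 * \<sigma>) + 2 * (1 - \<theta>) \<le> 2 - 2 * \<sigma>" using 2 0 by (simp add: algebra_simps)
qed

text \<open>The exponents are affine in \<open>\<sigma>\<close>; at \<open>\<sigma> = 1\<close> the conditions read \<open>u, v \<ge> (1 - \<theta>) / 2\<close>, and this is
  exactly what the upper bound on \<open>\<theta>\<close> provides.\<close>
lemma exponents_above:
  fixes \<theta> \<sigma>0 \<sigma> u v :: real
  assumes "1/2 \<le> \<theta>" "1/2 < \<sigma>0" "\<sigma>0 < 1" "\<sigma>0 \<le> \<sigma>" "\<sigma> \<le> 1" and \<theta>: "\<theta> \<le> (3 - 2 * \<sigma>0) / (7 - 6 * \<sigma>0)"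
    and uv: "(2 * \<sigma>0 - 2 * \<theta>) / (2 * \<sigma>0 - 1) \<le> u + v" "u + v \<le> 1"
      "u * (2 - 2 * \<sigma>0) + v * (1 - 2 * \<sigma>0) \<le> \<theta> + 1 - 2 * \<sigma>0"
      "v * (2 - 2 * \<sigma>0) + u * (1 - 2 * \<sigma>0) \<le> \<theta> + 1 - 2 * \<sigma>0"
    and e: "e = (1 - \<theta>) * (1 / 2 + (1 - \<sigma>) / (2 * (1 - \<sigma>0)))"
  shows "(u + v) * (1 - 2 * \<sigma>) + (u + v) \<le> 2 - 2 * \<sigma>" "(u + v) * (1 - 2 * \<sigma>) + (u + e) \<le> 2 - 2 * \<sigma>"
    "(u + v) * (1 - 2 * \<sigma>) + (v + e) \<le> 2 - 2 * \<sigma>" "(u + v) * (1 - 2 * \<sigma>) + 2 * e \<le> 2 - 2 * \<sigma>"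
proof -
  define a where "a = 2 * \<sigma>0 - 1"
  have a: "0 < a" "a < 1" using assms by (auto simp: a_def)
  have \<sigma>0: "\<sigma>0 = (1 + a) / 2" by (simp add: a_def)
  have w: "a + 1 - 2 * \<theta> \<le> (u + v) * a" using uv(1) a by (simp add: \<sigma>0 field_simps)
  have th: "\<theta> * (4 - 3 * a) \<le> 2 - a" using \<theta> a by (simp add: \<sigma>0 field_simps)
  \<comment> \<open>Eliminating w = u + v gives a v >= 1 - 2 \<theta> + a \<theta>, and
    \<open>th\<close> says exactly that this is at least a (1 - \<theta>) / 2. The fact is used
    twice, with u and v exchanged.\<close>
  have lower: "(1 - \<theta>) / 2 \<le> v" if "u + v = w" "a + 1 - 2 * \<theta> \<le> w * a" "w * (1 - a) - v \<le> \<theta> - a" for u v w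
  proof -
    have "(a + 1 - 2 * \<theta>) * (1 - a) \<le> (w * a) * (1 - a)" using that a by (intro mult_right_mono) auto
    moreover have "a * (w * (1 - a) - v) \<le> a * (\<theta> - a)" using that a by (intro mult_left_mono) auto
    ultimately have "a * ((1 - \<theta>) / 2) \<le> a * v" using th by (simp add: algebra_simps)
    then show ?thesis using a by simp
  qed
  have "(u + v) * (1 - a) - v \<le> \<theta> - a" "(u + v) * (1 - a) - u \<le> \<theta> - a"
    using uv(3,4) by (simp_all add: a_def algebra_simps)
  then have v: "(1 - \<theta>) / 2 \<le> v" and u: "(1 - \<theta>) / 2 \<le> u"
    using lower[of u v "u + v"] lower[of v u "u + v"] w by (simp_all add: add.commute)
  \<comment> \<open>Interpolation parameter: s = 1 at \<open>\<sigma>0\<close>, where e = 1 -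
    \<theta> and \<open>exponents_below\<close> applies, and s = 0 at 1. Each claim is a combination
    of the two endpoint cases with weights s and 1 - s.\<close>
  define s where "s = (1 - \<sigma>) / (1 - \<sigma>0)"
  have s: "0 \<le> s" "s \<le> 1" using assms by (auto simp: s_def)
  have \<sigma>: "\<sigma> = 1 - s * (1 - \<sigma>0)" using assms by (simp add: s_def)
  have e': "e = (1 - \<theta>) * (1 / 2 + s / 2)" using assms by (simp add: e s_def)
  have s0: "\<sigma>0 \<le> 1" using assms by simp
  have 1: "0 \<le> s * (2 - 2 * \<sigma>0 - ((u + v) * (1 - 2 * \<sigma>0) + (u + v)))"
    "0 \<le> s * (2 - 2 * \<sigma>0 - ((u + v) * (1 - 2 * \<sigma>0) + (u + (1 - \<theta>))))"
    "0 \<le> s * (2 - 2 * \<sigma>0 - ((u + v) * (1 - 2 * \<sigma>0) + (v + (1 - \<theta>))))"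
    "0 \<le> s * (2 - 2 * \<sigma>0 - ((u + v) * (1 - 2 * \<sigma>0) + 2 * (1 - \<theta>)))"
    using s exponents_below[OF assms(1,2) order_refl s0 uv] by (auto intro!: mult_nonneg_nonneg)
  have 2: "0 \<le> (1 - s) * (v - (1 - \<theta>) / 2)" "0 \<le> (1 - s) * (u - (1 - \<theta>) / 2)"
    using s u v by (auto intro!: mult_nonneg_nonneg)
  show "(u + v) * (1 - 2 * \<sigma>) + (u + v) \<le> 2 - 2 * \<sigma>" "(u + v) * (1 - 2 * \<sigma>) + (u + e) \<le> 2 - 2 * \<sigma>"
    "(u + v) * (1 - 2 * \<sigma>) + (v + e) \<le> 2 - 2 * \<sigma>" "(u + v) * (1 - 2 * \<sigma>) + 2 * e \<le> 2 - 2 * \<sigma>"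
    using 1 2 unfolding \<sigma> e' by (simp_all add: field_simps)
qed

theorem lemma3p1:
  fixes B :: real
  shows "\<exists>c::real. \<forall>(\<theta>::real) (\<sigma>0::real) (A :: real \<Rightarrow> real).
    1/2 \<le> \<theta> \<and> \<theta> < 1 \<and> 1/2 < \<sigma>0 \<and> \<sigma>0 < 1 \<and>
    (\<forall>\<sigma>\<in>{0..1}. 0 \<le> A \<sigma>) \<and>
    A \<sigma>0 = 1 / (2 * (1 - \<sigma>0)) \<and>
    antimono_on {\<sigma>0..1} A \<and>
    zero_density A B \<and>
    \<theta> \<le> (3 - 2 * \<sigma>0) / (7 - 6 * \<sigma>0) \<longrightarrow>
    (\<exists>K x0 :: real. \<forall>x\<ge>x0. \<forall>(u::real) (v::real) (a :: nat \<Rightarrow> real) (b :: nat \<Rightarrow> real). \<forall>\<sigma>\<in>{0..1}.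
       (2 * \<sigma>0 - 2 * \<theta>) / (2 * \<sigma>0 - 1) \<le> u + v \<and> u + v \<le> 1 \<and>
       u * (2 - 2 * \<sigma>0) + v * (1 - 2 * \<sigma>0) \<le> \<theta> + 1 - 2 * \<sigma>0 \<and>
       v * (2 - 2 * \<sigma>0) + u * (1 - 2 * \<sigma>0) \<le> \<theta> + 1 - 2 * \<sigma>0 \<and>
       (\<forall>m. 0 \<le> a m \<and> a m \<le> 1) \<and> (\<forall>n. 0 \<le> b n \<and> b n \<le> 1) \<longrightarrow>
       (\<Sum>\<rho> | \<rho> \<in> nontrivial_zeros \<and> \<sigma> \<le> Re \<rho> \<and> \<bar>Im \<rho>\<bar> \<le> x powr (1 - \<theta>).
          real (zero_mult \<rho>) *
          norm (dirichlet_poly a (x powr u) \<rho> * dirichlet_poly b (x powr v) \<rho>))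
       \<le> K * x powr (1 - \<sigma>) * ln x powr c)"
proof -
  obtain C where C: "C > 0"
    "\<And>T Z \<rho>. T \<ge> 3 \<Longrightarrow> finite Z \<Longrightarrow> Z \<subseteq> nontrivial_zeros \<Longrightarrow> (\<And>\<rho>. \<rho> \<in> Z \<Longrightarrow> \<bar>Im \<rho>\<bar> \<le> T) \<Longrightarrow> \<rho> \<in> Z \<Longrightarrow>
        (\<Sum>\<rho>'\<in>Z. real (zero_mult \<rho>') / (1 + \<bar>Im \<rho> - Im \<rho>'\<bar>)) \<le> C * (ln T)\<^sup>2"
    using zero_row_sum_bound by blast
  obtain C0 where C0: "C0 > 0"
    "\<And>t Z. Z \<subseteq> nontrivial_zeros \<Longrightarrow> (\<And>\<rho>. \<rho> \<in> Z \<Longrightarrow> \<bar>Im \<rho> - t\<bar> \<le> 1) \<Longrightarrow>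
        (\<Sum>\<rho>\<in>Z. real (zero_mult \<rho>)) \<le> C0 * ln (\<bar>t\<bar> + 3)"
    using local_zero_count by blast
  \<comment> \<open>The row sums cost log^2 and the zero density log^B. Both polynomials are bounded
    with the same power of the logarithm, so Cauchy-Schwarz preserves it.\<close>
  define c where "c = max 2 B"
  show ?thesis
  proof (rule exI[of _ c], intro allI impI, elim conjE)
    fix \<theta> \<sigma>0 :: real and A :: "real \<Rightarrow> real"
    assume \<theta>: "1/2 \<le> \<theta>" "\<theta> < 1" and \<sigma>0: "1/2 < \<sigma>0" "\<sigma>0 < 1"
      and A: "A \<sigma>0 = 1 / (2 * (1 - \<sigma>0))" "antimono_on {\<sigma>0..1} A"
      and zd: "zero_density A B" and \<theta>2: "\<theta> \<le> (3 - 2 * \<sigma>0) / (7 - 6 * \<sigma>0)"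
    obtain C1' T0 where C1': "\<And>T \<sigma>. T \<ge> T0 \<Longrightarrow> \<sigma> \<in> {1/2..1} \<Longrightarrow>
        real (zero_count \<sigma> T) \<le> C1' * T powr (A \<sigma> * (1 - \<sigma>)) * ln T powr B"
      using zd unfolding zero_density_def by blast
    \<comment> \<open>The factor 2 stands for conjugate pairs, the last summand for real zeros; the
      absolute value is taken because the sign of \<open>C1'\<close> is unknown.\<close>
    define C1 where "C1 = 2 * \<bar>C1'\<bar> + C0 * ln 3"
    have C1: "C1 \<ge> 0" using C0(1) by (simp add: C1_def)
    \<comment> \<open>T >= 3 ensures ln T >= 1, so powers of ln T grow with the exponent;
      \<open>x0\<close> is chosen so that x^(1 - \<theta>) >= \<open>T1\<close>.\<close>
    define T1 where "T1 = max T0 3"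
    define x0 where "x0 = max 3 (T1 powr (1 / (1 - \<theta>)))"
    define K where "K = 48 * C + 1512 * (C + C1)"
    show "\<exists>K x0 :: real. \<forall>x\<ge>x0. \<forall>(u::real) (v::real) (a :: nat \<Rightarrow> real) (b :: nat \<Rightarrow> real). \<forall>\<sigma>\<in>{0..1}.
       (2 * \<sigma>0 - 2 * \<theta>) / (2 * \<sigma>0 - 1) \<le> u + v \<and> u + v \<le> 1 \<and>
       u * (2 - 2 * \<sigma>0) + v * (1 - 2 * \<sigma>0) \<le> \<theta> + 1 - 2 * \<sigma>0 \<and>
       v * (2 - 2 * \<sigma>0) + u * (1 - 2 * \<sigma>0) \<le> \<theta> + 1 - 2 * \<sigma>0 \<and>
       (\<forall>m. 0 \<le> a m \<and> a m \<le> 1) \<and> (\<forall>n. 0 \<le> b n \<and> b n \<le> 1) \<longrightarrow>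
       (\<Sum>\<rho> | \<rho> \<in> nontrivial_zeros \<and> \<sigma> \<le> Re \<rho> \<and> \<bar>Im \<rho>\<bar> \<le> x powr (1 - \<theta>).
          real (zero_mult \<rho>) *
          norm (dirichlet_poly a (x powr u) \<rho> * dirichlet_poly b (x powr v) \<rho>))
       \<le> K * x powr (1 - \<sigma>) * ln x powr c"
    proof (rule exI[of _ "2 * K"], rule exI[of _ x0], intro allI impI ballI, elim conjE)
      fix x u v \<sigma> :: real and a b :: "nat \<Rightarrow> real"
      assume x: "x0 \<le> x" and \<sigma>: "\<sigma> \<in> {0..1}"
        and uv: "(2 * \<sigma>0 - 2 * \<theta>) / (2 * \<sigma>0 - 1) \<le> u + v" "u + v \<le> 1"
          "u * (2 - 2 * \<sigma>0) + v * (1 - 2 * \<sigma>0) \<le> \<theta> + 1 - 2 * \<sigma>0"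
          "v * (2 - 2 * \<sigma>0) + u * (1 - 2 * \<sigma>0) \<le> \<theta> + 1 - 2 * \<sigma>0"
        and ab: "\<forall>m. 0 \<le> a m \<and> a m \<le> 1" "\<forall>n. 0 \<le> b n \<and> b n \<le> 1"
      define T where "T = x powr (1 - \<theta>)"
      define S where "S = {\<rho>. \<rho> \<in> nontrivial_zeros \<and> \<sigma> \<le> Re \<rho> \<and> \<bar>Im \<rho>\<bar> \<le> T}"
      define w where "w \<rho> = real (zero_mult \<rho>)" for \<rho>
      define L where "L = ln x powr c"
      have x3: "x \<ge> 3" using x by (simp add: x0_def)
      have "T1 = (T1 powr (1 / (1 - \<theta>))) powr (1 - \<theta>)" using \<theta> by (simp add: powr_powr T1_def)
      also have "\<dots> \<le> T" unfolding T_def using x \<theta> by (intro powr_mono2) (auto simp: x0_def)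
      finally have T: "T \<ge> T0" "T \<ge> 3" by (auto simp: T1_def)
      have lnT: "1 \<le> ln T" using exp_le T by (subst ln_ge_iff) auto
      have "ln T = (1 - \<theta>) * ln x" using x3 by (simp add: T_def ln_powr)
      also have "\<dots> \<le> 1 * ln x" using \<theta> x3 by (intro mult_right_mono) auto
      finally have lnx: "ln T \<le> ln x" by simp
      have pw: "ln T powr r \<le> L" if "r \<le> c" for r
      proof -
        have "ln T powr r \<le> ln T powr c" using lnT that by (intro powr_mono) auto
        also have "\<dots> \<le> L" unfolding L_def using lnT lnx by (intro powr_mono2) (auto simp: c_def)
        finally show ?thesis .
      qed
      have L1: "L \<ge> 1" using pw[of 0] lnT by (simp add: c_def)
      have "S \<subseteq> {\<rho> \<in> nontrivial_zeros. - T \<le> Im \<rho> \<and> Im \<rho> \<le> T}" by (auto simp: S_def)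
      then have fin: "finite S" using finite_nontrivial_zeros finite_subset by blast
      have S: "S \<subseteq> nontrivial_zeros" "\<And>\<rho>. \<rho> \<in> S \<Longrightarrow> \<sigma> \<le> Re \<rho>" "\<And>\<rho>. \<rho> \<in> S \<Longrightarrow> Re \<rho> \<le> 1"
        "\<And>\<rho>. \<rho> \<in> S \<Longrightarrow> \<bar>Im \<rho>\<bar> \<le> T"
        by (auto simp: S_def nontrivial_zeros_def)
      have w: "\<And>\<rho>. \<rho> \<in> S \<Longrightarrow> w \<rho> \<ge> 0" by (simp add: w_def)
      have D: "(\<Sum>\<rho>'\<in>S. w \<rho>' / (1 + \<bar>Im \<rho> - Im \<rho>'\<bar>)) \<le> C * L" if "\<rho> \<in> S" for \<rho>
      proof -
        have "(\<Sum>\<rho>'\<in>S. w \<rho>' / (1 + \<bar>Im \<rho> - Im \<rho>'\<bar>)) \<le> C * (ln T)\<^sup>2"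
          unfolding w_def by (rule C(2)[OF T(2) fin S(1) S(4) that])
        also have "(ln T)\<^sup>2 = ln T powr 2" using lnT by simp
        also have "C * \<dots> \<le> C * L" using C(1) by (intro mult_left_mono pw) (auto simp: c_def)
        finally show ?thesis .
      qed
      have D0: "C * L \<ge> 0" using C(1) L1 by simp
      have \<sigma>': "0 \<le> \<sigma>" "\<sigma> \<le> 1" using \<sigma> by auto
      have a: "\<And>m. \<bar>a m\<bar> \<le> 1" "\<And>m. \<bar>b m\<bar> \<le> 1" using ab by auto
      have "(\<Sum>\<rho>\<in>S. w \<rho> * norm (dirichlet_poly a (x powr u) \<rho> * dirichlet_poly b (x powr v) \<rho>))
         \<le> 2 * (K * L) * x powr (1 - \<sigma>)"
      proof (cases "\<sigma> \<le> \<sigma>0")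
        case True
        have mv: "(\<Sum>\<rho>\<in>S. w \<rho> * (norm (dirichlet_poly a (x powr u) \<rho>))\<^sup>2)
           \<le> K * L * x powr (u * (1 - 2 * \<sigma>)) * (x powr u + x powr (1 - \<theta>))"
          if "\<And>m. \<bar>a m\<bar> \<le> 1" for a u
        proof -
          have "(\<Sum>\<rho>\<in>S. w \<rho> * (norm (dirichlet_poly a (x powr u) \<rho>))\<^sup>2)
             \<le> 48 * (C * L) * (x powr u) powr (1 - 2 * \<sigma>) * (x powr u + T)"
            by (rule discrete_mean_value[OF fin w S(2) \<sigma>'(1) S(3,4) _ D D0 _ that]) (use T x3 in auto)
          also have "\<dots> \<le> (K * L) * (x powr u) powr (1 - 2 * \<sigma>) * (x powr u + T)"
            using C(1) C1 L1 T(2) by (intro mult_right_mono) (auto simp: K_def mult.assoc[symmetric] intro!: mult_right_mono)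
          finally show ?thesis by (simp add: powr_powr T_def)
        qed
        show ?thesis
          by (rule sum_product_bound[OF w _ _ mv[OF a(1)] mv[OF a(2)]
              exponents_below[OF \<theta>(1) \<sigma>0(1) True \<sigma>'(2) uv]])
             (use x3 L1 C(1) C1 in \<open>auto simp: K_def\<close>)
      next
        case False
        define e where "e = (1 - \<theta>) * (1 / 2 + (1 - \<sigma>) / (2 * (1 - \<sigma>0)))"
        have s: "\<sigma>0 \<le> \<sigma>" using False by simp
        define \<kappa> where "\<kappa> = (1 - \<sigma>) / (2 * (1 - \<sigma>0))"
        have \<kappa>: "\<kappa> \<ge> 0" using \<sigma>' \<sigma>0 by (simp add: \<kappa>_def)
        have W: "(\<Sum>\<rho>\<in>S. w \<rho>) \<le> C1 * T powr \<kappa> * L"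
        proof -
          have "A \<sigma> \<le> A \<sigma>0" using A(2) s \<sigma>'(2) \<sigma>0 by (auto simp: monotone_on_def)
          then have "A \<sigma> * (1 - \<sigma>) \<le> A \<sigma>0 * (1 - \<sigma>)" using \<sigma>' by (intro mult_right_mono) auto
          then have le: "A \<sigma> * (1 - \<sigma>) \<le> \<kappa>" by (simp add: A(1) \<kappa>_def)
          have "real (zero_count \<sigma> T) \<le> C1' * T powr (A \<sigma> * (1 - \<sigma>)) * ln T powr B"
            using T(1) s \<sigma>0 \<sigma>' by (intro C1') auto
          also have "\<dots> \<le> \<bar>C1'\<bar> * T powr \<kappa> * L"
            using T le pw[of B] by (intro mult_mono powr_mono) (auto simp: c_def)
          finally have 1: "real (zero_count \<sigma> T) \<le> \<bar>C1'\<bar> * T powr \<kappa> * L" .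
          \<comment> \<open>As \<kappa> >= 0, the contribution of the real zeros can be absorbed
            into the density bound.\<close>
          have "1 \<le> T powr \<kappa>" using T \<kappa> by (intro ge_one_powr_ge_zero) auto
          then have "1 * 1 \<le> T powr \<kappa> * L" using L1 by (intro mult_mono) auto
          then have "C0 * ln 3 * 1 \<le> C0 * ln 3 * (T powr \<kappa> * L)" using C0(1) by (intro mult_left_mono) auto
          moreover have "(\<Sum>\<rho>\<in>S. w \<rho>) \<le> 2 * real (zero_count \<sigma> T) + C0 * ln 3"
            unfolding S_def w_def by (rule sum_zero_mult_le_zero_count[OF C0(2) \<sigma>'(1)])
          ultimately show ?thesis using 1 by (simp add: C1_def algebra_simps)
        qed
        have e_eq: "sqrt T * T powr \<kappa> = x powr e"
        proof -
          have "sqrt T * T powr \<kappa> = T powr (1 / 2) * T powr \<kappa>" using T by (simp add: powr_half_sqrt)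
          also have "\<dots> = T powr (1 / 2 + \<kappa>)" by (rule powr_add[symmetric])
          also have "\<dots> = x powr e" by (simp add: T_def powr_powr e_def \<kappa>_def)
          finally show ?thesis .
        qed
        have hm: "(\<Sum>\<rho>\<in>S. w \<rho> * (norm (dirichlet_poly a (x powr u) \<rho>))\<^sup>2)
           \<le> K * L * x powr (u * (1 - 2 * \<sigma>)) * (x powr u + x powr e)"
          if "\<And>m. \<bar>a m\<bar> \<le> 1" for a u
        proof -
          have "(\<Sum>\<rho>\<in>S. w \<rho> * (norm (dirichlet_poly a (x powr u) \<rho>))\<^sup>2)
             \<le> 1512 * (x powr u) powr (1 - 2 * \<sigma>) * (x powr u * (C * L) + sqrt T * (\<Sum>\<rho>\<in>S. w \<rho>))"
            by (rule halasz_montgomery[OF fin w S(2) \<sigma>'(1) S(4) _ D D0 _ that]) (use T x3 in auto)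
          also have "\<dots> \<le> 1512 * (x powr u) powr (1 - 2 * \<sigma>) * (x powr u * ((C + C1) * L) + sqrt T * ((C + C1) * T powr \<kappa> * L))"
          proof (intro mult_left_mono add_mono)
            have "C1 * T powr \<kappa> * L \<le> (C + C1) * T powr \<kappa> * L" using C(1) L1 by (intro mult_right_mono) auto
            then show "(\<Sum>\<rho>\<in>S. w \<rho>) \<le> (C + C1) * T powr \<kappa> * L" using W by linarith
            show "C * L \<le> (C + C1) * L" using C1 L1 by (intro mult_right_mono) auto
          qed (use T in auto)
          also have "\<dots> = (1512 * (C + C1)) * L * (x powr u) powr (1 - 2 * \<sigma>) * (x powr u + x powr e)"
            unfolding e_eq[symmetric] by (simp add: algebra_simps)
          also have "\<dots> \<le> K * L * (x powr u) powr (1 - 2 * \<sigma>) * (x powr u + x powr e)"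
            using C(1) L1 by (intro mult_right_mono) (auto simp: K_def)
          finally show ?thesis by (simp add: powr_powr)
        qed
        show ?thesis
          by (rule sum_product_bound[OF w _ _ hm[OF a(1)] hm[OF a(2)]
              exponents_above[OF \<theta>(1) \<sigma>0 s \<sigma>'(2) \<theta>2 uv e_def]])
             (use x3 L1 C(1) C1 in \<open>auto simp: K_def\<close>)
      qed
      then show "(\<Sum>\<rho> | \<rho> \<in> nontrivial_zeros \<and> \<sigma> \<le> Re \<rho> \<and> \<bar>Im \<rho>\<bar> \<le> x powr (1 - \<theta>).
          real (zero_mult \<rho>) *
          norm (dirichlet_poly a (x powr u) \<rho> * dirichlet_poly b (x powr v) \<rho>))
         \<le> 2 * K * x powr (1 - \<sigma>) * ln x powr c"
        by (simp add: S_def T_def w_def L_def mult_ac)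
    qed
  qed
qed

end
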